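(* Let $(B,\beta)$ be a monoidal Hom-bialgebra, let $(A,\alpha)$ be a left $(B,\beta)$-Hom-module algebra with Hom-action $B\otimes A\to A$, $b\otimes a\mapsto b\cdot a$, and let $(C,\gamma)$ be a left $(B,\beta)$-Hom-comodule coalgebra with Hom-coaction $C\to B\otimes C$, $c\mapsto c_{(-1)}\otimes c_{(0)}$. Define $$\psi:C\otimes A\to A\otimes C,\quad c\otimes a\mapsto c_{(-1)}\cdot\alpha^{-1}(a)\otimes\gamma(c_{(0)}).$$ Then the following hold. (1) $[(A,\alpha),(C,\gamma)]_\psi$ is a Hom-entwining structure. (2) $(M,\mu)$ is an $[(A,\alpha),(C,\gamma)]_\psi$-entwined Hom-module if and only if it is a right $(A,\alpha)$-Hom-module with $\rho_M:M\otimes A\to M$, $m\otimes a\mapsto ma$, and a right $(C,\gamma)$-Hom-comodule with $\rho^M:M\to M\otimes C$, $m\mapsto m_{[0]}\otimes m_{[1]}$, such that $$\rho^M(ma)=m_{[0]}\big(m_{[1](-1)}\cdot\alpha^{-2}(a)\big)\otimes\gamma^2(m_{[1](0)})$$ for all $m\in M$, $a\in A$. (3) $(\mathcal{C},\chi)=(A\otimes C,\alpha\otimes\gamma)$ is an $(A,\alpha)$-Hom-coring with comultiplication $\Delta_{\mathcal{C}}(a\otimes c)=(\alpha^{-1}(a)\otimes c_1)\otimes_A(1\otimes c_2)$, counit $\varepsilon_{\mathcal{C}}(a\otimes c)=\alpha(a)\varepsilon(c)$, and the $(A,\alpha)$-Hom-bimodule structure $a(a'\otimes c)=\alpha^{-1}(a)a'\otimes\gamma(c)$,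 $(a'\otimes c)a=a'(c_{(-1)}\cdot\alpha^{-2}(a))\otimes\gamma^2(c_{(0)})$ for $a,a'\in A$, $c\in C$.
   Context: $k$ is a commutative ring with unit; unadorned $\otimes$ is over $k$. The category $\widetilde{\mathcal{H}}(\mathcal{M}_k)$ has as objects pairs $(M,\mu)$ with $M$ a $k$-module and $\mu$ a $k$-linear automorphism of $M$; morphisms $(M,\mu)\to(N,\nu)$ are $k$-linear maps $f$ with $\nu\circ f=f\circ\mu$; $(M,\mu)\otimes(N,\nu)=(M\otimes N,\mu\otimes\nu)$. A monoidal Hom-algebra $(A,\alpha)$ is an object of $\widetilde{\mathcal{H}}(\mathcal{M}_k)$ with a $k$-linear multiplication and an element $1=1_A$ such that $\alpha(a)(bc)=(ab)\alpha(c)$, $a1_A=1_Aa=\alpha(a)$, $\alpha(ab)=\alpha(a)\alpha(b)$, $\alpha(1_A)=1_A$. A monoidal Hom-coalgebra $(C,\gamma)$ is an object with $k$-linear maps $\Delta(c)=c_1\otimes c_2$ (summation understood) and $\varepsilon:C\to k$ such that $\gamma^{-1}(c_1)\otimes\Delta(c_2)=c_{11}\otimes(c_{12}\otimes\gamma^{-1}(c_2))$, $\varepsilon(c_1)c_2=\gamma^{-1}(c)=c_1\varepsilon(c_2)$ (ordinary scalar multiplication), $\Delta(\gamma(c))=\gamma(c_1)\otimes\gamma(c_2)$, $\varepsilon(\gamma(c))=\varepsilon(c)$. A right $(C,\gamma)$-Hom-comodule is an object $(M,\mu)$ with a $k$-linear map $\rho^M:M\to M\otimes C$, $m\mapsto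 m_{[0]}\otimes m_{[1]}$, such that $\mu^{-1}(m_{[0]})\otimes\Delta(m_{[1]})=m_{[0][0]}\otimes(m_{[0][1]}\otimes\gamma^{-1}(m_{[1]}))$, $m_{[0]}\varepsilon(m_{[1]})=\mu^{-1}(m)$, $\rho^M(\mu(m))=\mu(m_{[0]})\otimes\gamma(m_{[1]})$. A left $(B,\beta)$-Hom-comodule over a monoidal Hom-coalgebra $(B,\beta)$ is an object $(M,\mu)$ with a $k$-linear map $\rho:M\to B\otimes M$, $m\mapsto m_{(-1)}\otimes m_{(0)}$, such that $m_{(-1)1}\otimes m_{(-1)2}\otimes\mu^{-1}(m_{(0)})=\beta^{-1}(m_{(-1)})\otimes m_{(0)(-1)}\otimes m_{(0)(0)}$, $\varepsilon(m_{(-1)})m_{(0)}=\mu^{-1}(m)$, $\rho(\mu(m))=\beta(m_{(-1)})\otimes\mu(m_{(0)})$. A right $(A,\alpha)$-Hom-module is an object $(M,\mu)$ with a $k$-linear map $m\otimes a\mapsto ma$ such that $\mu(m)(ab)=(ma)\alpha(b)$, $m1_A=\mu(m)$, $\mu(ma)=\mu(m)\alpha(a)$. A left one satisfies $\alpha(a)(bm)=(ab)\mu(m)$, $1_Am=\mu(m)$, $\mu(am)=\alpha(a)\mu(m)$. An $(A,\alpha)$-Hom-bimodule is both, with $(am)\alpha(b)=\alpha(a)(mb)$. Bilinear maps are morphisms in $\widetilde{\mathcal{H}}(\mathcal{M}_k)$ commuting with both actions. $(A,\alpha)$ is a Hom-bimodule over itself. For a right Hom-module $(M,\mu)$ and a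 left Hom-module $(N,\nu)$, $M\otimes_AN$ is the quotient of $M\otimes N$ by the relations $ma\otimes n=\mu(m)\otimes a\nu^{-1}(n)$; for Hom-bimodules it is a Hom-bimodule with automorphism $\mu\otimes\nu$ and actions $a(m\otimes_An)=\alpha^{-1}(a)m\otimes_A\nu(n)$, $(m\otimes_An)a=\mu(m)\otimes_An\alpha^{-1}(a)$. An $(A,\alpha)$-Hom-coring is an $(A,\alpha)$-Hom-bimodule $(\mathcal{C},\chi)$ with $(A,\alpha)$-bilinear maps $\Delta_{\mathcal{C}}:\mathcal{C}\to\mathcal{C}\otimes_A\mathcal{C}$, $x\mapsto x_1\otimes_Ax_2$, and $\varepsilon_{\mathcal{C}}:\mathcal{C}\to A$, such that $x_1\otimes_A\Delta_{\mathcal{C}}(x_2)=\chi(x_{11})\otimes_A(x_{12}\otimes_A\chi^{-1}(x_2))$, $\varepsilon_{\mathcal{C}}(x_1)x_2=x=x_1\varepsilon_{\mathcal{C}}(x_2)$, $\Delta_{\mathcal{C}}(\chi(x))=\chi(x_1)\otimes_A\chi(x_2)$, $\varepsilon_{\mathcal{C}}(\chi(x))=\alpha(\varepsilon_{\mathcal{C}}(x))$. A monoidal Hom-bialgebra $(B,\beta)$ is a monoidal Hom-algebra and monoidal Hom-coalgebra (same $\beta$) with $\Delta(bb')=\Delta(b)\Delta(b')$, $\Delta(1)=1\otimes1$, $\varepsilon(bb')=\varepsilon(b)\varepsilon(b')$, $\varepsilon(1)=1$. A left $(B,\beta)$-Hom-module algebra $(A,\alpha)$ is a monoidal Hom-algebra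 and left $(B,\beta)$-Hom-module with $b\cdot(aa')=(b_1\cdot a)(b_2\cdot a')$, $b\cdot1_A=\varepsilon(b)1_A$ (and $\alpha(b\cdot a)=\beta(b)\cdot\alpha(a)$). A left $(B,\beta)$-Hom-comodule coalgebra $(C,\gamma)$ is a monoidal Hom-coalgebra and left $(B,\beta)$-Hom-comodule with $c_{(-1)}\otimes c_{(0)1}\otimes c_{(0)2}=c_{1(-1)}c_{2(-1)}\otimes c_{1(0)}\otimes c_{2(0)}$, $c_{(-1)}\varepsilon_C(c_{(0)})=1_B\varepsilon_C(c)$. A (right-right) Hom-entwining structure $[(A,\alpha),(C,\gamma)]_\psi$ consists of a monoidal Hom-algebra $(A,\alpha)$, a monoidal Hom-coalgebra $(C,\gamma)$ and a morphism $\psi:C\otimes A\to A\otimes C$ in $\widetilde{\mathcal{H}}(\mathcal{M}_k)$, written $\psi(c\otimes a)=a_\kappa\otimes c^\kappa$ (further letters for further applications of $\psi$), such that for all $a,a'\in A$, $c\in C$: $(aa')_\kappa\otimes\gamma(c)^\kappa=a_\kappa a'_\lambda\otimes\gamma(c^{\kappa\lambda})$; $\alpha^{-1}(a_\kappa)\otimes c^\kappa{}_1\otimes c^\kappa{}_2=\alpha^{-1}(a)_{\kappa\lambda}\otimes c_1{}^\lambda\otimes c_2{}^\kappa$; $1_\kappa\otimes c^\kappa=1\otimes c$; $a_\kappa\varepsilon(c^\kappa)=a\varepsilon(c)$. An $[(A,\alpha),(C,\gamma)]_\psi$-entwined Hom-module is an object $(M,\mu)$ that is a right $(A,\alpha)$-Hom-module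 and a right $(C,\gamma)$-Hom-comodule with $\rho^M(ma)=m_{[0]}\alpha^{-1}(a)_\kappa\otimes\gamma(m_{[1]}{}^\kappa)$ for all $m\in M$, $a\in A$. *)

theory Defs
  imports "HOL-Algebra.Module" "HOL-Algebra.AbelCoset"
begin

section \<open>Linear and bilinear maps, free modules, quotients\<close>

definition linear_maps ::
    "('k, 'r) ring_scheme \<Rightarrow> ('k, 'm, 'x) module_scheme \<Rightarrow> ('k, 'n, 'y) module_scheme \<Rightarrow> ('m \<Rightarrow> 'n) set"
  where "linear_maps k M N =
    {f \<in> carrier M \<rightarrow> carrier N.
      (\<forall>x\<in>carrier M. \<forall>y\<in>carrier M. f (x \<oplus>\<^bsub>M\<^esub> y) = f x \<oplus>\<^bsub>N\<^esub> f y) \<and>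
      (\<forall>r\<in>carrier k. \<forall>x\<in>carrier M. f (r \<odot>\<^bsub>M\<^esub> x) = r \<odot>\<^bsub>N\<^esub> f x)}"

text \<open>
  Multiplications and actions, which are linear maps on a tensor product \<open>M \<otimes> N\<close>, are
  represented by the corresponding bilinear maps on \<open>M \<times> N\<close>.
\<close>

definition bilinear_maps ::
    "('k, 'r) ring_scheme \<Rightarrow> ('k, 'm, 'x) module_scheme \<Rightarrow> ('k, 'n, 'y) module_scheme
      \<Rightarrow> ('k, 'p, 'z) module_scheme \<Rightarrow> ('m \<Rightarrow> 'n \<Rightarrow> 'p) set"
  where "bilinear_maps k M N P =
    {f. (\<forall>m\<in>carrier M. f m \<in> linear_maps k N P) \<and>
        (\<forall>n\<in>carrier N. (\<lambda>m. f m n) \<in> linear_maps k M P)}"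

definition base_module :: "('k, 'r) ring_scheme \<Rightarrow> ('k, 'k) module"
  where "base_module k =
    \<lparr>carrier = carrier k, mult = mult k, one = \<one>\<^bsub>k\<^esub>, zero = \<zero>\<^bsub>k\<^esub>, add = add k, smult = mult k\<rparr>"

text \<open>
  Records of type \<open>module\<close> extend those of type \<open>ring\<close>, but the locale \<open>module\<close> does not use
  the fields \<open>mult\<close> and \<open>one\<close>. They are left unspecified in the constructions
  below, and for a monoidal Hom-algebra they carry its multiplication and unit.
\<close>

definition free_module :: "('k, 'r) ring_scheme \<Rightarrow> 's set \<Rightarrow> ('k, 's \<Rightarrow> 'k) module"
  where "free_module k S =
    \<lparr>carrier = {f. (\<forall>p\<in>S. f p \<in> carrier k) \<and> (\<forall>p. p \<notin> S \<longrightarrow> f p = \<zero>\<^bsub>k\<^esub>) \<and> finite {p. f p \<noteq> \<zero>\<^bsub>k\<^esub>}},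
     mult = undefined, one = undefined,
     zero = (\<lambda>p. \<zero>\<^bsub>k\<^esub>), add = (\<lambda>f g p. f p \<oplus>\<^bsub>k\<^esub> g p), smult = (\<lambda>r f p. r \<otimes>\<^bsub>k\<^esub> f p)\<rparr>"

definition free_generator :: "('k, 'r) ring_scheme \<Rightarrow> 's \<Rightarrow> 's \<Rightarrow> 'k"
  where "free_generator k p = (\<lambda>q. if q = p then \<one>\<^bsub>k\<^esub> else \<zero>\<^bsub>k\<^esub>)"

definition free_lift ::
    "('k, 'r) ring_scheme \<Rightarrow> ('k, 'p, 'x) module_scheme \<Rightarrow> ('s \<Rightarrow> 'p) \<Rightarrow> ('s \<Rightarrow> 'k) \<Rightarrow> 'p"
  where "free_lift k P f h = (\<Oplus>\<^bsub>P\<^esub>p\<in>{p. h p \<noteq> \<zero>\<^bsub>k\<^esub>}. h p \<odot>\<^bsub>P\<^esub> f p)"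

definition module_span :: "('k, 'r) ring_scheme \<Rightarrow> ('k, 'm, 'x) module_scheme \<Rightarrow> 'm set \<Rightarrow> 'm set"
  where "module_span k M S = \<Inter>{N. submodule N k M \<and> S \<subseteq> N}"

definition quotient_module :: "('k, 'm, 'x) module_scheme \<Rightarrow> 'm set \<Rightarrow> ('k, 'm set) module"
  where "quotient_module M N =
    \<lparr>carrier = a_rcosets\<^bsub>M\<^esub> N, mult = undefined, one = undefined,
     zero = N, add = set_add M, smult = (\<lambda>r X. \<Union>x\<in>X. N +>\<^bsub>M\<^esub> (r \<odot>\<^bsub>M\<^esub> x))\<rparr>"

text \<open>The map induced on cosets by a map that is constant on each of them.\<close>

definition quotient_lift :: "('m \<Rightarrow> 'p) \<Rightarrow> 'm set \<Rightarrow> 'p"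
  where "quotient_lift f X = the_elem (f ` X)"


section \<open>The tensor product over the base ring\<close>

definition tensor_relations ::
    "('k, 'r) ring_scheme \<Rightarrow> ('k, 'm, 'x) module_scheme \<Rightarrow> ('k, 'n, 'y) module_scheme
      \<Rightarrow> ('m \<times> 'n \<Rightarrow> 'k) set"
  where "tensor_relations k M N =
    (let F = free_module k (carrier M \<times> carrier N); e = free_generator k in
      module_span k F
       ({e (m \<oplus>\<^bsub>M\<^esub> m', n) \<ominus>\<^bsub>F\<^esub> (e (m, n) \<oplus>\<^bsub>F\<^esub> e (m', n)) | m m' n.
          m \<in> carrier M \<and> m' \<in> carrier M \<and> n \<in> carrier N} \<union>
        {e (m, n \<oplus>\<^bsub>N\<^esub> n') \<ominus>\<^bsub>F\<^esub> (e (m, n) \<oplus>\<^bsub>F\<^esub> e (m, n')) | m n n'.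
          m \<in> carrier M \<and> n \<in> carrier N \<and> n' \<in> carrier N} \<union>
        {e (r \<odot>\<^bsub>M\<^esub> m, n) \<ominus>\<^bsub>F\<^esub> (r \<odot>\<^bsub>F\<^esub> e (m, n)) | r m n.
          r \<in> carrier k \<and> m \<in> carrier M \<and> n \<in> carrier N} \<union>
        {e (m, r \<odot>\<^bsub>N\<^esub> n) \<ominus>\<^bsub>F\<^esub> (r \<odot>\<^bsub>F\<^esub> e (m, n)) | r m n.
          r \<in> carrier k \<and> m \<in> carrier M \<and> n \<in> carrier N}))"

type_synonym ('k, 'm, 'n) tensor = "('m \<times> 'n \<Rightarrow> 'k) set"

definition tensor ::
    "('k, 'r) ring_scheme \<Rightarrow> ('k, 'm, 'x) module_scheme \<Rightarrow> ('k, 'n, 'y) module_scheme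
      \<Rightarrow> ('k, ('k, 'm, 'n) tensor) module"
  where "tensor k M N =
    quotient_module (free_module k (carrier M \<times> carrier N)) (tensor_relations k M N)"

definition tens ::
    "('k, 'r) ring_scheme \<Rightarrow> ('k, 'm, 'x) module_scheme \<Rightarrow> ('k, 'n, 'y) module_scheme
      \<Rightarrow> 'm \<Rightarrow> 'n \<Rightarrow> ('k, 'm, 'n) tensor"
  where "tens k M N m n =
    tensor_relations k M N +>\<^bsub>free_module k (carrier M \<times> carrier N)\<^esub> free_generator k (m, n)"

text \<open>
  For \<open>f\<close> bilinear with values in \<open>P\<close>, \<open>tensor_lift k P f\<close> is the induced linear map on the tensor
  product. It also renders Sweedler notation: if \<open>t\<close> is written \<open>t\<^sub>1 \<otimes> t\<^sub>2\<close> (summation understood),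
  then \<open>tensor_lift k P f t\<close> is the sum of the \<open>f t\<^sub>1 t\<^sub>2\<close>.
\<close>

definition tensor_lift ::
    "('k, 'r) ring_scheme \<Rightarrow> ('k, 'p, 'x) module_scheme \<Rightarrow> ('m \<Rightarrow> 'n \<Rightarrow> 'p)
      \<Rightarrow> ('k, 'm, 'n) tensor \<Rightarrow> 'p"
  where "tensor_lift k P f = quotient_lift (free_lift k P (\<lambda>(m, n). f m n))"

definition tensor_map ::
    "('k, 'r) ring_scheme \<Rightarrow> ('k, 'm', 'x) module_scheme \<Rightarrow> ('k, 'n', 'y) module_scheme
      \<Rightarrow> ('m \<Rightarrow> 'm') \<Rightarrow> ('n \<Rightarrow> 'n') \<Rightarrow> ('k, 'm, 'n) tensor \<Rightarrow> ('k, 'm', 'n') tensor"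
  where "tensor_map k M' N' f g = tensor_lift k (tensor k M' N') (\<lambda>m n. tens k M' N' (f m) (g n))"


section \<open>Hom-algebras, Hom-coalgebras, Hom-modules and Hom-comodules\<close>

abbreviation aut_inv :: "('k, 'm, 'x) module_scheme \<Rightarrow> ('m \<Rightarrow> 'm) \<Rightarrow> 'm \<Rightarrow> 'm"
  where "aut_inv M \<mu> \<equiv> inv_into (carrier M) \<mu>"

locale hom_object = module k M
  for k :: "('k, 'r) ring_scheme" and M :: "('k, 'm, 'x) module_scheme" and \<mu> :: "'m \<Rightarrow> 'm" +
  assumes aut_linear: "\<mu> \<in> linear_maps k M M"
    and aut_bij: "bij_betw \<mu> (carrier M) (carrier M)"

locale monoidal_hom_algebra = hom_object k A \<alpha>
  for k :: "('k, 'r) ring_scheme" and A :: "('k, 'a, 'x) module_scheme" and \<alpha> :: "'a \<Rightarrow> 'a" +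
  assumes mult_bilinear: "mult A \<in> bilinear_maps k A A A"
    and one_in_carrier: "\<one>\<^bsub>A\<^esub> \<in> carrier A"
    and hom_assoc: "\<lbrakk>a \<in> carrier A; b \<in> carrier A; c \<in> carrier A\<rbrakk>
      \<Longrightarrow> \<alpha> a \<otimes>\<^bsub>A\<^esub> (b \<otimes>\<^bsub>A\<^esub> c) = (a \<otimes>\<^bsub>A\<^esub> b) \<otimes>\<^bsub>A\<^esub> \<alpha> c"
    and hom_unit_right: "a \<in> carrier A \<Longrightarrow> a \<otimes>\<^bsub>A\<^esub> \<one>\<^bsub>A\<^esub> = \<alpha> a"
    and hom_unit_left: "a \<in> carrier A \<Longrightarrow> \<one>\<^bsub>A\<^esub> \<otimes>\<^bsub>A\<^esub> a = \<alpha> a"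
    and aut_mult: "\<lbrakk>a \<in> carrier A; b \<in> carrier A\<rbrakk> \<Longrightarrow> \<alpha> (a \<otimes>\<^bsub>A\<^esub> b) = \<alpha> a \<otimes>\<^bsub>A\<^esub> \<alpha> b"
    and aut_one: "\<alpha> \<one>\<^bsub>A\<^esub> = \<one>\<^bsub>A\<^esub>"

locale monoidal_hom_coalgebra = hom_object k C \<gamma>
  for k :: "('k, 'r) ring_scheme" and C :: "('k, 'c, 'x) module_scheme" and \<gamma> :: "'c \<Rightarrow> 'c"
    and \<Delta> :: "'c \<Rightarrow> ('k, 'c, 'c) tensor" and \<epsilon> :: "'c \<Rightarrow> 'k" +
  assumes comult_linear: "\<Delta> \<in> linear_maps k C (tensor k C C)"
    and counit_linear: "\<epsilon> \<in> linear_maps k C (base_module k)"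
    and hom_coassoc: "c \<in> carrier C \<Longrightarrow>
      tensor_lift k (tensor k C (tensor k C C))
        (\<lambda>c1 c2. tens k C (tensor k C C) (aut_inv C \<gamma> c1) (\<Delta> c2)) (\<Delta> c) =
      tensor_lift k (tensor k C (tensor k C C))
        (\<lambda>c1 c2. tensor_lift k (tensor k C (tensor k C C))
          (\<lambda>c11 c12. tens k C (tensor k C C) c11 (tens k C C c12 (aut_inv C \<gamma> c2))) (\<Delta> c1)) (\<Delta> c)"
    and hom_counit_left: "c \<in> carrier C \<Longrightarrow>
      tensor_lift k C (\<lambda>c1 c2. \<epsilon> c1 \<odot>\<^bsub>C\<^esub> c2) (\<Delta> c) = aut_inv C \<gamma> c"
    and hom_counit_right: "c \<in> carrier C \<Longrightarrow>
      tensor_lift k C (\<lambda>c1 c2. \<epsilon> c2 \<odot>\<^bsub>C\<^esub> c1) (\<Delta> c) = aut_inv C \<gamma> c"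
    and comult_aut: "c \<in> carrier C \<Longrightarrow> \<Delta> (\<gamma> c) = tensor_map k C C \<gamma> \<gamma> (\<Delta> c)"
    and counit_aut: "c \<in> carrier C \<Longrightarrow> \<epsilon> (\<gamma> c) = \<epsilon> c"

locale right_hom_comodule =
  C: monoidal_hom_coalgebra k C \<gamma> \<Delta> \<epsilon> + M: hom_object k M \<mu>
  for k :: "('k, 'r) ring_scheme" and C :: "('k, 'c, 'x) module_scheme" and \<gamma> :: "'c \<Rightarrow> 'c"
    and \<Delta> :: "'c \<Rightarrow> ('k, 'c, 'c) tensor" and \<epsilon> :: "'c \<Rightarrow> 'k"
    and M :: "('k, 'm, 'y) module_scheme" and \<mu> :: "'m \<Rightarrow> 'm"
    and \<rho> :: "'m \<Rightarrow> ('k, 'm, 'c) tensor" +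
  assumes coact_linear: "\<rho> \<in> linear_maps k M (tensor k M C)"
    and hom_coact_coassoc: "m \<in> carrier M \<Longrightarrow>
      tensor_lift k (tensor k M (tensor k C C))
        (\<lambda>m0 m1. tens k M (tensor k C C) (aut_inv M \<mu> m0) (\<Delta> m1)) (\<rho> m) =
      tensor_lift k (tensor k M (tensor k C C))
        (\<lambda>m0 m1. tensor_lift k (tensor k M (tensor k C C))
          (\<lambda>m00 m01. tens k M (tensor k C C) m00 (tens k C C m01 (aut_inv C \<gamma> m1))) (\<rho> m0)) (\<rho> m)"
    and hom_coact_counit: "m \<in> carrier M \<Longrightarrow>
      tensor_lift k M (\<lambda>m0 m1. \<epsilon> m1 \<odot>\<^bsub>M\<^esub> m0) (\<rho> m) = aut_inv M \<mu> m"
    and coact_aut: "m \<in> carrier M \<Longrightarrow> \<rho> (\<mu> m) = tensor_map k M C \<mu> \<gamma> (\<rho> m)"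

locale left_hom_comodule =
  B: monoidal_hom_coalgebra k B \<beta> \<Delta> \<epsilon> + M: hom_object k M \<mu>
  for k :: "('k, 'r) ring_scheme" and B :: "('k, 'b, 'x) module_scheme" and \<beta> :: "'b \<Rightarrow> 'b"
    and \<Delta> :: "'b \<Rightarrow> ('k, 'b, 'b) tensor" and \<epsilon> :: "'b \<Rightarrow> 'k"
    and M :: "('k, 'm, 'y) module_scheme" and \<mu> :: "'m \<Rightarrow> 'm"
    and \<rho> :: "'m \<Rightarrow> ('k, 'b, 'm) tensor" +
  assumes coact_linear: "\<rho> \<in> linear_maps k M (tensor k B M)"
    and hom_coact_coassoc: "m \<in> carrier M \<Longrightarrow>
      tensor_lift k (tensor k B (tensor k B M))
        (\<lambda>b m0. tensor_lift k (tensor k B (tensor k B M))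
          (\<lambda>b1 b2. tens k B (tensor k B M) b1 (tens k B M b2 (aut_inv M \<mu> m0))) (\<Delta> b)) (\<rho> m) =
      tensor_lift k (tensor k B (tensor k B M))
        (\<lambda>b m0. tens k B (tensor k B M) (aut_inv B \<beta> b) (\<rho> m0)) (\<rho> m)"
    and hom_coact_counit: "m \<in> carrier M \<Longrightarrow>
      tensor_lift k M (\<lambda>b m0. \<epsilon> b \<odot>\<^bsub>M\<^esub> m0) (\<rho> m) = aut_inv M \<mu> m"
    and coact_aut: "m \<in> carrier M \<Longrightarrow> \<rho> (\<mu> m) = tensor_map k B M \<beta> \<mu> (\<rho> m)"

locale right_hom_module =
  A: monoidal_hom_algebra k A \<alpha> + M: hom_object k M \<mu>
  for k :: "('k, 'r) ring_scheme" and A :: "('k, 'a, 'x) module_scheme" and \<alpha> :: "'a \<Rightarrow> 'a"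
    and M :: "('k, 'm, 'y) module_scheme" and \<mu> :: "'m \<Rightarrow> 'm" and ra :: "'m \<Rightarrow> 'a \<Rightarrow> 'm" +
  assumes ract_bilinear: "ra \<in> bilinear_maps k M A M"
    and hom_ract_assoc: "\<lbrakk>m \<in> carrier M; a \<in> carrier A; b \<in> carrier A\<rbrakk>
      \<Longrightarrow> ra (\<mu> m) (a \<otimes>\<^bsub>A\<^esub> b) = ra (ra m a) (\<alpha> b)"
    and hom_ract_one: "m \<in> carrier M \<Longrightarrow> ra m \<one>\<^bsub>A\<^esub> = \<mu> m"
    and ract_aut: "\<lbrakk>m \<in> carrier M; a \<in> carrier A\<rbrakk> \<Longrightarrow> \<mu> (ra m a) = ra (\<mu> m) (\<alpha> a)"

locale left_hom_module =
  A: monoidal_hom_algebra k A \<alpha> + M: hom_object k M \<mu>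
  for k :: "('k, 'r) ring_scheme" and A :: "('k, 'a, 'x) module_scheme" and \<alpha> :: "'a \<Rightarrow> 'a"
    and M :: "('k, 'm, 'y) module_scheme" and \<mu> :: "'m \<Rightarrow> 'm" and la :: "'a \<Rightarrow> 'm \<Rightarrow> 'm" +
  assumes lact_bilinear: "la \<in> bilinear_maps k A M M"
    and hom_lact_assoc: "\<lbrakk>a \<in> carrier A; b \<in> carrier A; m \<in> carrier M\<rbrakk>
      \<Longrightarrow> la (\<alpha> a) (la b m) = la (a \<otimes>\<^bsub>A\<^esub> b) (\<mu> m)"
    and hom_lact_one: "m \<in> carrier M \<Longrightarrow> la \<one>\<^bsub>A\<^esub> m = \<mu> m"
    and lact_aut: "\<lbrakk>a \<in> carrier A; m \<in> carrier M\<rbrakk> \<Longrightarrow> \<mu> (la a m) = la (\<alpha> a) (\<mu> m)"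


section \<open>Hom-bimodules, their tensor product, and Hom-corings\<close>

record ('k, 'm, 'a) hom_bimod = "('k, 'm) module" +
  aut :: "'m \<Rightarrow> 'm"
  lact :: "'a \<Rightarrow> 'm \<Rightarrow> 'm"
  ract :: "'m \<Rightarrow> 'a \<Rightarrow> 'm"

definition hom_bimod_of ::
    "('k, 'm, 'x) module_scheme \<Rightarrow> ('m \<Rightarrow> 'm) \<Rightarrow> ('a \<Rightarrow> 'm \<Rightarrow> 'm) \<Rightarrow> ('m \<Rightarrow> 'a \<Rightarrow> 'm)
      \<Rightarrow> ('k, 'm, 'a) hom_bimod"
  where "hom_bimod_of M \<mu> la ra =
    \<lparr>carrier = carrier M, mult = mult M, one = \<one>\<^bsub>M\<^esub>, zero = \<zero>\<^bsub>M\<^esub>, add = add M, smult = smult M,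
     aut = \<mu>, lact = la, ract = ra\<rparr>"

locale hom_bimodule =
  left_hom_module k A \<alpha> M "aut M" "lact M" + right_hom_module k A \<alpha> M "aut M" "ract M"
  for k :: "('k, 'r) ring_scheme" and A :: "('k, 'a, 'x) module_scheme" and \<alpha> :: "'a \<Rightarrow> 'a"
    and M :: "('k, 'm, 'a, 'y) hom_bimod_scheme" +
  assumes hom_bimodule_assoc: "\<lbrakk>a \<in> carrier A; m \<in> carrier M; b \<in> carrier A\<rbrakk>
    \<Longrightarrow> ract M (lact M a m) (\<alpha> b) = lact M (\<alpha> a) (ract M m b)"

definition balanced_relations ::
    "('k, 'r) ring_scheme \<Rightarrow> ('k, 'a, 'x) module_scheme \<Rightarrow> ('k, 'm, 'a, 'y) hom_bimod_scheme
      \<Rightarrow> ('k, 'n, 'a, 'z) hom_bimod_scheme \<Rightarrow> ('k, 'm, 'n) tensor set"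
  where "balanced_relations k A M N =
    module_span k (tensor k M N)
      {tens k M N (ract M m a) n \<ominus>\<^bsub>tensor k M N\<^esub>
         tens k M N (aut M m) (lact N a (aut_inv N (aut N) n)) | m a n.
       m \<in> carrier M \<and> a \<in> carrier A \<and> n \<in> carrier N}"

definition hom_tens ::
    "('k, 'r) ring_scheme \<Rightarrow> ('k, 'a, 'x) module_scheme \<Rightarrow> ('k, 'm, 'a, 'y) hom_bimod_scheme
      \<Rightarrow> ('k, 'n, 'a, 'z) hom_bimod_scheme \<Rightarrow> 'm \<Rightarrow> 'n \<Rightarrow> ('k, 'm, 'n) tensor set"
  where "hom_tens k A M N m n = balanced_relations k A M N +>\<^bsub>tensor k M N\<^esub> tens k M N m n"

text \<open>
  The analogue of \<open>tensor_lift\<close> for the tensor product over \<open>A\<close>; \<open>f\<close> has to be bilinear and to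
  respect the relations \<open>ma \<otimes> n = \<mu>(m) \<otimes> a\<nu>\<^sup>-\<^sup>1(n)\<close>.
\<close>

definition hom_tensor_lift ::
    "('k, 'r) ring_scheme \<Rightarrow> ('k, 'p, 'x) module_scheme \<Rightarrow> ('m \<Rightarrow> 'n \<Rightarrow> 'p)
      \<Rightarrow> ('k, 'm, 'n) tensor set \<Rightarrow> 'p"
  where "hom_tensor_lift k P f = quotient_lift (tensor_lift k P f)"

definition hom_tensor ::
    "('k, 'r) ring_scheme \<Rightarrow> ('k, 'a, 'x) module_scheme \<Rightarrow> ('a \<Rightarrow> 'a)
      \<Rightarrow> ('k, 'm, 'a, 'y) hom_bimod_scheme \<Rightarrow> ('k, 'n, 'a, 'z) hom_bimod_scheme
      \<Rightarrow> ('k, ('k, 'm, 'n) tensor set, 'a) hom_bimod"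
  where "hom_tensor k A \<alpha> M N =
    (let Q = quotient_module (tensor k M N) (balanced_relations k A M N);
         t = hom_tens k A M N
     in hom_bimod_of Q
          (hom_tensor_lift k Q (\<lambda>m n. t (aut M m) (aut N n)))
          (\<lambda>a. hom_tensor_lift k Q (\<lambda>m n. t (lact M (aut_inv A \<alpha> a) m) (aut N n)))
          (\<lambda>x a. hom_tensor_lift k Q (\<lambda>m n. t (aut M m) (ract N n (aut_inv A \<alpha> a))) x))"

definition bimodule_maps ::
    "('k, 'r) ring_scheme \<Rightarrow> ('k, 'a, 'x) module_scheme \<Rightarrow> ('k, 'm, 'a, 'y) hom_bimod_scheme
      \<Rightarrow> ('k, 'n, 'a, 'z) hom_bimod_scheme \<Rightarrow> ('m \<Rightarrow> 'n) set"
  where "bimodule_maps k A M N =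
    {f \<in> linear_maps k M N.
      (\<forall>m\<in>carrier M. f (aut M m) = aut N (f m)) \<and>
      (\<forall>a\<in>carrier A. \<forall>m\<in>carrier M. f (lact M a m) = lact N a (f m)) \<and>
      (\<forall>m\<in>carrier M. \<forall>a\<in>carrier A. f (ract M m a) = ract N (f m) a)}"

definition regular_bimod ::
    "('k, 'a, 'x) module_scheme \<Rightarrow> ('a \<Rightarrow> 'a) \<Rightarrow> ('k, 'a, 'a) hom_bimod"
  where "regular_bimod A \<alpha> = hom_bimod_of A \<alpha> (mult A) (mult A)"

locale hom_coring = hom_bimodule k A \<alpha> C
  for k :: "('k, 'r) ring_scheme" and A :: "('k, 'a, 'x) module_scheme" and \<alpha> :: "'a \<Rightarrow> 'a"
    and C :: "('k, 'c, 'a, 'y) hom_bimod_scheme"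
    and \<Delta> :: "'c \<Rightarrow> ('k, 'c, 'c) tensor set" and \<epsilon> :: "'c \<Rightarrow> 'a" +
  assumes comult_bimodule_map: "\<Delta> \<in> bimodule_maps k A C (hom_tensor k A \<alpha> C C)"
    and counit_bimodule_map: "\<epsilon> \<in> bimodule_maps k A C (regular_bimod A \<alpha>)"
    and coring_coassoc: "x \<in> carrier C \<Longrightarrow>
      hom_tensor_lift k (hom_tensor k A \<alpha> C (hom_tensor k A \<alpha> C C))
        (\<lambda>x1 x2. hom_tens k A C (hom_tensor k A \<alpha> C C) x1 (\<Delta> x2)) (\<Delta> x) =
      hom_tensor_lift k (hom_tensor k A \<alpha> C (hom_tensor k A \<alpha> C C))
        (\<lambda>x1 x2. hom_tensor_lift k (hom_tensor k A \<alpha> C (hom_tensor k A \<alpha> C C))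
          (\<lambda>x11 x12. hom_tens k A C (hom_tensor k A \<alpha> C C)
             (aut C x11) (hom_tens k A C C x12 (aut_inv C (aut C) x2))) (\<Delta> x1)) (\<Delta> x)"
    and coring_counit_left: "x \<in> carrier C \<Longrightarrow>
      hom_tensor_lift k C (\<lambda>x1 x2. lact C (\<epsilon> x1) x2) (\<Delta> x) = x"
    and coring_counit_right: "x \<in> carrier C \<Longrightarrow>
      hom_tensor_lift k C (\<lambda>x1 x2. ract C x1 (\<epsilon> x2)) (\<Delta> x) = x"
    and coring_comult_aut: "x \<in> carrier C \<Longrightarrow>
      \<Delta> (aut C x) =
      hom_tensor_lift k (hom_tensor k A \<alpha> C C)
        (\<lambda>x1 x2. hom_tens k A C C (aut C x1) (aut C x2)) (\<Delta> x)"
    and coring_counit_aut: "x \<in> carrier C \<Longrightarrow> \<epsilon> (aut C x) = \<alpha> (\<epsilon> x)"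


section \<open>Hom-bialgebras, module algebras and comodule coalgebras\<close>

locale monoidal_hom_bialgebra =
  monoidal_hom_algebra k B \<beta> + monoidal_hom_coalgebra k B \<beta> \<Delta> \<epsilon>
  for k :: "('k, 'r) ring_scheme" and B :: "('k, 'b, 'x) module_scheme" and \<beta> :: "'b \<Rightarrow> 'b"
    and \<Delta> :: "'b \<Rightarrow> ('k, 'b, 'b) tensor" and \<epsilon> :: "'b \<Rightarrow> 'k" +
  assumes comult_mult: "\<lbrakk>b \<in> carrier B; b' \<in> carrier B\<rbrakk> \<Longrightarrow>
      \<Delta> (b \<otimes>\<^bsub>B\<^esub> b') =
      tensor_lift k (tensor k B B)
        (\<lambda>b1 b2. tensor_lift k (tensor k B B)
          (\<lambda>b1' b2'. tens k B B (b1 \<otimes>\<^bsub>B\<^esub> b1') (b2 \<otimes>\<^bsub>B\<^esub> b2')) (\<Delta> b')) (\<Delta> b)"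
    and comult_one: "\<Delta> \<one>\<^bsub>B\<^esub> = tens k B B \<one>\<^bsub>B\<^esub> \<one>\<^bsub>B\<^esub>"
    and counit_mult: "\<lbrakk>b \<in> carrier B; b' \<in> carrier B\<rbrakk> \<Longrightarrow> \<epsilon> (b \<otimes>\<^bsub>B\<^esub> b') = \<epsilon> b \<otimes>\<^bsub>k\<^esub> \<epsilon> b'"
    and counit_one: "\<epsilon> \<one>\<^bsub>B\<^esub> = \<one>\<^bsub>k\<^esub>"

locale left_hom_module_algebra =
  B: monoidal_hom_bialgebra k B \<beta> \<Delta> \<epsilon> + A: monoidal_hom_algebra k A \<alpha> +
  left_hom_module k B \<beta> A \<alpha> la
  for k :: "('k, 'r) ring_scheme" and B :: "('k, 'b, 'x) module_scheme" and \<beta> :: "'b \<Rightarrow> 'b"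
    and \<Delta> :: "'b \<Rightarrow> ('k, 'b, 'b) tensor" and \<epsilon> :: "'b \<Rightarrow> 'k"
    and A :: "('k, 'a, 'y) module_scheme" and \<alpha> :: "'a \<Rightarrow> 'a" and la :: "'b \<Rightarrow> 'a \<Rightarrow> 'a" +
  assumes lact_mult: "\<lbrakk>b \<in> carrier B; a \<in> carrier A; a' \<in> carrier A\<rbrakk> \<Longrightarrow>
      la b (a \<otimes>\<^bsub>A\<^esub> a') = tensor_lift k A (\<lambda>b1 b2. la b1 a \<otimes>\<^bsub>A\<^esub> la b2 a') (\<Delta> b)"
    and lact_one: "b \<in> carrier B \<Longrightarrow> la b \<one>\<^bsub>A\<^esub> = \<epsilon> b \<odot>\<^bsub>A\<^esub> \<one>\<^bsub>A\<^esub>"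

locale left_hom_comodule_coalgebra =
  B: monoidal_hom_bialgebra k B \<beta> \<Delta>B \<epsilon>B + C: monoidal_hom_coalgebra k C \<gamma> \<Delta>C \<epsilon>C +
  left_hom_comodule k B \<beta> \<Delta>B \<epsilon>B C \<gamma> \<rho>
  for k :: "('k, 'r) ring_scheme" and B :: "('k, 'b, 'x) module_scheme" and \<beta> :: "'b \<Rightarrow> 'b"
    and \<Delta>B :: "'b \<Rightarrow> ('k, 'b, 'b) tensor" and \<epsilon>B :: "'b \<Rightarrow> 'k"
    and C :: "('k, 'c, 'y) module_scheme" and \<gamma> :: "'c \<Rightarrow> 'c"
    and \<Delta>C :: "'c \<Rightarrow> ('k, 'c, 'c) tensor" and \<epsilon>C :: "'c \<Rightarrow> 'k"
    and \<rho> :: "'c \<Rightarrow> ('k, 'b, 'c) tensor" +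
  assumes coact_comult: "c \<in> carrier C \<Longrightarrow>
      tensor_lift k (tensor k B (tensor k C C))
        (\<lambda>b c0. tens k B (tensor k C C) b (\<Delta>C c0)) (\<rho> c) =
      tensor_lift k (tensor k B (tensor k C C))
        (\<lambda>c1 c2. tensor_lift k (tensor k B (tensor k C C))
          (\<lambda>b1 c10. tensor_lift k (tensor k B (tensor k C C))
            (\<lambda>b2 c20. tens k B (tensor k C C) (b1 \<otimes>\<^bsub>B\<^esub> b2) (tens k C C c10 c20)) (\<rho> c2)) (\<rho> c1))
        (\<Delta>C c)"
    and coact_counit: "c \<in> carrier C \<Longrightarrow>
      tensor_lift k B (\<lambda>b c0. \<epsilon>C c0 \<odot>\<^bsub>B\<^esub> b) (\<rho> c) = \<epsilon>C c \<odot>\<^bsub>B\<^esub> \<one>\<^bsub>B\<^esub>"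


section \<open>Hom-entwining structures and entwined Hom-modules\<close>

locale hom_entwining =
  A: monoidal_hom_algebra k A \<alpha> + C: monoidal_hom_coalgebra k C \<gamma> \<Delta> \<epsilon>
  for k :: "('k, 'r) ring_scheme" and A :: "('k, 'a, 'x) module_scheme" and \<alpha> :: "'a \<Rightarrow> 'a"
    and C :: "('k, 'c, 'y) module_scheme" and \<gamma> :: "'c \<Rightarrow> 'c"
    and \<Delta> :: "'c \<Rightarrow> ('k, 'c, 'c) tensor" and \<epsilon> :: "'c \<Rightarrow> 'k"
    and \<psi> :: "('k, 'c, 'a) tensor \<Rightarrow> ('k, 'a, 'c) tensor" +
  assumes entw_linear: "\<psi> \<in> linear_maps k (tensor k C A) (tensor k A C)"
    and entw_aut: "t \<in> carrier (tensor k C A) \<Longrightarrow>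
      tensor_map k A C \<alpha> \<gamma> (\<psi> t) = \<psi> (tensor_map k C A \<gamma> \<alpha> t)"
    and entw_mult: "\<lbrakk>a \<in> carrier A; a' \<in> carrier A; c \<in> carrier C\<rbrakk> \<Longrightarrow>
      \<psi> (tens k C A (\<gamma> c) (a \<otimes>\<^bsub>A\<^esub> a')) =
      tensor_lift k (tensor k A C)
        (\<lambda>a\<kappa> c\<kappa>. tensor_lift k (tensor k A C)
          (\<lambda>a'\<nu> c\<kappa>\<nu>. tens k A C (a\<kappa> \<otimes>\<^bsub>A\<^esub> a'\<nu>) (\<gamma> c\<kappa>\<nu>)) (\<psi> (tens k C A c\<kappa> a')))
        (\<psi> (tens k C A c a))"
    and entw_comult: "\<lbrakk>a \<in> carrier A; c \<in> carrier C\<rbrakk> \<Longrightarrow>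
      tensor_lift k (tensor k A (tensor k C C))
        (\<lambda>a\<kappa> c\<kappa>. tens k A (tensor k C C) (aut_inv A \<alpha> a\<kappa>) (\<Delta> c\<kappa>)) (\<psi> (tens k C A c a)) =
      tensor_lift k (tensor k A (tensor k C C))
        (\<lambda>c1 c2. tensor_lift k (tensor k A (tensor k C C))
          (\<lambda>a\<kappa> c2\<kappa>. tensor_lift k (tensor k A (tensor k C C))
            (\<lambda>a\<kappa>\<nu> c1\<nu>. tens k A (tensor k C C) a\<kappa>\<nu> (tens k C C c1\<nu> c2\<kappa>)) (\<psi> (tens k C A c1 a\<kappa>)))
          (\<psi> (tens k C A c2 (aut_inv A \<alpha> a)))) (\<Delta> c)"
    and entw_one: "c \<in> carrier C \<Longrightarrow> \<psi> (tens k C A c \<one>\<^bsub>A\<^esub>) = tens k A C \<one>\<^bsub>A\<^esub> c"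
    and entw_counit: "\<lbrakk>a \<in> carrier A; c \<in> carrier C\<rbrakk> \<Longrightarrow>
      tensor_lift k A (\<lambda>a\<kappa> c\<kappa>. \<epsilon> c\<kappa> \<odot>\<^bsub>A\<^esub> a\<kappa>) (\<psi> (tens k C A c a)) = \<epsilon> c \<odot>\<^bsub>A\<^esub> a"

locale entwined_hom_module =
  hom_entwining k A \<alpha> C \<gamma> \<Delta> \<epsilon> \<psi> + right_hom_module k A \<alpha> M \<mu> ra +
  right_hom_comodule k C \<gamma> \<Delta> \<epsilon> M \<mu> \<rho>
  for k :: "('k, 'r) ring_scheme" and A :: "('k, 'a, 'x) module_scheme" and \<alpha> :: "'a \<Rightarrow> 'a"
    and C :: "('k, 'c, 'y) module_scheme" and \<gamma> :: "'c \<Rightarrow> 'c"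
    and \<Delta> :: "'c \<Rightarrow> ('k, 'c, 'c) tensor" and \<epsilon> :: "'c \<Rightarrow> 'k"
    and \<psi> :: "('k, 'c, 'a) tensor \<Rightarrow> ('k, 'a, 'c) tensor"
    and M :: "('k, 'm, 'z) module_scheme" and \<mu> :: "'m \<Rightarrow> 'm"
    and ra :: "'m \<Rightarrow> 'a \<Rightarrow> 'm" and \<rho> :: "'m \<Rightarrow> ('k, 'm, 'c) tensor" +
  assumes entwined: "\<lbrakk>m \<in> carrier M; a \<in> carrier A\<rbrakk> \<Longrightarrow>
      \<rho> (ra m a) =
      tensor_lift k (tensor k M C)
        (\<lambda>m0 m1. tensor_lift k (tensor k M C)
          (\<lambda>a\<kappa> m1\<kappa>. tens k M C (ra m0 a\<kappa>) (\<gamma> m1\<kappa>)) (\<psi> (tens k C A m1 (aut_inv A \<alpha> a))))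
        (\<rho> m)"

end

theory Submission
  imports Defs
begin

text \<open>
  Every identity to be proved is an equality of two linear maps on a tensor product, so it holds
  as soon as it holds on pure tensors. On pure tensors both sides are iterated Sweedler sums, that is,
  multilinear expressions summed over \<open>\<Delta>\<^sub>B\<close>, \<open>\<Delta>\<^sub>C\<close> or the coaction of \<open>C\<close>. Linear maps
  can be moved inside such sums and automorphisms can be moved to the innermost arguments; after that,
  each identity reduces to a single axiom of the data, used with an arbitrary multilinear map in place of
  the pure tensor (\<open>coact_coassoc\<close>, \<open>comult_coassoc\<close>, \<open>coact_comult\<close>, \<open>coact_counitB\<close>,
  \<open>coact_counitC\<close>, \<open>comult_counit\<close>).

  Which axiom is responsible for what: \<open>\<psi>\<close> respects the multiplication of \<open>A\<close> because \<open>b\<cdot>(aa') = (b\<^sub>1\<cdot>a)(b\<^sub>2\<cdot>a')\<close>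
  turns one coaction into a comultiplication of \<open>B\<close>, which coassociativity of the coaction
  turns into a double coaction. It respects the comultiplication of \<open>C\<close> because \<open>C\<close> is a comodule
  coalgebra, so that \<open>c\<^sub>(\<^sub>-\<^sub>1\<^sub>)\<close> becomes a product \<open>c\<^sub>1\<^sub>(\<^sub>-\<^sub>1\<^sub>)c\<^sub>2\<^sub>(\<^sub>-\<^sub>1\<^sub>)\<close>, which acts as a composite of two
  actions. The unit law comes from \<open>b\<cdot>1 = \<epsilon>(b)1\<close> and the counit axiom of the coaction, the counit law
  from \<open>c\<^sub>(\<^sub>-\<^sub>1\<^sub>)\<epsilon>(c\<^sub>(\<^sub>0\<^sub>)) = 1\<epsilon>(c)\<close> and the unit axiom of the action. The compatibility condition for entwined Hom-modules in terms of \<open>\<psi>\<close> and the one in terms of the coaction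
  have equal right-hand sides, because \<open>\<psi>\<close> is evaluated on a pure tensor there (\<open>entwined_condition\<close>).

  For the Hom-coring \<open>A \<otimes> C\<close> the same computations give the Hom-bimodule axioms. The one new point is
  right linearity of the comultiplication (\<open>comultAC_ract\<close>): the scalar acts on the second factor
  \<open>1 \<otimes> c\<^sub>2\<close> of \<open>\<Delta>(a \<otimes> c)\<close>, producing an element of \<open>A\<close> that the relations of \<open>\<otimes>\<^sub>A\<close> carry over to the
  first factor (\<open>tens2_balance\<close>), where it meets the coaction of \<open>c\<^sub>1\<close>; then the comodule coalgebra axiom applies
  again. Coassociativity and counit are inherited from \<open>C\<close>, once the maps in their formulas are known to
  be balanced over \<open>A\<close>; that holds for every bimodule map \<open>M \<rightarrow> M \<otimes>\<^sub>A M\<close>.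
\<close>

section \<open>Linear maps\<close>

lemma linear_mapsI:
  assumes "\<And>x. x \<in> carrier M \<Longrightarrow> f x \<in> carrier N"
    and "\<And>x y. \<lbrakk>x \<in> carrier M; y \<in> carrier M\<rbrakk> \<Longrightarrow> f (x \<oplus>\<^bsub>M\<^esub> y) = f x \<oplus>\<^bsub>N\<^esub> f y"
    and "\<And>r x. \<lbrakk>r \<in> carrier k; x \<in> carrier M\<rbrakk> \<Longrightarrow> f (r \<odot>\<^bsub>M\<^esub> x) = r \<odot>\<^bsub>N\<^esub> f x"
  shows "f \<in> linear_maps k M N"
  using assms by (auto simp: linear_maps_def)

lemma linear_closed: "\<lbrakk>f \<in> linear_maps k M N; x \<in> carrier M\<rbrakk> \<Longrightarrow> f x \<in> carrier N"
  by (auto simp: linear_maps_def)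

lemma linear_add:
  "\<lbrakk>f \<in> linear_maps k M N; x \<in> carrier M; y \<in> carrier M\<rbrakk> \<Longrightarrow> f (x \<oplus>\<^bsub>M\<^esub> y) = f x \<oplus>\<^bsub>N\<^esub> f y"
  by (auto simp: linear_maps_def)

lemma linear_smult:
  "\<lbrakk>f \<in> linear_maps k M N; r \<in> carrier k; x \<in> carrier M\<rbrakk> \<Longrightarrow> f (r \<odot>\<^bsub>M\<^esub> x) = r \<odot>\<^bsub>N\<^esub> f x"
  by (auto simp: linear_maps_def)

lemma linear_zero:
  assumes "f \<in> linear_maps k M N" "module k M" "module k N"
  shows "f \<zero>\<^bsub>M\<^esub> = \<zero>\<^bsub>N\<^esub>"
proof -
  interpret M: module k M by fact
  interpret N: module k N by fact
  have "f (\<zero>\<^bsub>k\<^esub> \<odot>\<^bsub>M\<^esub> \<zero>\<^bsub>M\<^esub>) = \<zero>\<^bsub>k\<^esub> \<odot>\<^bsub>N\<^esub> f \<zero>\<^bsub>M\<^esub>"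
    using assms by (intro linear_smult[OF assms(1)]) auto
  then show ?thesis using linear_closed[OF assms(1)] by simp
qed

lemma linear_uminus:
  assumes "f \<in> linear_maps k M N" "module k M" "module k N" "x \<in> carrier M"
  shows "f (\<ominus>\<^bsub>M\<^esub> x) = \<ominus>\<^bsub>N\<^esub> f x"
proof -
  interpret M: module k M by fact
  interpret N: module k N by fact
  have "f ((\<ominus>\<^bsub>k\<^esub> \<one>\<^bsub>k\<^esub>) \<odot>\<^bsub>M\<^esub> x) = (\<ominus>\<^bsub>k\<^esub> \<one>\<^bsub>k\<^esub>) \<odot>\<^bsub>N\<^esub> f x"
    using assms by (intro linear_smult[OF assms(1)]) auto
  then show ?thesis
    using linear_closed[OF assms(1)] assms(4) by (simp add: M.smult_l_minus N.smult_l_minus)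
qed

lemma linear_diff:
  assumes "f \<in> linear_maps k M N" "module k M" "module k N" "x \<in> carrier M" "y \<in> carrier M"
  shows "f (x \<ominus>\<^bsub>M\<^esub> y) = f x \<ominus>\<^bsub>N\<^esub> f y"
proof -
  interpret M: module k M by fact
  interpret N: module k N by fact
  show ?thesis using assms by (simp add: a_minus_def linear_add[OF assms(1)] linear_uminus)
qed

text \<open>
  Quotient modules and Hom-bimodule records are both surjective images of a module structure that is
  already known, so the axioms are transported instead of being verified again.
\<close>

lemma module_image:
  assumes "module k M"
    and onto: "carrier Q = \<pi> ` carrier M"
    and add: "\<And>x y. \<lbrakk>x \<in> carrier M; y \<in> carrier M\<rbrakk> \<Longrightarrow> \<pi> x \<oplus>\<^bsub>Q\<^esub> \<pi> y = \<pi> (x \<oplus>\<^bsub>M\<^esub> y)"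
    and zero: "\<zero>\<^bsub>Q\<^esub> = \<pi> \<zero>\<^bsub>M\<^esub>"
    and smult: "\<And>r x. \<lbrakk>r \<in> carrier k; x \<in> carrier M\<rbrakk> \<Longrightarrow> r \<odot>\<^bsub>Q\<^esub> \<pi> x = \<pi> (r \<odot>\<^bsub>M\<^esub> x)"
  shows "module k Q"
proof -
  interpret M: module k M by fact
  have "\<exists>y\<in>\<pi> ` carrier M. y \<oplus>\<^bsub>Q\<^esub> \<pi> x = \<pi> \<zero>\<^bsub>M\<^esub>" if "x \<in> carrier M" for x
    using that by (intro bexI[of _ "\<pi> (\<ominus>\<^bsub>M\<^esub> x)"]) (auto simp: add M.M.l_neg)
  moreover have "\<pi> (x \<oplus>\<^bsub>M\<^esub> y) = \<pi> (y \<oplus>\<^bsub>M\<^esub> x)" if "x \<in> carrier M" "y \<in> carrier M" for x y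
    using that by (simp add: M.M.a_comm)
  ultimately show ?thesis
    by (intro moduleI abelian_groupI M.R.cring_axioms)
      (auto simp: onto add zero smult M.M.a_assoc M.smult_l_distr M.smult_r_distr M.smult_assoc1)
qed

section \<open>Free modules, spans and quotients\<close>

lemma free_module_simps [simp]:
  "\<zero>\<^bsub>free_module k S\<^esub> = (\<lambda>p. \<zero>\<^bsub>k\<^esub>)"
  "f \<oplus>\<^bsub>free_module k S\<^esub> g = (\<lambda>p. f p \<oplus>\<^bsub>k\<^esub> g p)"
  "r \<odot>\<^bsub>free_module k S\<^esub> f = (\<lambda>p. r \<otimes>\<^bsub>k\<^esub> f p)"
  by (simp_all add: free_module_def)

lemma free_module_carrier:
  "f \<in> carrier (free_module k S) \<longleftrightarrow>
    (\<forall>p. f p \<in> carrier k \<and> (p \<notin> S \<longrightarrow> f p = \<zero>\<^bsub>k\<^esub>)) \<and> finite {p. f p \<noteq> \<zero>\<^bsub>k\<^esub>}"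
  if "cring k"
proof -
  interpret cring k by fact
  show ?thesis by (auto simp: free_module_def)
qed

lemma free_module_module:
  fixes k :: "('k, 'r) ring_scheme" and S :: "'s set"
  assumes k: "cring k"
  shows "module k (free_module k S)"
proof -
  interpret cring k by fact
  note car = free_module_carrier[OF k]
  have fin: "finite {p. f p \<oplus>\<^bsub>k\<^esub> g p \<noteq> \<zero>\<^bsub>k\<^esub>}"
    if "finite {p. f p \<noteq> \<zero>\<^bsub>k\<^esub>}" "finite {p. g p \<noteq> \<zero>\<^bsub>k\<^esub>}" for f g :: "'s \<Rightarrow> 'k"
    by (rule finite_subset[OF _ finite_UnI[OF that]]) auto
  have fin': "finite {p. r \<otimes>\<^bsub>k\<^esub> f p \<noteq> \<zero>\<^bsub>k\<^esub>}"
    if "r \<in> carrier k" "finite {p. f p \<noteq> \<zero>\<^bsub>k\<^esub>}" for f :: "'s \<Rightarrow> 'k" and r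
    by (rule finite_subset[OF _ that(2)]) (use that in auto)
  have "\<exists>y\<in>carrier (free_module k S). (\<lambda>p. y p \<oplus>\<^bsub>k\<^esub> x p) = (\<lambda>p. \<zero>\<^bsub>k\<^esub>)"
    if "x \<in> carrier (free_module k S)" for x
  proof (rule bexI[of _ "\<lambda>p. \<ominus>\<^bsub>k\<^esub> x p"])
    show "(\<lambda>p. \<ominus>\<^bsub>k\<^esub> x p) \<in> carrier (free_module k S)"
      using that finite_subset[of "{p. \<ominus>\<^bsub>k\<^esub> x p \<noteq> \<zero>\<^bsub>k\<^esub>}" "{p. x p \<noteq> \<zero>\<^bsub>k\<^esub>}"] by (auto simp: car)
  qed (use that in \<open>auto simp: car l_neg\<close>)
  then show ?thesis
    by (intro moduleI abelian_groupI k)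
      (auto simp: car fin fin' l_distr r_distr a_assoc m_assoc fun_eq_iff intro: a_comm)
qed

lemma free_generator_closed: "\<lbrakk>cring k; p \<in> S\<rbrakk> \<Longrightarrow> free_generator k p \<in> carrier (free_module k S)"
proof -
  assume k: "cring k" and p: "p \<in> S"
  interpret cring k by fact
  show ?thesis
    using p finite_subset[of "{q. free_generator k p q \<noteq> \<zero>\<^bsub>k\<^esub>}" "{p}"]
    by (auto simp: free_module_carrier[OF k] free_generator_def)
qed

text \<open>
  The defining sum of \<open>free_lift\<close> runs over the support of \<open>h\<close>, which changes with \<open>h\<close>. Allowing any
  larger finite index set makes the sums for different \<open>h\<close> comparable.
\<close>

lemma free_lift_superset:
  assumes P: "module k P" and f: "\<And>p. p \<in> S \<Longrightarrow> f p \<in> carrier P"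
    and h: "h \<in> carrier (free_module k S)"
    and T: "finite T" "{p. h p \<noteq> \<zero>\<^bsub>k\<^esub>} \<subseteq> T" "T \<subseteq> S"
  shows "free_lift k P f h = (\<Oplus>\<^bsub>P\<^esub>p\<in>T. h p \<odot>\<^bsub>P\<^esub> f p)"
proof -
  interpret P: module k P by fact
  have h': "h p \<in> carrier k" for p using h P.R.cring_axioms by (simp add: free_module_carrier)
  show ?thesis unfolding free_lift_def
    by (rule P.M.add.finprod_mono_neutral_cong_left) (use T f h' in \<open>auto simp: subset_iff\<close>)
qed

lemma free_lift_linear:
  assumes P: "module k P" and f: "\<And>p. p \<in> S \<Longrightarrow> f p \<in> carrier P"
  shows "free_lift k P f \<in> linear_maps k (free_module k S) P"
proof -
  interpret P: module k P by fact
  note car = free_module_carrier[OF P.R.cring_axioms]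
  have sup: "{p. h p \<noteq> \<zero>\<^bsub>k\<^esub>} \<subseteq> S" "h p \<in> carrier k"
    if "h \<in> carrier (free_module k S)" for h p using that by (auto simp: car)
  interpret F: module k "free_module k S" by (rule free_module_module[OF P.R.cring_axioms])
  show ?thesis
  proof (rule linear_mapsI)
    fix h assume h: "h \<in> carrier (free_module k S)"
    show "free_lift k P f h \<in> carrier P" unfolding free_lift_def
      using sup[OF h] f by (intro P.M.finsum_closed) auto
    fix r assume r: "r \<in> carrier k"
    define T where "T = {p. h p \<noteq> \<zero>\<^bsub>k\<^esub>}"
    have T: "finite T" "T \<subseteq> S" "\<And>p. p \<in> T \<Longrightarrow> f p \<in> carrier P"
      using h sup[OF h] f by (auto simp: car T_def)
    have rh: "r \<odot>\<^bsub>free_module k S\<^esub> h \<in> carrier (free_module k S)" using r h by blast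
    have "free_lift k P f (r \<odot>\<^bsub>free_module k S\<^esub> h) =
      (\<Oplus>\<^bsub>P\<^esub>p\<in>T. (r \<odot>\<^bsub>free_module k S\<^esub> h) p \<odot>\<^bsub>P\<^esub> f p)"
      by (rule free_lift_superset[OF P f rh]) (use T r in \<open>auto simp: T_def\<close>)
    also have "\<dots> = r \<odot>\<^bsub>P\<^esub> (\<Oplus>\<^bsub>P\<^esub>p\<in>T. h p \<odot>\<^bsub>P\<^esub> f p)"
      using T sup[OF h] r
      by (subst P.finsum_smult_ldistr) (auto intro!: P.M.finsum_cong' simp: P.smult_assoc1 Pi_def)
    finally show "free_lift k P f (r \<odot>\<^bsub>free_module k S\<^esub> h) = r \<odot>\<^bsub>P\<^esub> free_lift k P f h"
      by (simp add: free_lift_def T_def)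
  next
    fix h g assume h: "h \<in> carrier (free_module k S)" and g: "g \<in> carrier (free_module k S)"
    define T where "T = {p. h p \<noteq> \<zero>\<^bsub>k\<^esub>} \<union> {p. g p \<noteq> \<zero>\<^bsub>k\<^esub>}"
    have T: "finite T" "T \<subseteq> S" "\<And>p. p \<in> T \<Longrightarrow> f p \<in> carrier P"
      using h g sup[OF h] sup[OF g] f by (auto simp: car T_def)
    have hg: "h \<oplus>\<^bsub>free_module k S\<^esub> g \<in> carrier (free_module k S)" using g h by blast
    have "free_lift k P f (h \<oplus>\<^bsub>free_module k S\<^esub> g) =
      (\<Oplus>\<^bsub>P\<^esub>p\<in>T. (h \<oplus>\<^bsub>free_module k S\<^esub> g) p \<odot>\<^bsub>P\<^esub> f p)"
      by (rule free_lift_superset[OF P f hg]) (use T in \<open>auto simp: T_def\<close>)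
    also have "\<dots> = (\<Oplus>\<^bsub>P\<^esub>p\<in>T. h p \<odot>\<^bsub>P\<^esub> f p \<oplus>\<^bsub>P\<^esub> g p \<odot>\<^bsub>P\<^esub> f p)"
      using T sup[OF h] sup[OF g] by (intro P.M.finsum_cong') (auto simp: P.smult_l_distr)
    also have "\<dots> = (\<Oplus>\<^bsub>P\<^esub>p\<in>T. h p \<odot>\<^bsub>P\<^esub> f p) \<oplus>\<^bsub>P\<^esub> (\<Oplus>\<^bsub>P\<^esub>p\<in>T. g p \<odot>\<^bsub>P\<^esub> f p)"
      using T sup[OF h] sup[OF g] by (intro P.M.finsum_addf) auto
    also have "(\<Oplus>\<^bsub>P\<^esub>p\<in>T. h p \<odot>\<^bsub>P\<^esub> f p) = free_lift k P f h"
      by (rule free_lift_superset[OF P f h, symmetric]) (use T in \<open>auto simp: T_def\<close>)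
    also have "(\<Oplus>\<^bsub>P\<^esub>p\<in>T. g p \<odot>\<^bsub>P\<^esub> f p) = free_lift k P f g"
      by (rule free_lift_superset[OF P f g, symmetric]) (use T in \<open>auto simp: T_def\<close>)
    finally show "free_lift k P f (h \<oplus>\<^bsub>free_module k S\<^esub> g) = free_lift k P f h \<oplus>\<^bsub>P\<^esub> free_lift k P f g" .
  qed
qed

lemma free_lift_generator:
  assumes P: "module k P" and f: "f p \<in> carrier P"
  shows "free_lift k P f (free_generator k p) = f p"
proof -
  interpret P: module k P by fact
  have "free_lift k P f (free_generator k p) = (\<Oplus>\<^bsub>P\<^esub>q\<in>{p}. free_generator k p q \<odot>\<^bsub>P\<^esub> f q)"
    by (rule free_lift_superset[OF P _ free_generator_closed[OF P.R.cring_axioms], of "{p}"])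
      (use f in \<open>auto simp: free_generator_def split: if_splits\<close>)
  then show ?thesis using f by (simp add: free_generator_def P.M.finsum_insert)
qed

text \<open>
  Induction on a finite set containing the support: removing one point \<open>p\<close> splits off the multiple \<open>h p\<close>
  of a generator.
\<close>

lemma free_module_ext:
  assumes P: "module k P"
    and g: "g \<in> linear_maps k (free_module k S) P" and g': "g' \<in> linear_maps k (free_module k S) P"
    and eq: "\<And>p. p \<in> S \<Longrightarrow> g (free_generator k p) = g' (free_generator k p)"
    and h: "h \<in> carrier (free_module k S)"
  shows "g h = g' h"
proof -
  interpret P: module k P by fact
  note car = free_module_carrier[OF P.R.cring_axioms]
  have F: "module k (free_module k S)" by (rule free_module_module[OF P.R.cring_axioms])
  have "finite T \<Longrightarrow> h \<in> carrier (free_module k S) \<Longrightarrow> {p. h p \<noteq> \<zero>\<^bsub>k\<^esub>} \<subseteq> T \<Longrightarrow> g h = g' h" for T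
  proof (induction T arbitrary: h rule: finite_induct)
    case empty
    then have "h = \<zero>\<^bsub>free_module k S\<^esub>" by auto
    then show ?case using linear_zero[OF g F P] linear_zero[OF g' F P] by (simp only:)
  next
    case (insert p T)
    show ?case
    proof (cases "p \<in> S")
      case True
      let ?h = "h(p := \<zero>\<^bsub>k\<^esub>)"
      have h': "?h \<in> carrier (free_module k S)"
        using insert.prems by (auto simp: car elim!: rev_finite_subset)
      have gp: "free_generator k p \<in> carrier (free_module k S)"
        by (rule free_generator_closed[OF P.R.cring_axioms True])
      have hp: "h p \<in> carrier k" using insert.prems by (simp add: car)
      have hpg: "h p \<odot>\<^bsub>free_module k S\<^esub> free_generator k p \<in> carrier (free_module k S)"
        using module.smult_closed[OF F hp gp] .
      have "h = ?h \<oplus>\<^bsub>free_module k S\<^esub> (h p \<odot>\<^bsub>free_module k S\<^esub> free_generator k p)"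
        using insert.prems by (auto simp: car free_generator_def fun_eq_iff)
      moreover have "g ?h = g' ?h"
        by (rule insert.IH[OF h']) (use insert.prems in auto)
      ultimately show ?thesis
        using linear_add[OF g h' hpg] linear_add[OF g' h' hpg] eq[OF True]
          linear_smult[OF g hp gp] linear_smult[OF g' hp gp] by (simp only:)
    next
      case False
      then have "h p = \<zero>\<^bsub>k\<^esub>" using insert.prems by (simp add: car)
      then show ?thesis using insert by (intro insert.IH) auto
    qed
  qed
  then show ?thesis using h by (auto simp: car)
qed

lemma module_span_submodule:
  assumes "module k M" "S \<subseteq> carrier M"
  shows "submodule (module_span k M S) k M"
proof -
  interpret M: module k M by fact
  note E = M.submoduleE
  have zero: "\<zero>\<^bsub>M\<^esub> \<in> N" if "submodule N k M" for N
    using subgroup.one_closed[OF submodule.axioms(1)[OF that]] by simp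
  show ?thesis unfolding module_span_def
    by (rule M.submoduleI)
      (use zero E M.carrier_is_submodule assms(2) in \<open>auto simp: submodule.smult_closed\<close>)
qed

lemma module_span_incl: "x \<in> S \<Longrightarrow> x \<in> module_span k M S"
  by (auto simp: module_span_def)

text \<open>
  The kernel is a submodule. Both tensor products are quotients by a span, so this is what makes
  maps out of them well defined.
\<close>

lemma linear_vanishes_on_span:
  assumes M: "module k M" and P: "module k P" and f: "f \<in> linear_maps k M P"
    and S: "S \<subseteq> carrier M" "\<And>s. s \<in> S \<Longrightarrow> f s = \<zero>\<^bsub>P\<^esub>"
    and x: "x \<in> module_span k M S"
  shows "f x = \<zero>\<^bsub>P\<^esub>"
proof -
  interpret M: module k M by fact
  interpret P: module k P by fact
  have "submodule {x \<in> carrier M. f x = \<zero>\<^bsub>P\<^esub>} k M"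
    by (rule M.submoduleI) (use f M P in \<open>auto simp: linear_zero linear_uminus linear_add linear_smult\<close>)
  then show ?thesis using x S unfolding module_span_def by auto
qed

context
  fixes k :: "('k, 'r) ring_scheme" and M :: "('k, 'm, 'x) module_scheme" and N
  assumes M: "module k M" and N: "submodule N k M"
begin

interpretation M: module k M by (rule M)

lemma submodule_abelian: "abelian_subgroup N M"
  using submodule.axioms(1)[OF N] M.M.abelian_group_axioms
  by (intro abelian_subgroupI3 additive_subgroup.intro)

interpretation N: abelian_subgroup N M by (rule submodule_abelian)

lemma coset_eq_iff:
  assumes "x \<in> carrier M" "y \<in> carrier M"
  shows "N +>\<^bsub>M\<^esub> x = N +>\<^bsub>M\<^esub> y \<longleftrightarrow> x \<ominus>\<^bsub>M\<^esub> y \<in> N"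
  using assms N.a_rcos_module[of y x] M.M.a_repr_independence[of x N y]
    N.a_rcos_self[OF assms(1)] submodule.axioms(1)[OF N]
  by (metis a_minus_def)

lemma quotient_add:
  assumes "x \<in> carrier M" "y \<in> carrier M"
  shows "(N +>\<^bsub>M\<^esub> x) \<oplus>\<^bsub>quotient_module M N\<^esub> (N +>\<^bsub>M\<^esub> y) = N +>\<^bsub>M\<^esub> (x \<oplus>\<^bsub>M\<^esub> y)"
  using N.a_rcos_sum[OF assms] by (simp add: quotient_module_def)

lemma quotient_smult:
  assumes "r \<in> carrier k" "x \<in> carrier M"
  shows "r \<odot>\<^bsub>quotient_module M N\<^esub> (N +>\<^bsub>M\<^esub> x) = N +>\<^bsub>M\<^esub> (r \<odot>\<^bsub>M\<^esub> x)"
proof -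
  have "N +>\<^bsub>M\<^esub> (r \<odot>\<^bsub>M\<^esub> y) = N +>\<^bsub>M\<^esub> (r \<odot>\<^bsub>M\<^esub> x)" if y: "y \<in> N +>\<^bsub>M\<^esub> x" for y
  proof -
    have yM: "y \<in> carrier M"
      using y assms N.a_subset M.M.a_r_coset_subset_G by blast
    have "N +>\<^bsub>M\<^esub> y = N +>\<^bsub>M\<^esub> x"
      using M.M.a_repr_independence[OF y assms(2) submodule.axioms(1)[OF N]] by simp
    then have "r \<odot>\<^bsub>M\<^esub> (y \<ominus>\<^bsub>M\<^esub> x) \<in> N"
      using coset_eq_iff[OF yM assms(2)] submodule.smult_closed[OF N assms(1)] by blast
    then show ?thesis
      using assms yM by (simp add: coset_eq_iff a_minus_def M.smult_r_distr M.smult_r_minus)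
  qed
  then have "(\<Union>y\<in>N +>\<^bsub>M\<^esub> x. N +>\<^bsub>M\<^esub> (r \<odot>\<^bsub>M\<^esub> y)) = (\<Union>y\<in>N +>\<^bsub>M\<^esub> x. N +>\<^bsub>M\<^esub> (r \<odot>\<^bsub>M\<^esub> x))"
    by (rule SUP_cong[OF refl])
  moreover have "N +>\<^bsub>M\<^esub> x \<noteq> {}" using N.a_rcos_self[OF assms(2)] by blast
  ultimately show ?thesis by (simp add: quotient_module_def)
qed

lemma quotient_carrier: "carrier (quotient_module M N) = (\<lambda>x. N +>\<^bsub>M\<^esub> x) ` carrier M"
  by (simp add: quotient_module_def A_RCOSETS_def' image_def) blast

lemma quotient_module_module: "module k (quotient_module M N)"
proof (rule module_image[OF M quotient_carrier])
  show "\<zero>\<^bsub>quotient_module M N\<^esub> = N +>\<^bsub>M\<^esub> \<zero>\<^bsub>M\<^esub>"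
    using M.M.a_coset_add_zero[OF N.a_subset] by (simp add: quotient_module_def)
qed (simp_all add: quotient_add quotient_smult)

lemma coset_linear: "(\<lambda>x. N +>\<^bsub>M\<^esub> x) \<in> linear_maps k M (quotient_module M N)"
  by (rule linear_mapsI) (auto simp: quotient_carrier quotient_add quotient_smult)

lemma quotient_lift_coset:
  assumes P: "module k P" and f: "f \<in> linear_maps k M P" "\<And>x. x \<in> N \<Longrightarrow> f x = \<zero>\<^bsub>P\<^esub>"
    and x: "x \<in> carrier M"
  shows "quotient_lift f (N +>\<^bsub>M\<^esub> x) = f x"
proof -
  interpret P: module k P by fact
  have "f (n \<oplus>\<^bsub>M\<^esub> x) = f x" if "n \<in> N" for n
    using that f(2)[OF that] linear_add[OF f(1) _ x, of n] N.a_subset linear_closed[OF f(1) x] by auto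
  then have "f ` (N +>\<^bsub>M\<^esub> x) = {f x}"
    using N.a_rcos_self[OF x] by (auto simp: a_r_coset_def')
  then show ?thesis by (simp add: quotient_lift_def)
qed

lemma quotient_lift_linear:
  assumes P: "module k P" and f: "f \<in> linear_maps k M P" "\<And>x. x \<in> N \<Longrightarrow> f x = \<zero>\<^bsub>P\<^esub>"
  shows "quotient_lift f \<in> linear_maps k (quotient_module M N) P"
  by (rule linear_mapsI)
    (use f in \<open>auto simp: quotient_carrier quotient_add quotient_smult quotient_lift_coset[OF P f]
      linear_closed linear_add linear_smult\<close>)

end

section \<open>Multilinear maps and the tensor product over the base ring\<close>

lemma module_minus_self: "\<lbrakk>module k M; x \<in> carrier M\<rbrakk> \<Longrightarrow> x \<ominus>\<^bsub>M\<^esub> x = \<zero>\<^bsub>M\<^esub>"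
  by (simp add: a_minus_def module_def abelian_group.r_neg)

lemma linear_ident: "(\<lambda>x. x) \<in> linear_maps k M M"
  by (auto simp: linear_maps_def)

lemma linear_comp:
  "\<lbrakk>f \<in> linear_maps k N P; g \<in> linear_maps k M N\<rbrakk> \<Longrightarrow> (\<lambda>x. f (g x)) \<in> linear_maps k M P"
  by (auto simp: linear_maps_def Pi_iff)

lemma linear_sum:
  assumes "module k P" "f \<in> linear_maps k M P" "g \<in> linear_maps k M P"
  shows "(\<lambda>x. f x \<oplus>\<^bsub>P\<^esub> g x) \<in> linear_maps k M P"
proof -
  interpret P: module k P by fact
  show ?thesis
    by (rule linear_mapsI)
      (use assms(2,3) in \<open>auto simp: linear_closed linear_add linear_smult P.smult_r_distr P.M.a_ac\<close>)
qed

lemma linear_scale: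
  assumes "module k P" "r \<in> carrier k" "f \<in> linear_maps k M P"
  shows "(\<lambda>x. r \<odot>\<^bsub>P\<^esub> f x) \<in> linear_maps k M P"
proof -
  interpret P: module k P by fact
  have "s \<odot>\<^bsub>P\<^esub> (r \<odot>\<^bsub>P\<^esub> y) = r \<odot>\<^bsub>P\<^esub> (s \<odot>\<^bsub>P\<^esub> y)" if "s \<in> carrier k" "y \<in> carrier P" for s y
    using that assms(2) by (simp flip: P.smult_assoc1 add: P.R.m_comm)
  then show ?thesis
    by (intro linear_mapsI)
      (use assms(2,3) in \<open>auto simp: linear_closed linear_add linear_smult P.smult_r_distr\<close>)
qed

lemma base_module_simps [simp]:
  "carrier (base_module k) = carrier k" "\<zero>\<^bsub>base_module k\<^esub> = \<zero>\<^bsub>k\<^esub>"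
  "x \<oplus>\<^bsub>base_module k\<^esub> y = x \<oplus>\<^bsub>k\<^esub> y" "x \<odot>\<^bsub>base_module k\<^esub> y = x \<otimes>\<^bsub>k\<^esub> y"
  by (simp_all add: base_module_def)

lemma base_module_module: "cring k \<Longrightarrow> module k (base_module k)"
proof -
  assume k: "cring k"
  interpret cring k by fact
  show ?thesis
    by (intro moduleI abelian_groupI k)
      (auto simp: l_distr r_distr a_assoc m_assoc intro: a_comm bexI[of _ "\<ominus>\<^bsub>k\<^esub> x" for x] l_neg)
qed

lemma linear_scalar:
  assumes "module k P" "s \<in> linear_maps k M (base_module k)" "p \<in> carrier P"
  shows "(\<lambda>x. s x \<odot>\<^bsub>P\<^esub> p) \<in> linear_maps k M P"
proof -
  interpret P: module k P by fact
  show ?thesis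
    by (rule linear_mapsI)
      (use assms(3) linear_closed[OF assms(2)] linear_add[OF assms(2)] linear_smult[OF assms(2)]
       in \<open>auto simp: P.smult_l_distr P.smult_assoc1\<close>)
qed

lemma bilinear_mapsI:
  assumes "\<And>m. m \<in> carrier M \<Longrightarrow> (\<lambda>n. f m n) \<in> linear_maps k N P"
    and "\<And>n. n \<in> carrier N \<Longrightarrow> (\<lambda>m. f m n) \<in> linear_maps k M P"
  shows "f \<in> bilinear_maps k M N P"
  using assms by (auto simp: bilinear_maps_def)

lemma bilinear_left:
  "\<lbrakk>f \<in> bilinear_maps k M N P; n \<in> carrier N\<rbrakk> \<Longrightarrow> (\<lambda>m. f m n) \<in> linear_maps k M P"
  by (auto simp: bilinear_maps_def)

lemma bilinear_right:
  "\<lbrakk>f \<in> bilinear_maps k M N P; m \<in> carrier M\<rbrakk> \<Longrightarrow> f m \<in> linear_maps k N P"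
  by (auto simp: bilinear_maps_def)

lemma bilinear_closed:
  "\<lbrakk>f \<in> bilinear_maps k M N P; m \<in> carrier M; n \<in> carrier N\<rbrakk> \<Longrightarrow> f m n \<in> carrier P"
  by (rule linear_closed[OF bilinear_right])

lemma bilinear_comp_left:
  assumes "f \<in> bilinear_maps k M N P" "g \<in> linear_maps k X M" "n \<in> carrier N"
  shows "(\<lambda>x. f (g x) n) \<in> linear_maps k X P"
  using linear_comp[OF bilinear_left[OF assms(1,3)] assms(2)] .

lemma bilinear_comp_right:
  assumes "f \<in> bilinear_maps k M N P" "g \<in> linear_maps k X N" "m \<in> carrier M"
  shows "(\<lambda>x. f m (g x)) \<in> linear_maps k X P"
  using linear_comp[OF bilinear_right[OF assms(1,3)] assms(2)] .

text \<open>
  The fold underlying a finite sum depends only on the summands at points of the index set, whether or not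
  they lie in the carrier. Hence \<open>tensor_lift_cong\<close> holds for arbitrary summands, and multilinearity need not be
  established again at every level of nested sums.
\<close>

lemma foldSetD_congD:
  assumes "(A, y) \<in> foldSetD D f e" "\<And>x. x \<in> A \<Longrightarrow> f x = g x"
  shows "(A, y) \<in> foldSetD D g e"
  using assms
proof (induction rule: foldSetD.induct)
  case emptyI
  then show ?case by (intro foldSetD.emptyI)
next
  case (insertI x A y)
  then show ?case using foldSetD.insertI[of x A g y D e] by auto
qed

context
  fixes k :: "('k, 'r) ring_scheme" and M :: "('k, 'm, 'x) module_scheme"
    and N :: "('k, 'n, 'y) module_scheme"
  assumes M: "module k M" and N: "module k N"
begin

interpretation M: module k M by (rule M)
interpretation N: module k N by (rule N)

private abbreviation (input) "F \<equiv> free_module k (carrier M \<times> carrier N)"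
private abbreviation (input) "e \<equiv> free_generator k"

lemma tensor_free: "module k F"
  by (rule free_module_module[OF M.R.cring_axioms])

interpretation F: module k F by (rule tensor_free)

lemma generator_in_free [simp]: "\<lbrakk>m \<in> carrier M; n \<in> carrier N\<rbrakk> \<Longrightarrow> e (m, n) \<in> carrier F"
  by (rule free_generator_closed[OF M.R.cring_axioms]) simp

private definition "tensor_gens =
       ({e (m \<oplus>\<^bsub>M\<^esub> m', n) \<ominus>\<^bsub>F\<^esub> (e (m, n) \<oplus>\<^bsub>F\<^esub> e (m', n)) | m m' n.
          m \<in> carrier M \<and> m' \<in> carrier M \<and> n \<in> carrier N} \<union>
        {e (m, n \<oplus>\<^bsub>N\<^esub> n') \<ominus>\<^bsub>F\<^esub> (e (m, n) \<oplus>\<^bsub>F\<^esub> e (m, n')) | m n n'.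
          m \<in> carrier M \<and> n \<in> carrier N \<and> n' \<in> carrier N} \<union>
        {e (r \<odot>\<^bsub>M\<^esub> m, n) \<ominus>\<^bsub>F\<^esub> (r \<odot>\<^bsub>F\<^esub> e (m, n)) | r m n.
          r \<in> carrier k \<and> m \<in> carrier M \<and> n \<in> carrier N} \<union>
        {e (m, r \<odot>\<^bsub>N\<^esub> n) \<ominus>\<^bsub>F\<^esub> (r \<odot>\<^bsub>F\<^esub> e (m, n)) | r m n.
          r \<in> carrier k \<and> m \<in> carrier M \<and> n \<in> carrier N})"

lemma tensor_relations_span: "tensor_relations k M N = module_span k F tensor_gens"
  unfolding tensor_relations_def tensor_gens_def Let_def ..

lemma tensor_gens_subset: "tensor_gens \<subseteq> carrier F"
  unfolding tensor_gens_def
  by (auto simp del: free_module_simps intro!: F.M.minus_closed F.M.a_closed F.smult_closed generator_in_free)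

lemma tensor_relations_submodule: "submodule (tensor_relations k M N) k F"
  unfolding tensor_relations_span by (rule module_span_submodule[OF tensor_free tensor_gens_subset])

lemma tensor_module: "module k (tensor k M N)"
  unfolding tensor_def by (rule quotient_module_module[OF tensor_free tensor_relations_submodule])

interpretation T: module k "tensor k M N" by (rule tensor_module)

lemma tensor_coset_linear: "(\<lambda>x. tensor_relations k M N +>\<^bsub>F\<^esub> x) \<in> linear_maps k F (tensor k M N)"
  unfolding tensor_def by (rule coset_linear[OF tensor_free tensor_relations_submodule])

lemma tens_closed:
  assumes "m \<in> carrier M" "n \<in> carrier N"
  shows "tens k M N m n \<in> carrier (tensor k M N)"
  unfolding tens_def using assms by (intro linear_closed[OF tensor_coset_linear]) auto

lemma tensor_coset_eqI:
  assumes "x \<ominus>\<^bsub>F\<^esub> y \<in> tensor_gens" "x \<in> carrier F" "y \<in> carrier F"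
  shows "tensor_relations k M N +>\<^bsub>F\<^esub> x = tensor_relations k M N +>\<^bsub>F\<^esub> y"
  using assms coset_eq_iff[OF tensor_free tensor_relations_submodule]
  by (simp add: tensor_relations_span module_span_incl)

lemma tens_bilinear: "tens k M N \<in> bilinear_maps k M N (tensor k M N)"
proof (rule bilinear_mapsI; rule linear_mapsI)
  note [simp del] = free_module_simps
  \<comment> \<open>Each bilinearity law says that two generators differ by one of the defining relations.\<close>
  note add = linear_add[OF tensor_coset_linear] and smult = linear_smult[OF tensor_coset_linear]
  show "tens k M N m (n \<oplus>\<^bsub>N\<^esub> n') = tens k M N m n \<oplus>\<^bsub>tensor k M N\<^esub> tens k M N m n'"
    if "m \<in> carrier M" "n \<in> carrier N" "n' \<in> carrier N" for m n n'
    using that unfolding tens_def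
    by (subst add[symmetric], simp_all, intro tensor_coset_eqI)
      (unfold tensor_gens_def, blast, auto intro!: F.M.a_closed)
  show "tens k M N (m \<oplus>\<^bsub>M\<^esub> m') n = tens k M N m n \<oplus>\<^bsub>tensor k M N\<^esub> tens k M N m' n"
    if "n \<in> carrier N" "m \<in> carrier M" "m' \<in> carrier M" for m m' n
    using that unfolding tens_def
    by (subst add[symmetric], simp_all, intro tensor_coset_eqI)
      (unfold tensor_gens_def, blast, auto intro!: F.M.a_closed)
  show "tens k M N m (r \<odot>\<^bsub>N\<^esub> n) = r \<odot>\<^bsub>tensor k M N\<^esub> tens k M N m n"
    if "m \<in> carrier M" "r \<in> carrier k" "n \<in> carrier N" for m r n
    using that unfolding tens_def
    by (subst smult[symmetric], simp_all, intro tensor_coset_eqI)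
      (unfold tensor_gens_def, blast, auto intro!: F.smult_closed)
  show "tens k M N (r \<odot>\<^bsub>M\<^esub> m) n = r \<odot>\<^bsub>tensor k M N\<^esub> tens k M N m n"
    if "n \<in> carrier N" "r \<in> carrier k" "m \<in> carrier M" for m r n
    using that unfolding tens_def
    by (subst smult[symmetric], simp_all, intro tensor_coset_eqI)
      (unfold tensor_gens_def, blast, auto intro!: F.smult_closed)
qed (auto intro: tens_closed)

text \<open>
  Pure tensors generate: the composites with the projection from the free module agree on generators.
\<close>

lemma tensor_ext:
  assumes P: "module k P" and g: "g \<in> linear_maps k (tensor k M N) P" "g' \<in> linear_maps k (tensor k M N) P"
    and eq: "\<And>m n. \<lbrakk>m \<in> carrier M; n \<in> carrier N\<rbrakk> \<Longrightarrow> g (tens k M N m n) = g' (tens k M N m n)"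
    and t: "t \<in> carrier (tensor k M N)"
  shows "g t = g' t"
proof -
  obtain h where h: "h \<in> carrier F" "t = tensor_relations k M N +>\<^bsub>F\<^esub> h"
    using t by (auto simp: tensor_def quotient_carrier[OF tensor_free tensor_relations_submodule])
  show ?thesis unfolding h(2)
    by (rule free_module_ext[OF P linear_comp[OF g(1) tensor_coset_linear]
        linear_comp[OF g(2) tensor_coset_linear] _ h(1)])
      (use eq in \<open>auto simp: tens_def\<close>)
qed

context
  fixes P :: "('k, 'p, 'z) module_scheme" and f :: "'m \<Rightarrow> 'n \<Rightarrow> 'p"
  assumes P: "module k P" and f: "f \<in> bilinear_maps k M N P"
begin

interpretation P: module k P by (rule P)

lemma tensor_free_lift_linear: "free_lift k P (\<lambda>(m, n). f m n) \<in> linear_maps k F P"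
  by (rule free_lift_linear[OF P]) (auto intro: bilinear_closed[OF f])

lemma tensor_free_lift_generator:
  "\<lbrakk>m \<in> carrier M; n \<in> carrier N\<rbrakk> \<Longrightarrow> free_lift k P (\<lambda>(m, n). f m n) (e (m, n)) = f m n"
  by (subst free_lift_generator[OF P]) (auto intro: bilinear_closed[OF f])

lemma tensor_free_lift_vanishes:
  assumes "x \<in> tensor_relations k M N"
  shows "free_lift k P (\<lambda>(m, n). f m n) x = \<zero>\<^bsub>P\<^esub>"
proof (rule linear_vanishes_on_span[OF tensor_free P tensor_free_lift_linear tensor_gens_subset])
  note L = tensor_free_lift_linear
  show "free_lift k P (\<lambda>(m, n). f m n) s = \<zero>\<^bsub>P\<^esub>" if "s \<in> tensor_gens" for s
    using that unfolding tensor_gens_def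
    by (elim UnE CollectE exE conjE)
      (simp_all only: tensor_free_lift_generator linear_diff[OF L tensor_free P] linear_add[OF L]
        linear_smult[OF L] linear_add[OF bilinear_left[OF f]] linear_add[OF bilinear_right[OF f]]
        linear_smult[OF bilinear_left[OF f]] linear_smult[OF bilinear_right[OF f]] module_minus_self[OF P]
        bilinear_closed[OF f] generator_in_free M.M.a_closed N.M.a_closed F.M.a_closed P.M.a_closed
        M.smult_closed N.smult_closed F.smult_closed P.smult_closed)
qed (use assms in \<open>simp add: tensor_relations_span\<close>)

lemma tensor_lift_linear: "tensor_lift k P f \<in> linear_maps k (tensor k M N) P"
  unfolding tensor_lift_def tensor_def
  by (rule quotient_lift_linear[OF tensor_free tensor_relations_submodule P tensor_free_lift_linear
      tensor_free_lift_vanishes])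

lemma tensor_lift_tens:
  "\<lbrakk>m \<in> carrier M; n \<in> carrier N\<rbrakk> \<Longrightarrow> tensor_lift k P f (tens k M N m n) = f m n"
  unfolding tensor_lift_def tens_def
  by (subst quotient_lift_coset[OF tensor_free tensor_relations_submodule P tensor_free_lift_linear
      tensor_free_lift_vanishes]) (simp_all only: generator_in_free tensor_free_lift_generator)

lemma tensor_lift_closed:
  "t \<in> carrier (tensor k M N) \<Longrightarrow> tensor_lift k P f t \<in> carrier P"
  by (rule linear_closed[OF tensor_lift_linear])

end

lemma tensor_lift_push:
  assumes P: "module k P" and Q: "module k Q" and f: "f \<in> bilinear_maps k M N P"
    and g: "g \<in> linear_maps k P Q" and t: "t \<in> carrier (tensor k M N)"
  shows "g (tensor_lift k P f t) = tensor_lift k Q (\<lambda>m n. g (f m n)) t"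
proof -
  have gf: "(\<lambda>m n. g (f m n)) \<in> bilinear_maps k M N Q"
    by (rule bilinear_mapsI) (use linear_comp[OF g] bilinear_left[OF f] bilinear_right[OF f] in auto)
  show ?thesis
    by (rule tensor_ext[OF Q linear_comp[OF g tensor_lift_linear[OF P f]] tensor_lift_linear[OF Q gf] _ t])
      (simp add: tensor_lift_tens[OF P f] tensor_lift_tens[OF Q gf])
qed

lemma tensor_lift_cong:
  assumes t: "t \<in> carrier (tensor k M N)"
    and eq: "\<And>m n. \<lbrakk>m \<in> carrier M; n \<in> carrier N\<rbrakk> \<Longrightarrow> f m n = g m n"
  shows "tensor_lift k P f t = tensor_lift k P g t"
proof -
  note sub = tensor_relations_submodule
  obtain h where h: "h \<in> carrier F" "t = tensor_relations k M N +>\<^bsub>F\<^esub> h"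
    using t by (auto simp: tensor_def quotient_carrier[OF tensor_free sub])
  have "t \<subseteq> carrier F" unfolding h(2)
    using tensor_free sub h(1) abelian_monoid.a_r_coset_subset_G[of F] module.submoduleE(1)[OF tensor_free]
    by (auto simp: module_def abelian_group_def)
  moreover have "free_lift k P (\<lambda>(m, n). f m n) h = free_lift k P (\<lambda>(m, n). g m n) h"
    if "h \<in> carrier F" for h
  proof -
    have "h p \<odot>\<^bsub>P\<^esub> (\<lambda>(m, n). f m n) p = h p \<odot>\<^bsub>P\<^esub> (\<lambda>(m, n). g m n) p"
      if "p \<in> {p. h p \<noteq> \<zero>\<^bsub>k\<^esub>}" for p
    proof -
      have "p \<in> carrier M \<times> carrier N"
        using \<open>h \<in> carrier F\<close> that by (cases p) (auto simp: free_module_carrier[OF M.R.cring_axioms])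
      then show ?thesis by (cases p) (auto simp: eq)
    qed
    then have "foldSetD (carrier P) (add P \<circ> (\<lambda>p. h p \<odot>\<^bsub>P\<^esub> (\<lambda>(m, n). f m n) p)) \<zero>\<^bsub>P\<^esub> `` {{p. h p \<noteq> \<zero>\<^bsub>k\<^esub>}} =
        foldSetD (carrier P) (add P \<circ> (\<lambda>p. h p \<odot>\<^bsub>P\<^esub> (\<lambda>(m, n). g m n) p)) \<zero>\<^bsub>P\<^esub> `` {{p. h p \<noteq> \<zero>\<^bsub>k\<^esub>}}"
      by (auto elim!: foldSetD_congD)
    then show ?thesis
      by (auto simp: free_lift_def finsum_def finprod_def foldD_def set_eq_iff)
  qed
  ultimately show ?thesis
    by (auto simp: tensor_lift_def quotient_lift_def intro!: arg_cong[of _ _ the_elem] image_cong)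
qed

text \<open>
  A sum over a fixed tensor is linear in a parameter of the summand. As the lift is only controlled on pure tensors,
  additivity in \<open>x\<close> is itself proved by extensionality in \<open>t\<close>.
\<close>

lemma tensor_lift_linear_param:
  assumes P: "module k P" and X: "module k X" and t: "t \<in> carrier (tensor k M N)"
    and f: "\<And>x. x \<in> carrier X \<Longrightarrow> f x \<in> bilinear_maps k M N P"
    and lin: "\<And>m n. \<lbrakk>m \<in> carrier M; n \<in> carrier N\<rbrakk> \<Longrightarrow> (\<lambda>x. f x m n) \<in> linear_maps k X P"
  shows "(\<lambda>x. tensor_lift k P (f x) t) \<in> linear_maps k X P"
proof (rule linear_mapsI)
  interpret X: module k X by (rule X)
  show "tensor_lift k P (f x) t \<in> carrier P" if "x \<in> carrier X" for x
    by (rule tensor_lift_closed[OF P f[OF that] t])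
  show "tensor_lift k P (f (x \<oplus>\<^bsub>X\<^esub> y)) t = tensor_lift k P (f x) t \<oplus>\<^bsub>P\<^esub> tensor_lift k P (f y) t"
    if x: "x \<in> carrier X" and y: "y \<in> carrier X" for x y
    by (rule tensor_ext[OF P tensor_lift_linear[OF P f]
        linear_sum[OF P tensor_lift_linear[OF P f] tensor_lift_linear[OF P f]] _ t])
      (use x y in \<open>auto simp: tensor_lift_tens[OF P f] linear_add[OF lin]\<close>)
  show "tensor_lift k P (f (r \<odot>\<^bsub>X\<^esub> x)) t = r \<odot>\<^bsub>P\<^esub> tensor_lift k P (f x) t"
    if r: "r \<in> carrier k" and x: "x \<in> carrier X" for r x
    by (rule tensor_ext[OF P tensor_lift_linear[OF P f] linear_scale[OF P r tensor_lift_linear[OF P f]] _ t])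
      (use r x in \<open>auto simp: tensor_lift_tens[OF P f] linear_smult[OF lin]\<close>)
qed

end

lemma tensor_lift_tensor_map:
  assumes "module k M" "module k N" "module k M'" "module k N'" "module k P"
    and f: "f \<in> bilinear_maps k M' N' P" and g: "g \<in> linear_maps k M M'" and h: "h \<in> linear_maps k N N'"
    and t: "t \<in> carrier (tensor k M N)"
  shows "tensor_lift k P f (tensor_map k M' N' g h t) = tensor_lift k P (\<lambda>m n. f (g m) (h n)) t"
proof -
  have b: "(\<lambda>m n. tens k M' N' (g m) (h n)) \<in> bilinear_maps k M N (tensor k M' N')"
    by (intro bilinear_mapsI bilinear_comp_left[OF tens_bilinear] bilinear_comp_right[OF tens_bilinear])
      (use assms in \<open>auto intro: linear_closed\<close>)
  have "tensor_lift k P f (tensor_map k M' N' g h t)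
    = tensor_lift k P (\<lambda>m n. tensor_lift k P f (tens k M' N' (g m) (h n))) t"
    unfolding tensor_map_def
    by (rule tensor_lift_push[OF assms(1,2) tensor_module[OF assms(3,4)] assms(5) b
          tensor_lift_linear[OF assms(3-5) f] t])
  also have "\<dots> = tensor_lift k P (\<lambda>m n. f (g m) (h n)) t"
    by (rule tensor_lift_cong[OF assms(1,2) t])
      (auto simp: tensor_lift_tens[OF assms(3-5) f] linear_closed[OF g] linear_closed[OF h])
  finally show ?thesis .
qed

lemma tensor_map_linear:
  assumes "module k M" "module k N" "module k M'" "module k N'"
    and g: "g \<in> linear_maps k M M'" and h: "h \<in> linear_maps k N N'"
  shows "tensor_map k M' N' g h \<in> linear_maps k (tensor k M N) (tensor k M' N')"
  unfolding tensor_map_def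
  by (intro tensor_lift_linear tensor_module bilinear_mapsI bilinear_comp_left[OF tens_bilinear]
      bilinear_comp_right[OF tens_bilinear])
    (use assms in \<open>auto intro: linear_closed\<close>)

lemma tensor_map_tens:
  assumes "module k M" "module k N" "module k M'" "module k N'"
    and g: "g \<in> linear_maps k M M'" and h: "h \<in> linear_maps k N N'" and "m \<in> carrier M" "n \<in> carrier N"
  shows "tensor_map k M' N' g h (tens k M N m n) = tens k M' N' (g m) (h n)"
  unfolding tensor_map_def
  by (rule tensor_lift_tens, insert assms)
    (intro tensor_module bilinear_mapsI bilinear_comp_left[OF tens_bilinear]
      bilinear_comp_right[OF tens_bilinear] | auto intro: linear_closed)+

lemma tensor_lift_swap:
  assumes M: "module k M" "module k N" and M': "module k M'" "module k N'" and P: "module k P"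
    and s: "s \<in> carrier (tensor k M N)" and t: "t \<in> carrier (tensor k M' N')"
    and f: "\<And>m n. \<lbrakk>m \<in> carrier M; n \<in> carrier N\<rbrakk> \<Longrightarrow> f m n \<in> bilinear_maps k M' N' P"
    and f': "\<And>m' n'. \<lbrakk>m' \<in> carrier M'; n' \<in> carrier N'\<rbrakk> \<Longrightarrow> (\<lambda>m n. f m n m' n') \<in> bilinear_maps k M N P"
  shows "tensor_lift k P (\<lambda>m n. tensor_lift k P (f m n) t) s =
    tensor_lift k P (\<lambda>m' n'. tensor_lift k P (\<lambda>m n. f m n m' n') s) t"
proof -
  have inner: "(\<lambda>m n. tensor_lift k P (f m n) t) \<in> bilinear_maps k M N P"
    using bilinear_left[OF f'] bilinear_right[OF f'] f
    by (intro bilinear_mapsI; intro tensor_lift_linear_param[OF M' P _ t]) (use M in auto)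
  have b: "(\<lambda>m' n'. tensor_lift k P (\<lambda>m n. f m n m' n') s) \<in> bilinear_maps k M' N' P"
    if "s \<in> carrier (tensor k M N)" for s
    using bilinear_left[OF f] bilinear_right[OF f] f'
    by (intro bilinear_mapsI; intro tensor_lift_linear_param[OF M P _ that]) (use M' in auto)
  have outer: "(\<lambda>s. tensor_lift k P (\<lambda>m' n'. tensor_lift k P (\<lambda>m n. f m n m' n') s) t)
      \<in> linear_maps k (tensor k M N) P"
    by (intro tensor_lift_linear_param[OF M' P tensor_module[OF M] t] b tensor_lift_linear[OF M P f'])
  have "tensor_lift k P (\<lambda>m' n'. tensor_lift k P (\<lambda>m n. f m n m' n') (tens k M N m n)) t
     = tensor_lift k P (f m n) t" if "m \<in> carrier M" "n \<in> carrier N" for m n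
    by (rule tensor_lift_cong[OF M' t, symmetric]) (simp add: tensor_lift_tens[OF M P f'] that)
  then show ?thesis
    by (intro tensor_ext[OF M P tensor_lift_linear[OF M P inner] outer _ s])
      (simp add: tensor_lift_tens[OF M P inner])
qed

section \<open>The tensor product over a monoidal Hom-algebra\<close>

lemma hom_bimod_of_simps [simp]:
  "carrier (hom_bimod_of M \<mu> la ra) = carrier M" "\<zero>\<^bsub>hom_bimod_of M \<mu> la ra\<^esub> = \<zero>\<^bsub>M\<^esub>"
  "add (hom_bimod_of M \<mu> la ra) = add M" "smult (hom_bimod_of M \<mu> la ra) = smult M"
  "aut (hom_bimod_of M \<mu> la ra) = \<mu>" "lact (hom_bimod_of M \<mu> la ra) = la"
  "ract (hom_bimod_of M \<mu> la ra) = ra"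
  by (simp_all add: hom_bimod_of_def)

lemma module_hom_bimod_of: "module k M \<Longrightarrow> module k (hom_bimod_of M \<mu> la ra)"
  by (rule module_image[of k M _ "\<lambda>x. x"]) auto

lemma linear_maps_to_hom_bimod_of [simp]:
  "linear_maps k X (hom_bimod_of M \<mu> la ra) = linear_maps k X M"
  by (simp add: linear_maps_def)

lemma linear_maps_from_hom_bimod_of [simp]:
  "linear_maps k (hom_bimod_of M \<mu> la ra) X = linear_maps k M X"
  by (simp add: linear_maps_def)

text \<open>
  Finite sums in the record of a Hom-bimodule and in that of its underlying module are formally different terms,
  over additive monoids of different types. Their values agree, as only carrier, zero and addition enter.
\<close>

lemma free_lift_hom_bimod_of [simp]: "free_lift k (hom_bimod_of M \<mu> la ra) = free_lift k M"
  by (intro ext) (simp add: free_lift_def finsum_def finprod_def hom_bimod_of_def)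

lemma tensor_lift_hom_bimod_of [simp]:
  "tensor_lift k (hom_bimod_of M \<mu> la ra) = tensor_lift k M"
  by (intro ext) (simp add: tensor_lift_def)

text \<open>
  The balancing condition is stated for the arguments \<open>m\<close>, \<open>\<nu>(n)\<close> instead of \<open>m\<close>, \<open>n\<close>, so that the inverse of \<open>\<nu>\<close>
  does not occur; since \<open>\<nu>\<close> is bijective this is the same condition.
\<close>

definition balanced_maps ::
    "('k, 'r) ring_scheme \<Rightarrow> ('k, 'a, 'x) module_scheme \<Rightarrow> ('k, 'm, 'a, 'y) hom_bimod_scheme
      \<Rightarrow> ('k, 'n, 'a, 'z) hom_bimod_scheme \<Rightarrow> ('k, 'p, 'w) module_scheme \<Rightarrow> ('m \<Rightarrow> 'n \<Rightarrow> 'p) set"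
  where "balanced_maps k A M N P =
    {f \<in> bilinear_maps k M N P. \<forall>m\<in>carrier M. \<forall>a\<in>carrier A. \<forall>n\<in>carrier N.
      f (ract M m a) (aut N n) = f (aut M m) (lact N a n)}"

text \<open>
  The assumptions place the balancing relations inside \<open>M \<otimes> N\<close> and make the automorphism of \<open>N\<close> invertible.
  This suffices for the universal property of \<open>M \<otimes>\<^sub>A N\<close>, and it is easily checked when \<open>N\<close> is itself a tensor
  product over \<open>A\<close>, as in the coassociativity law.
\<close>

locale balanced_pair = M: module k M + N: module k N
  for k :: "('k, 'r) ring_scheme" and A :: "('k, 'a, 'x) module_scheme" and \<alpha> :: "'a \<Rightarrow> 'a"
    and M :: "('k, 'm, 'a, 'y) hom_bimod_scheme" and N :: "('k, 'n, 'a, 'z) hom_bimod_scheme" +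
  assumes ract_closed: "\<lbrakk>m \<in> carrier M; a \<in> carrier A\<rbrakk> \<Longrightarrow> ract M m a \<in> carrier M"
    and aut_closed: "m \<in> carrier M \<Longrightarrow> aut M m \<in> carrier M"
    and lact_closed: "\<lbrakk>a \<in> carrier A; n \<in> carrier N\<rbrakk> \<Longrightarrow> lact N a n \<in> carrier N"
    and aut_bij: "bij_betw (aut N) (carrier N) (carrier N)"
begin

abbreviation "T \<equiv> tensor k M N"
abbreviation "R \<equiv> balanced_relations k A M N"
abbreviation "H \<equiv> hom_tensor k A \<alpha> M N"
abbreviation "t \<equiv> hom_tens k A M N"

lemma T_module: "module k T"
  by (rule tensor_module[OF M.module_axioms N.module_axioms])

interpretation T: module k T by (rule T_module)

lemma aut_inv_closed: "n \<in> carrier N \<Longrightarrow> aut_inv N (aut N) n \<in> carrier N"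
  using aut_bij by (metis bij_betwE bij_betw_inv_into)

lemma aut_aut_inv: "n \<in> carrier N \<Longrightarrow> aut N (aut_inv N (aut N) n) = n"
  using aut_bij by (simp add: bij_betw_inv_into_right)

lemma aut_inv_aut: "n \<in> carrier N \<Longrightarrow> aut_inv N (aut N) (aut N n) = n"
  using aut_bij by (simp add: bij_betw_inv_into_left)

lemma tens_closed': "\<lbrakk>m \<in> carrier M; n \<in> carrier N\<rbrakk> \<Longrightarrow> tens k M N m n \<in> carrier T"
  by (rule tens_closed[OF M.module_axioms N.module_axioms])

lemma generators_subset:
  "{tens k M N (ract M m a) n \<ominus>\<^bsub>T\<^esub> tens k M N (aut M m) (lact N a (aut_inv N (aut N) n)) | m a n.
       m \<in> carrier M \<and> a \<in> carrier A \<and> n \<in> carrier N} \<subseteq> carrier T"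
  by (auto intro!: T.M.minus_closed tens_closed' ract_closed aut_closed lact_closed aut_inv_closed)

lemma R_submodule: "submodule R k T"
  unfolding balanced_relations_def by (rule module_span_submodule[OF T_module generators_subset])

lemma H_def: "H = hom_bimod_of (quotient_module T R) (aut H) (lact H) (ract H)"
  by (simp add: hom_tensor_def Let_def)

lemma H_module: "module k H"
  by (subst H_def) (rule module_hom_bimod_of[OF quotient_module_module[OF T_module R_submodule]])

lemma coset_linear': "(\<lambda>x. R +>\<^bsub>T\<^esub> x) \<in> linear_maps k T H"
  by (subst H_def) (use coset_linear[OF T_module R_submodule] in simp)

lemma hom_tens_bilinear: "t \<in> bilinear_maps k M N H"
  using tens_bilinear[OF M.module_axioms N.module_axioms] coset_linear' unfolding hom_tens_def[abs_def]
  by (intro bilinear_mapsI linear_comp[OF coset_linear']) (auto intro: bilinear_left bilinear_right)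

lemma hom_tens_closed: "\<lbrakk>m \<in> carrier M; n \<in> carrier N\<rbrakk> \<Longrightarrow> t m n \<in> carrier H"
  by (rule bilinear_closed[OF hom_tens_bilinear])

lemma hom_tens_balanced:
  assumes "m \<in> carrier M" "a \<in> carrier A" "n \<in> carrier N"
  shows "t (ract M m a) (aut N n) = t (aut M m) (lact N a n)"
proof -
  have n: "aut N n \<in> carrier N" using aut_bij assms(3) by (rule bij_betwE[THEN bspec])
  have "tens k M N (ract M m a) (aut N n) \<ominus>\<^bsub>T\<^esub> tens k M N (aut M m) (lact N a n) \<in> R"
    unfolding balanced_relations_def
    by (rule module_span_incl) (use assms n aut_inv_aut[OF assms(3)] in \<open>force intro!: exI\<close>)
  then show ?thesis unfolding hom_tens_def
    using coset_eq_iff[OF T_module R_submodule] assms n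
    by (simp add: tens_closed' ract_closed aut_closed lact_closed)
qed

lemma hom_tensor_ext:
  assumes P: "module k P" and g: "g \<in> linear_maps k H P" "g' \<in> linear_maps k H P"
    and eq: "\<And>m n. \<lbrakk>m \<in> carrier M; n \<in> carrier N\<rbrakk> \<Longrightarrow> g (t m n) = g' (t m n)"
    and x: "x \<in> carrier H"
  shows "g x = g' x"
proof -
  have "carrier H = carrier (quotient_module T R)" by (subst H_def) simp
  then obtain s where s: "s \<in> carrier T" "x = R +>\<^bsub>T\<^esub> s"
    using x by (auto simp: quotient_carrier[OF T_module R_submodule])
  show ?thesis unfolding s(2)
    by (rule tensor_ext[OF M.module_axioms N.module_axioms P linear_comp[OF g(1) coset_linear']
        linear_comp[OF g(2) coset_linear'] _ s(1)])
      (use eq in \<open>simp add: hom_tens_def\<close>)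
qed

context
  fixes P :: "('k, 'p, 'w) module_scheme" and f :: "'m \<Rightarrow> 'n \<Rightarrow> 'p"
  assumes P: "module k P" and f: "f \<in> balanced_maps k A M N P"
begin

interpretation P: module k P by (rule P)

lemma balanced_lift_linear: "tensor_lift k P f \<in> linear_maps k T P"
  using f by (intro tensor_lift_linear[OF M.module_axioms N.module_axioms P]) (simp add: balanced_maps_def)

lemma balanced_lift_vanishes:
  assumes "x \<in> R"
  shows "tensor_lift k P f x = \<zero>\<^bsub>P\<^esub>"
proof (rule linear_vanishes_on_span[OF T_module P balanced_lift_linear generators_subset])
  have fb: "f \<in> bilinear_maps k M N P" using f by (simp add: balanced_maps_def)
  fix s assume "s \<in> {tens k M N (ract M m a) n \<ominus>\<^bsub>T\<^esub> tens k M N (aut M m) (lact N a (aut_inv N (aut N) n)) | m a n.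
       m \<in> carrier M \<and> a \<in> carrier A \<and> n \<in> carrier N}"
  then obtain m a n where s: "m \<in> carrier M" "a \<in> carrier A" "n \<in> carrier N"
    "s = tens k M N (ract M m a) n \<ominus>\<^bsub>T\<^esub> tens k M N (aut M m) (lact N a (aut_inv N (aut N) n))" by blast
  note lift = tensor_lift_tens[OF M.module_axioms N.module_axioms P fb]
  note cl = ract_closed aut_closed lact_closed aut_inv_closed tens_closed'
  have "f (ract M m a) (aut N (aut_inv N (aut N) n)) = f (aut M m) (lact N a (aut_inv N (aut N) n))"
    using f s by (simp add: balanced_maps_def aut_inv_closed)
  then have "f (ract M m a) n = f (aut M m) (lact N a (aut_inv N (aut N) n))"
    using s by (simp add: aut_aut_inv)
  moreover have "f (aut M m) (lact N a (aut_inv N (aut N) n)) \<in> carrier P"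
    using s by (intro bilinear_closed[OF fb] cl)
  ultimately show "tensor_lift k P f s = \<zero>\<^bsub>P\<^esub>"
    using s by (simp add: linear_diff[OF balanced_lift_linear T_module P] cl lift module_minus_self[OF P])
qed (use assms in \<open>simp add: balanced_relations_def\<close>)

lemma hom_tensor_lift_linear: "hom_tensor_lift k P f \<in> linear_maps k H P"
  unfolding hom_tensor_lift_def
  by (subst H_def)
    (use quotient_lift_linear[OF T_module R_submodule P balanced_lift_linear balanced_lift_vanishes] in simp)

lemma hom_tensor_lift_tens:
  "\<lbrakk>m \<in> carrier M; n \<in> carrier N\<rbrakk> \<Longrightarrow> hom_tensor_lift k P f (t m n) = f m n"
  unfolding hom_tensor_lift_def hom_tens_def
  using f quotient_lift_coset[OF T_module R_submodule P balanced_lift_linear balanced_lift_vanishes]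
  by (simp add: tens_closed' tensor_lift_tens[OF M.module_axioms N.module_axioms P] balanced_maps_def)

end

end

lemma hom_tensor_lift_hom_bimod_of [simp]:
  "hom_tensor_lift k (hom_bimod_of M \<mu> la ra) = hom_tensor_lift k M"
  by (simp add: hom_tensor_lift_def fun_eq_iff)

context hom_object
begin

lemma object_module: "module k M"
  by (rule module_axioms)

lemma aut_bar_closed: "x \<in> carrier M \<Longrightarrow> aut_inv M \<mu> x \<in> carrier M"
  using aut_bij by (metis bij_betwE bij_betw_inv_into)

lemma aut_bar_right: "x \<in> carrier M \<Longrightarrow> \<mu> (aut_inv M \<mu> x) = x"
  using aut_bij by (simp add: bij_betw_inv_into_right)

lemma aut_bar_left: "x \<in> carrier M \<Longrightarrow> aut_inv M \<mu> (\<mu> x) = x"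
  using aut_bij by (simp add: bij_betw_inv_into_left)

lemma aut_bar_eqI: "\<lbrakk>x \<in> carrier M; \<mu> x = y\<rbrakk> \<Longrightarrow> aut_inv M \<mu> y = x"
  using aut_bar_left by blast

lemma aut_self_closed: "x \<in> carrier M \<Longrightarrow> \<mu> x \<in> carrier M"
  by (rule linear_closed[OF aut_linear])

lemma aut_bar_linear: "aut_inv M \<mu> \<in> linear_maps k M M"
  by (rule linear_mapsI)
    (auto intro!: aut_bar_eqI simp: aut_bar_closed linear_add[OF aut_linear] linear_smult[OF aut_linear]
      aut_bar_right)

end

section \<open>The tensor product of two Hom-bimodules\<close>

locale hom_bimodule_pair = M: hom_bimodule k A \<alpha> M + N: hom_bimodule k A \<alpha> N
  for k :: "('k, 'r) ring_scheme" and A :: "('k, 'a, 'x) module_scheme" and \<alpha> :: "'a \<Rightarrow> 'a"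
    and M :: "('k, 'm, 'a, 'y) hom_bimod_scheme" and N :: "('k, 'n, 'a, 'z) hom_bimod_scheme"
begin

lemmas M_lact = bilinear_closed[OF M.lact_bilinear] and M_ract = bilinear_closed[OF M.ract_bilinear]
  and N_lact = bilinear_closed[OF N.lact_bilinear] and N_ract = bilinear_closed[OF N.ract_bilinear]

sublocale balanced_pair k A \<alpha> M N
  by unfold_locales (auto intro: M_ract N_lact M.M.aut_self_closed N.M.aut_bij)

abbreviation "ai \<equiv> aut_inv A \<alpha>"
abbreviation "mi \<equiv> aut_inv M (aut M)"
abbreviation "ni \<equiv> aut_inv N (aut N)"

lemmas pair_closed = M_lact M_ract N_lact N_ract M.M.aut_self_closed N.M.aut_self_closed
  M.M.aut_bar_closed N.M.aut_bar_closed M.A.aut_bar_closed M.A.aut_self_closed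

lemmas pair_inv = M.M.aut_bar_left M.M.aut_bar_right N.M.aut_bar_left N.M.aut_bar_right
  M.A.aut_bar_left M.A.aut_bar_right

lemma mi_ract: "\<lbrakk>m \<in> carrier M; a \<in> carrier A\<rbrakk> \<Longrightarrow> mi (ract M m a) = ract M (mi m) (ai a)"
  by (rule M.M.aut_bar_eqI) (simp_all add: pair_closed M.ract_aut pair_inv)

lemma ni_lact: "\<lbrakk>n \<in> carrier N; a \<in> carrier A\<rbrakk> \<Longrightarrow> ni (lact N a n) = lact N (ai a) (ni n)"
  by (rule N.M.aut_bar_eqI) (simp_all add: pair_closed N.lact_aut pair_inv)

lemma hom_tens_balanced_inv:
  "\<lbrakk>m \<in> carrier M; a \<in> carrier A; n \<in> carrier N\<rbrakk> \<Longrightarrow> t (ract M m a) n = t (aut M m) (lact N a (ni n))"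
  using hom_tens_balanced[of m a "ni n"] by (simp add: pair_inv pair_closed)

text \<open>
  The automorphism and both actions of \<open>M \<otimes>\<^sub>A N\<close> are induced by a pair of linear maps of the factors, so each
  of them comes down to one balancing identity.
\<close>

lemma hom_tens_comp_balanced:
  assumes "f \<in> linear_maps k M M" "g \<in> linear_maps k N N"
    "\<And>m a n. \<lbrakk>m \<in> carrier M; a \<in> carrier A; n \<in> carrier N\<rbrakk>
      \<Longrightarrow> t (f (ract M m a)) (g (aut N n)) = t (f (aut M m)) (g (lact N a n))"
  shows "(\<lambda>m n. t (f m) (g n)) \<in> balanced_maps k A M N H"
  using assms
  by (auto simp: balanced_maps_def linear_closed intro!: bilinear_mapsI
    bilinear_comp_left[OF hom_tens_bilinear] bilinear_comp_right[OF hom_tens_bilinear])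

lemma aut_balanced: "(\<lambda>m n. t (aut M m) (aut N n)) \<in> balanced_maps k A M N H"
  by (rule hom_tens_comp_balanced)
    (simp_all add: M.M.aut_linear N.M.aut_linear M.ract_aut N.lact_aut hom_tens_balanced pair_closed)

lemma aut_inv_balanced: "(\<lambda>m n. t (mi m) (ni n)) \<in> balanced_maps k A M N H"
  by (rule hom_tens_comp_balanced)
    (simp_all add: M.M.aut_bar_linear N.M.aut_bar_linear mi_ract ni_lact pair_inv hom_tens_balanced_inv pair_closed)

text \<open>
  The left action on the first factor passes the right action by the Hom-bimodule axiom, at the price of one more
  inverse automorphism on \<open>a\<close>.
\<close>

lemma lact_balanced:
  assumes a: "a \<in> carrier A"
  shows "(\<lambda>m n. t (lact M (ai a) m) (aut N n)) \<in> balanced_maps k A M N H"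
proof (rule hom_tens_comp_balanced)
  fix m b n assume *: "m \<in> carrier M" "b \<in> carrier A" "n \<in> carrier N"
  have "lact M (ai a) (ract M m b) = ract M (lact M (ai (ai a)) m) (\<alpha> b)"
    using M.hom_bimodule_assoc[of "ai (ai a)" m b] a * by (simp add: pair_inv pair_closed)
  then show "t (lact M (ai a) (ract M m b)) (aut N (aut N n)) = t (lact M (ai a) (aut M m)) (aut N (lact N b n))"
    using a * by (simp add: hom_tens_balanced pair_closed M.lact_aut N.lact_aut pair_inv)
qed (use a in \<open>auto intro: bilinear_right[OF M.lact_bilinear] N.M.aut_linear simp: pair_closed\<close>)

lemma ract_balanced:
  assumes a: "a \<in> carrier A"
  shows "(\<lambda>m n. t (aut M m) (ract N n (ai a))) \<in> balanced_maps k A M N H"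
proof (rule hom_tens_comp_balanced)
  fix m b n assume *: "m \<in> carrier M" "b \<in> carrier A" "n \<in> carrier N"
  have "ract N (aut N n) (ai a) = aut N (ract N n (ai (ai a)))"
    using a * by (simp add: pair_inv pair_closed N.ract_aut)
  moreover have "lact N (\<alpha> b) (ract N n (ai (ai a))) = ract N (lact N b n) (ai a)"
    using N.hom_bimodule_assoc[of b n "ai (ai a)"] a * by (simp add: pair_inv pair_closed)
  ultimately show "t (aut M (ract M m b)) (ract N (aut N n) (ai a)) = t (aut M (aut M m)) (ract N (lact N b n) (ai a))"
    using a * by (simp add: hom_tens_balanced pair_closed M.ract_aut)
qed (use a in \<open>auto intro: bilinear_left[OF N.ract_bilinear] M.M.aut_linear simp: pair_closed\<close>)

lemma aut_H: "aut H = hom_tensor_lift k H (\<lambda>m n. t (aut M m) (aut N n))"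
  and lact_H: "lact H a = hom_tensor_lift k H (\<lambda>m n. t (lact M (ai a) m) (aut N n))"
  and ract_H: "ract H x a = hom_tensor_lift k H (\<lambda>m n. t (aut M m) (ract N n (ai a))) x"
  by (simp_all add: hom_tensor_def Let_def)

lemma aut_H_linear: "aut H \<in> linear_maps k H H"
  unfolding aut_H by (rule hom_tensor_lift_linear[OF H_module aut_balanced])

lemma lact_H_linear: "a \<in> carrier A \<Longrightarrow> lact H a \<in> linear_maps k H H"
  unfolding lact_H by (rule hom_tensor_lift_linear[OF H_module lact_balanced])

lemma ract_H_linear: "a \<in> carrier A \<Longrightarrow> (\<lambda>x. ract H x a) \<in> linear_maps k H H"
  unfolding ract_H using hom_tensor_lift_linear[OF H_module ract_balanced] by simp

lemma aut_H_tens: "\<lbrakk>m \<in> carrier M; n \<in> carrier N\<rbrakk> \<Longrightarrow> aut H (t m n) = t (aut M m) (aut N n)"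
  unfolding aut_H by (rule hom_tensor_lift_tens[OF H_module aut_balanced])

lemma lact_H_tens:
  "\<lbrakk>a \<in> carrier A; m \<in> carrier M; n \<in> carrier N\<rbrakk> \<Longrightarrow> lact H a (t m n) = t (lact M (ai a) m) (aut N n)"
  unfolding lact_H by (rule hom_tensor_lift_tens[OF H_module lact_balanced])

lemma ract_H_tens:
  "\<lbrakk>a \<in> carrier A; m \<in> carrier M; n \<in> carrier N\<rbrakk> \<Longrightarrow> ract H (t m n) a = t (aut M m) (ract N n (ai a))"
  unfolding ract_H by (rule hom_tensor_lift_tens[OF H_module ract_balanced])

lemma aut_H_bij: "bij_betw (aut H) (carrier H) (carrier H)"
proof (rule bij_betw_byWitness)
  let ?h = "hom_tensor_lift k H (\<lambda>m n. t (mi m) (ni n))"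
  note h = hom_tensor_lift_linear[OF H_module aut_inv_balanced]
    and ht = hom_tensor_lift_tens[OF H_module aut_inv_balanced]
  show "\<forall>x\<in>carrier H. ?h (aut H x) = x"
    by (rule ballI, rule hom_tensor_ext[OF H_module linear_comp[OF h aut_H_linear] linear_ident])
      (simp_all add: aut_H_tens ht pair_closed pair_inv)
  show "\<forall>x\<in>carrier H. aut H (?h x) = x"
    by (rule ballI, rule hom_tensor_ext[OF H_module linear_comp[OF aut_H_linear h] linear_ident])
      (simp_all add: aut_H_tens ht pair_closed pair_inv)
qed (use linear_closed[OF aut_H_linear] linear_closed[OF hom_tensor_lift_linear[OF H_module aut_inv_balanced]] in auto)

end

section \<open>Bimodule maps into the tensor square\<close>

text \<open>
  For a bimodule map \<open>\<Delta>\<close> into the tensor square, both sides of the coassociativity law are lifts of maps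
  on \<open>M \<times> M\<close>. They are meaningful only if these maps are balanced, which is derived here from the
  bimodule property of \<open>\<Delta>\<close>.
\<close>

locale hom_bimodule_comult = hom_bimodule k A \<alpha> M
  for k :: "('k, 'r) ring_scheme" and A :: "('k, 'a, 'x) module_scheme" and \<alpha> :: "'a \<Rightarrow> 'a"
    and M :: "('k, 'm, 'a, 'y) hom_bimod_scheme" and D +
  assumes D: "D \<in> bimodule_maps k A M (hom_tensor k A \<alpha> M M)"
begin

sublocale pair: hom_bimodule_pair k A \<alpha> M M
  by unfold_locales

abbreviation "H \<equiv> hom_tensor k A \<alpha> M M"

sublocale triple: balanced_pair k A \<alpha> M H
  by (intro balanced_pair.intro balanced_pair_axioms.intro M.object_module pair.H_module
      pair.aut_H_bij pair.M_ract M.aut_self_closed linear_closed[OF pair.lact_H_linear])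

abbreviation "K \<equiv> hom_tensor k A \<alpha> M H"
abbreviation "tt \<equiv> hom_tens k A M H"

lemma D_linear: "D \<in> linear_maps k M H"
  and D_aut: "m \<in> carrier M \<Longrightarrow> D (aut M m) = aut H (D m)"
  and D_lact: "\<lbrakk>a \<in> carrier A; m \<in> carrier M\<rbrakk> \<Longrightarrow> D (lact M a m) = lact H a (D m)"
  and D_ract: "\<lbrakk>a \<in> carrier A; m \<in> carrier M\<rbrakk> \<Longrightarrow> D (ract M m a) = ract H (D m) a"
  using D by (auto simp: bimodule_maps_def)

lemma D_closed: "m \<in> carrier M \<Longrightarrow> D m \<in> carrier H"
  by (rule linear_closed[OF D_linear])

lemma coassoc_left_balanced: "(\<lambda>x1 x2. tt x1 (D x2)) \<in> balanced_maps k A M M K"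
  unfolding balanced_maps_def
  by (auto intro!: bilinear_mapsI bilinear_left[OF triple.hom_tens_bilinear]
    bilinear_comp_right[OF triple.hom_tens_bilinear D_linear]
    simp: D_closed D_aut D_lact triple.hom_tens_balanced)

text \<open>
  Moving \<open>a\<close> from the first factor to the second lets it act on \<open>M \<otimes>\<^sub>A M\<close>. As the automorphism of
  \<open>M \<otimes>\<^sub>A M\<close> is applied to both factors, \<open>y\<close> is first written as an image under the automorphism.
\<close>

lemma coassoc_inner_balanced:
  assumes y: "y \<in> carrier M"
  shows "(\<lambda>x11 x12. tt (aut M x11) (pair.t x12 y)) \<in> balanced_maps k A M M K"
proof -
  have "tt (aut M (ract M m a)) (pair.t (aut M n) y) = tt (aut M (aut M m)) (pair.t (lact M a n) y)"
    if *: "m \<in> carrier M" "a \<in> carrier A" "n \<in> carrier M" for m a n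
  proof -
    have "pair.t (aut M n) y = aut H (pair.t n (pair.mi y))"
      using * y by (simp add: pair.aut_H_tens pair.pair_closed pair.pair_inv)
    then have "tt (aut M (ract M m a)) (pair.t (aut M n) y)
        = tt (aut M (aut M m)) (lact H (\<alpha> a) (pair.t n (pair.mi y)))"
      using * y triple.hom_tens_balanced[of "aut M m" "\<alpha> a" "pair.t n (pair.mi y)"]
      by (simp add: ract_aut pair.pair_closed pair.hom_tens_closed)
    then show ?thesis
      using * y by (simp add: pair.lact_H_tens pair.pair_closed pair.pair_inv)
  qed
  then show ?thesis using y unfolding balanced_maps_def
    by (auto intro!: bilinear_mapsI bilinear_comp_left[OF triple.hom_tens_bilinear]
      bilinear_comp_right[OF triple.hom_tens_bilinear] bilinear_left[OF pair.hom_tens_bilinear] M.aut_linear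
      simp: pair.pair_closed pair.hom_tens_closed)
qed

lemma coassoc_right_linear:
  assumes "z \<in> carrier H"
  shows "(\<lambda>y. hom_tensor_lift k K (\<lambda>x11 x12. tt (aut M x11) (pair.t x12 y)) z) \<in> linear_maps k M K"
proof (rule linear_mapsI)
  note lt = pair.hom_tensor_lift_tens[OF triple.H_module coassoc_inner_balanced]
    and ll = pair.hom_tensor_lift_linear[OF triple.H_module coassoc_inner_balanced]
  note tl = bilinear_comp_right[OF triple.hom_tens_bilinear bilinear_right[OF pair.hom_tens_bilinear]]
  show "hom_tensor_lift k K (\<lambda>x11 x12. tt (aut M x11) (pair.t x12 y)) z \<in> carrier K"
    if "y \<in> carrier M" for y
    by (rule linear_closed[OF ll[OF that] assms])
  show "hom_tensor_lift k K (\<lambda>x11 x12. tt (aut M x11) (pair.t x12 (y \<oplus>\<^bsub>M\<^esub> y'))) z =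
     hom_tensor_lift k K (\<lambda>x11 x12. tt (aut M x11) (pair.t x12 y)) z \<oplus>\<^bsub>K\<^esub>
     hom_tensor_lift k K (\<lambda>x11 x12. tt (aut M x11) (pair.t x12 y')) z"
    if y: "y \<in> carrier M" "y' \<in> carrier M" for y y'
    by (rule pair.hom_tensor_ext[OF triple.H_module ll linear_sum[OF triple.H_module ll ll] _ assms])
      (use y in \<open>auto simp: lt pair.pair_closed linear_add[OF tl]\<close>)
  show "hom_tensor_lift k K (\<lambda>x11 x12. tt (aut M x11) (pair.t x12 (r \<odot>\<^bsub>M\<^esub> y))) z =
     r \<odot>\<^bsub>K\<^esub> hom_tensor_lift k K (\<lambda>x11 x12. tt (aut M x11) (pair.t x12 y)) z"
    if r: "r \<in> carrier k" and y: "y \<in> carrier M" for r y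
    by (rule pair.hom_tensor_ext[OF triple.H_module ll linear_scale[OF triple.H_module r ll] _ assms])
      (use r y in \<open>auto simp: lt pair.pair_closed linear_smult[OF tl]\<close>)
qed

text \<open>
  By right linearity of \<open>\<Delta>\<close>, acting on \<open>x\<^sub>1\<close> means acting on its second component, and the relations of the
  inner tensor product carry the scalar over to \<open>x\<^sub>2\<close>.
\<close>

lemma coassoc_right_balanced:
  "(\<lambda>x1 x2. hom_tensor_lift k K (\<lambda>x11 x12. tt (aut M x11) (pair.t x12 (pair.mi x2))) (D x1))
    \<in> balanced_maps k A M M K"
proof -
  let ?g = "\<lambda>y. hom_tensor_lift k K (\<lambda>x11 x12. tt (aut M x11) (pair.t x12 y))"
  note gl = pair.hom_tensor_lift_linear[OF triple.H_module coassoc_inner_balanced]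
    and gt = pair.hom_tensor_lift_tens[OF triple.H_module coassoc_inner_balanced]
  have "?g x (ract H z a) = ?g (pair.mi (lact M a x)) (aut H z)"
    if *: "a \<in> carrier A" "x \<in> carrier M" and z: "z \<in> carrier H" for a x z
    by (rule pair.hom_tensor_ext[OF triple.H_module
          linear_comp[OF gl pair.ract_H_linear] linear_comp[OF gl pair.aut_H_linear] _ z])
      (use * in \<open>auto simp: pair.ract_H_tens pair.aut_H_tens gt pair.pair_closed pair.ni_lact pair.hom_tens_balanced_inv\<close>)
  then show ?thesis unfolding balanced_maps_def
    by (auto intro!: bilinear_mapsI linear_comp[OF gl D_linear]
        linear_comp[OF coassoc_right_linear M.aut_bar_linear]
      simp: D_closed D_aut D_ract pair.pair_closed pair.pair_inv)
qed

end

section \<open>Sweedler sums\<close>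

locale module_comodule_datum =
  fixes k :: "('k, 'r) ring_scheme"
    and B :: "('k, 'b, 'x) module_scheme" and \<beta> :: "'b \<Rightarrow> 'b"
    and \<Delta>B :: "'b \<Rightarrow> ('k, 'b, 'b) tensor" and \<epsilon>B :: "'b \<Rightarrow> 'k"
    and A :: "('k, 'a, 'y) module_scheme" and \<alpha> :: "'a \<Rightarrow> 'a"
    and act :: "'b \<Rightarrow> 'a \<Rightarrow> 'a"
    and C :: "('k, 'c, 'z) module_scheme" and \<gamma> :: "'c \<Rightarrow> 'c"
    and \<Delta>C :: "'c \<Rightarrow> ('k, 'c, 'c) tensor" and \<epsilon>C :: "'c \<Rightarrow> 'k"
    and coact :: "'c \<Rightarrow> ('k, 'b, 'c) tensor"
  assumes module_algebra: "left_hom_module_algebra k B \<beta> \<Delta>B \<epsilon>B A \<alpha> act"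
    and comodule_coalgebra: "left_hom_comodule_coalgebra k B \<beta> \<Delta>B \<epsilon>B C \<gamma> \<Delta>C \<epsilon>C coact"
begin

lemma bialgebra: "monoidal_hom_bialgebra k B \<beta> \<Delta>B \<epsilon>B"
  using module_algebra by (simp add: left_hom_module_algebra_def)

lemma B_algebra: "monoidal_hom_algebra k B \<beta>"
  and B_coalgebra: "monoidal_hom_coalgebra k B \<beta> \<Delta>B \<epsilon>B"
  using bialgebra by (simp_all add: monoidal_hom_bialgebra_def)

lemma A_algebra: "monoidal_hom_algebra k A \<alpha>"
  and A_module: "left_hom_module k B \<beta> A \<alpha> act"
  using module_algebra by (simp_all add: left_hom_module_algebra_def)

lemma C_coalgebra: "monoidal_hom_coalgebra k C \<gamma> \<Delta>C \<epsilon>C"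
  and C_comodule: "left_hom_comodule k B \<beta> \<Delta>B \<epsilon>B C \<gamma> coact"
  using comodule_coalgebra by (simp_all add: left_hom_comodule_coalgebra_def)

lemma objects: "hom_object k A \<alpha>" "hom_object k B \<beta>" "hom_object k C \<gamma>"
  using A_algebra B_algebra C_coalgebra
  by (simp_all add: monoidal_hom_algebra_def monoidal_hom_coalgebra_def)

lemmas modules = objects[THEN hom_object.object_module]

lemma k_cring: "cring k"
  using modules(1) by (simp add: module_def)

lemmas all_modules = modules tensor_module base_module_module[OF k_cring]

abbreviation "\<alpha>' \<equiv> aut_inv A \<alpha>"
abbreviation "\<beta>' \<equiv> aut_inv B \<beta>"
abbreviation "\<gamma>' \<equiv> aut_inv C \<gamma>"

text \<open>
  Sums \<open>\<Sum> f b\<^sub>1 b\<^sub>2\<close>, \<open>\<Sum> f c\<^sub>1 c\<^sub>2\<close> and \<open>\<Sum> f c\<^sub>(\<^sub>-\<^sub>1\<^sub>) c\<^sub>(\<^sub>0\<^sub>)\<close>. They are separate constants so that each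
  has its own congruence rule; the rule supplies the carriers of the bound variables.
\<close>

definition "SB P f b = tensor_lift k P f (\<Delta>B b)"
definition "SC P f c = tensor_lift k P f (\<Delta>C c)"
definition "SX P f c = tensor_lift k P f (coact c)"

lemmas \<Delta>B_linear = monoidal_hom_coalgebra.comult_linear[OF B_coalgebra]
  and \<Delta>C_linear = monoidal_hom_coalgebra.comult_linear[OF C_coalgebra]
  and coact_linear = left_hom_comodule.coact_linear[OF C_comodule]
  and \<epsilon>B_linear = monoidal_hom_coalgebra.counit_linear[OF B_coalgebra]
  and \<epsilon>C_linear = monoidal_hom_coalgebra.counit_linear[OF C_coalgebra]
  and multA_bilinear = monoidal_hom_algebra.mult_bilinear[OF A_algebra]
  and multB_bilinear = monoidal_hom_algebra.mult_bilinear[OF B_algebra]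
  and act_bilinear = left_hom_module.lact_bilinear[OF A_module]
  and aut_linears = objects[THEN hom_object.aut_linear] objects[THEN hom_object.aut_bar_linear]

lemmas comult_closed = linear_closed[OF \<Delta>B_linear] linear_closed[OF \<Delta>C_linear] linear_closed[OF coact_linear]

lemma \<epsilon>_closed: "b \<in> carrier B \<Longrightarrow> \<epsilon>B b \<in> carrier k" "c \<in> carrier C \<Longrightarrow> \<epsilon>C c \<in> carrier k"
  using linear_closed[OF \<epsilon>B_linear] linear_closed[OF \<epsilon>C_linear] by simp_all

lemma SB_closed: "\<lbrakk>module k P; f \<in> bilinear_maps k B B P; b \<in> carrier B\<rbrakk> \<Longrightarrow> SB P f b \<in> carrier P"
  and SC_closed: "\<lbrakk>module k P; g \<in> bilinear_maps k C C P; c \<in> carrier C\<rbrakk> \<Longrightarrow> SC P g c \<in> carrier P"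
  and SX_closed: "\<lbrakk>module k P; h \<in> bilinear_maps k B C P; c \<in> carrier C\<rbrakk> \<Longrightarrow> SX P h c \<in> carrier P"
  unfolding SB_def SC_def SX_def by (auto intro: tensor_lift_closed modules comult_closed)

lemma unit_closed: "\<one>\<^bsub>A\<^esub> \<in> carrier A" "\<one>\<^bsub>B\<^esub> \<in> carrier B"
  using monoidal_hom_algebra.one_in_carrier[OF A_algebra] monoidal_hom_algebra.one_in_carrier[OF B_algebra] .

lemmas closed = bilinear_closed[OF multA_bilinear] bilinear_closed[OF multB_bilinear]
  bilinear_closed[OF act_bilinear] aut_linears[THEN linear_closed] tens_closed \<epsilon>_closed SB_closed SC_closed
  SX_closed module.smult_closed unit_closed comult_closed

lemma SB_linear:
  "\<lbrakk>module k P; f1 \<in> bilinear_maps k B B P; g1 \<in> linear_maps k X B\<rbrakk> \<Longrightarrow> (\<lambda>x. SB P f1 (g1 x)) \<in> linear_maps k X P"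
  and SC_linear:
  "\<lbrakk>module k P; f2 \<in> bilinear_maps k C C P; g \<in> linear_maps k X C\<rbrakk> \<Longrightarrow> (\<lambda>x. SC P f2 (g x)) \<in> linear_maps k X P"
  and SX_linear:
  "\<lbrakk>module k P; f3 \<in> bilinear_maps k B C P; g \<in> linear_maps k X C\<rbrakk> \<Longrightarrow> (\<lambda>x. SX P f3 (g x)) \<in> linear_maps k X P"
  unfolding SB_def SC_def SX_def
  by (auto intro!: linear_comp[OF tensor_lift_linear] modules intro: linear_comp[OF \<Delta>B_linear]
    linear_comp[OF \<Delta>C_linear] linear_comp[OF coact_linear])

lemma SB_param:
  "\<lbrakk>module k P; module k X; b \<in> carrier B; \<And>x. x \<in> carrier X \<Longrightarrow> f x \<in> bilinear_maps k B B P;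
    \<And>m n. \<lbrakk>m \<in> carrier B; n \<in> carrier B\<rbrakk> \<Longrightarrow> (\<lambda>x. f x m n) \<in> linear_maps k X P\<rbrakk>
    \<Longrightarrow> (\<lambda>x. SB P (f x) b) \<in> linear_maps k X P"
  unfolding SB_def by (rule tensor_lift_linear_param[OF modules(2,2) _ _ comult_closed(1)])

lemma SC_param:
  "\<lbrakk>module k P; module k X; c \<in> carrier C; \<And>x. x \<in> carrier X \<Longrightarrow> f x \<in> bilinear_maps k C C P;
    \<And>m n. \<lbrakk>m \<in> carrier C; n \<in> carrier C\<rbrakk> \<Longrightarrow> (\<lambda>x. f x m n) \<in> linear_maps k X P\<rbrakk>
    \<Longrightarrow> (\<lambda>x. SC P (f x) c) \<in> linear_maps k X P"
  unfolding SC_def by (rule tensor_lift_linear_param[OF modules(3,3) _ _ comult_closed(2)])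

lemma SX_param:
  "\<lbrakk>module k P; module k X; c \<in> carrier C; \<And>x. x \<in> carrier X \<Longrightarrow> f x \<in> bilinear_maps k B C P;
    \<And>m n. \<lbrakk>m \<in> carrier B; n \<in> carrier C\<rbrakk> \<Longrightarrow> (\<lambda>x. f x m n) \<in> linear_maps k X P\<rbrakk>
    \<Longrightarrow> (\<lambda>x. SX P (f x) c) \<in> linear_maps k X P"
  unfolding SX_def by (rule tensor_lift_linear_param[OF modules(2,3) _ _ comult_closed(3)])

lemma counits_linear:
  "g \<in> linear_maps k X B \<Longrightarrow> (\<lambda>x. \<epsilon>B (g x)) \<in> linear_maps k X (base_module k)"
  "h \<in> linear_maps k X C \<Longrightarrow> (\<lambda>x. \<epsilon>C (h x)) \<in> linear_maps k X (base_module k)"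
  by (rule linear_comp[OF \<epsilon>B_linear], assumption, rule linear_comp[OF \<epsilon>C_linear])

text \<open>
  Rewriting with these rules shows that a nested sum is linear in a variable. The variable occurs exactly once,
  and there is a rule for each position in which it can occur.
\<close>

lemmas linearity = bilinear_mapsI linear_ident all_modules closed aut_linears[THEN linear_comp]
  bilinear_comp_left[OF multA_bilinear] bilinear_comp_right[OF multA_bilinear]
  bilinear_comp_left[OF multB_bilinear] bilinear_comp_right[OF multB_bilinear]
  bilinear_comp_left[OF act_bilinear] bilinear_comp_right[OF act_bilinear]
  bilinear_comp_left[OF tens_bilinear] bilinear_comp_right[OF tens_bilinear]
  linear_scale linear_scalar counits_linear SB_linear SC_linear SX_linear SB_param SC_param SX_param

lemma SB_cong [cong]:
  "\<lbrakk>b = b'; b' \<in> carrier B; \<And>x y. \<lbrakk>x \<in> carrier B; y \<in> carrier B\<rbrakk> \<Longrightarrow> f x y = g x y\<rbrakk> \<Longrightarrow> SB P f b = SB P g b'"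
  and SC_cong [cong]:
  "\<lbrakk>c = c'; c' \<in> carrier C; \<And>x y. \<lbrakk>x \<in> carrier C; y \<in> carrier C\<rbrakk> \<Longrightarrow> h x y = h' x y\<rbrakk> \<Longrightarrow> SC P h c = SC P h' c'"
  and SX_cong [cong]:
  "\<lbrakk>c = c'; c' \<in> carrier C; \<And>x y. \<lbrakk>x \<in> carrier B; y \<in> carrier C\<rbrakk> \<Longrightarrow> i x y = i' x y\<rbrakk> \<Longrightarrow> SX P i c = SX P i' c'"
  unfolding SB_def SC_def SX_def
  by (auto intro: tensor_lift_cong[OF modules(2,2)] tensor_lift_cong[OF modules(3,3)]
    tensor_lift_cong[OF modules(2,3)] comult_closed)

section \<open>Rewriting to Sweedler normal form\<close>

lemma SB_push:
  "\<lbrakk>g \<in> linear_maps k P Q; module k P; module k Q; f \<in> bilinear_maps k B B P; b \<in> carrier B\<rbrakk>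
    \<Longrightarrow> g (SB P f b) = SB Q (\<lambda>x y. g (f x y)) b"
  unfolding SB_def by (rule tensor_lift_push[OF modules(2,2) _ _ _ _ comult_closed(1)])

lemma SC_push:
  "\<lbrakk>g \<in> linear_maps k P Q; module k P; module k Q; f \<in> bilinear_maps k C C P; c \<in> carrier C\<rbrakk>
    \<Longrightarrow> g (SC P f c) = SC Q (\<lambda>x y. g (f x y)) c"
  unfolding SC_def by (rule tensor_lift_push[OF modules(3,3) _ _ _ _ comult_closed(2)])

lemma SX_push:
  "\<lbrakk>g \<in> linear_maps k P Q; module k P; module k Q; f \<in> bilinear_maps k B C P; c \<in> carrier C\<rbrakk>
    \<Longrightarrow> g (SX P f c) = SX Q (\<lambda>x y. g (f x y)) c"
  unfolding SX_def by (rule tensor_lift_push[OF modules(2,3) _ _ _ _ comult_closed(3)])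

lemmas push_rules = aut_linears[THEN SB_push] aut_linears[THEN SC_push] aut_linears[THEN SX_push]
  bilinear_left[OF multA_bilinear, THEN SB_push] bilinear_right[OF multA_bilinear, THEN SB_push]
  bilinear_left[OF multA_bilinear, THEN SX_push] bilinear_right[OF multA_bilinear, THEN SX_push]
  bilinear_left[OF tens_bilinear, THEN SB_push] bilinear_right[OF tens_bilinear, THEN SB_push]
  bilinear_left[OF tens_bilinear, THEN SC_push] bilinear_right[OF tens_bilinear, THEN SC_push]
  bilinear_left[OF tens_bilinear, THEN SX_push] bilinear_right[OF tens_bilinear, THEN SX_push]
  tensor_lift_linear[THEN SB_push] tensor_lift_linear[THEN SC_push] tensor_lift_linear[THEN SX_push]

lemmas scalar_rules = linear_smult[OF bilinear_left[OF multA_bilinear]] linear_smult[OF bilinear_right[OF multA_bilinear]]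
  linear_smult[OF bilinear_left[OF tens_bilinear]] linear_smult[OF bilinear_right[OF tens_bilinear]]
  aut_linears[THEN linear_smult]

lemmas fold_sums = SB_def[symmetric] SC_def[symmetric] SX_def[symmetric]

lemma SB_aut: "\<lbrakk>module k P; f \<in> bilinear_maps k B B P; b \<in> carrier B\<rbrakk>
    \<Longrightarrow> SB P f (\<beta> b) = SB P (\<lambda>x y. f (\<beta> x) (\<beta> y)) b"
  unfolding SB_def using monoidal_hom_coalgebra.comult_aut[OF B_coalgebra]
  by (simp add: tensor_lift_tensor_map[OF modules(2,2,2,2)] linearity aut_linears)

lemma SC_aut: "\<lbrakk>module k P; f \<in> bilinear_maps k C C P; c \<in> carrier C\<rbrakk>
    \<Longrightarrow> SC P f (\<gamma> c) = SC P (\<lambda>x y. f (\<gamma> x) (\<gamma> y)) c"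
  unfolding SC_def using monoidal_hom_coalgebra.comult_aut[OF C_coalgebra]
  by (simp add: tensor_lift_tensor_map[OF modules(3,3,3,3)] linearity aut_linears)

lemma SX_aut: "\<lbrakk>module k P; f \<in> bilinear_maps k B C P; c \<in> carrier C\<rbrakk>
    \<Longrightarrow> SX P f (\<gamma> c) = SX P (\<lambda>x y. f (\<beta> x) (\<gamma> y)) c"
  unfolding SX_def using left_hom_comodule.coact_aut[OF C_comodule]
  by (simp add: tensor_lift_tensor_map[OF modules(2,3,2,3)] linearity aut_linears)

lemmas aut_inverse = objects[THEN hom_object.aut_bar_left] objects[THEN hom_object.aut_bar_right]

lemma aut_mult:
  "\<lbrakk>a \<in> carrier A; a' \<in> carrier A\<rbrakk> \<Longrightarrow> \<alpha> (a \<otimes>\<^bsub>A\<^esub> a') = \<alpha> a \<otimes>\<^bsub>A\<^esub> \<alpha> a'"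
  "\<lbrakk>a \<in> carrier A; a' \<in> carrier A\<rbrakk> \<Longrightarrow> \<alpha>' (a \<otimes>\<^bsub>A\<^esub> a') = \<alpha>' a \<otimes>\<^bsub>A\<^esub> \<alpha>' a'"
  "\<lbrakk>b \<in> carrier B; b' \<in> carrier B\<rbrakk> \<Longrightarrow> \<beta> (b \<otimes>\<^bsub>B\<^esub> b') = \<beta> b \<otimes>\<^bsub>B\<^esub> \<beta> b'"
  "\<lbrakk>b \<in> carrier B; b' \<in> carrier B\<rbrakk> \<Longrightarrow> \<beta>' (b \<otimes>\<^bsub>B\<^esub> b') = \<beta>' b \<otimes>\<^bsub>B\<^esub> \<beta>' b'"
  "\<lbrakk>b \<in> carrier B; a \<in> carrier A\<rbrakk> \<Longrightarrow> \<alpha> (act b a) = act (\<beta> b) (\<alpha> a)"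
  "\<lbrakk>b \<in> carrier B; a \<in> carrier A\<rbrakk> \<Longrightarrow> \<alpha>' (act b a) = act (\<beta>' b) (\<alpha>' a)"
  "\<alpha> \<one>\<^bsub>A\<^esub> = \<one>\<^bsub>A\<^esub>" "\<alpha>' \<one>\<^bsub>A\<^esub> = \<one>\<^bsub>A\<^esub>" "\<beta> \<one>\<^bsub>B\<^esub> = \<one>\<^bsub>B\<^esub>" "\<beta>' \<one>\<^bsub>B\<^esub> = \<one>\<^bsub>B\<^esub>"
  using monoidal_hom_algebra.aut_mult[OF A_algebra] monoidal_hom_algebra.aut_mult[OF B_algebra]
    monoidal_hom_algebra.aut_one[OF A_algebra] monoidal_hom_algebra.aut_one[OF B_algebra]
    left_hom_module.lact_aut[OF A_module]
  by (auto intro!: objects[THEN hom_object.aut_bar_eqI] simp: closed aut_inverse)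

lemma counit_aut:
  "b \<in> carrier B \<Longrightarrow> \<epsilon>B (\<beta> b) = \<epsilon>B b" "c \<in> carrier C \<Longrightarrow> \<epsilon>C (\<gamma> c) = \<epsilon>C c"
  by (rule monoidal_hom_coalgebra.counit_aut[OF B_coalgebra], assumption,
    rule monoidal_hom_coalgebra.counit_aut[OF C_coalgebra])

lemma mult_assoc:
  "\<lbrakk>x \<in> carrier A; y \<in> carrier A; z \<in> carrier A\<rbrakk> \<Longrightarrow> x \<otimes>\<^bsub>A\<^esub> (y \<otimes>\<^bsub>A\<^esub> z) = (\<alpha>' x \<otimes>\<^bsub>A\<^esub> y) \<otimes>\<^bsub>A\<^esub> \<alpha> z"
  using monoidal_hom_algebra.hom_assoc[OF A_algebra, of "\<alpha>' x" y z] by (simp add: closed aut_inverse)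

lemma act_act:
  "\<lbrakk>b \<in> carrier B; b' \<in> carrier B; a \<in> carrier A\<rbrakk> \<Longrightarrow> act b (act b' a) = act (\<beta>' b \<otimes>\<^bsub>B\<^esub> b') (\<alpha> a)"
  using left_hom_module.hom_lact_assoc[OF A_module, of "\<beta>' b" b' a] by (simp add: closed aut_inverse)

lemma units:
  "a \<in> carrier A \<Longrightarrow> a \<otimes>\<^bsub>A\<^esub> \<one>\<^bsub>A\<^esub> = \<alpha> a" "a \<in> carrier A \<Longrightarrow> \<one>\<^bsub>A\<^esub> \<otimes>\<^bsub>A\<^esub> a = \<alpha> a"
  "a \<in> carrier A \<Longrightarrow> act \<one>\<^bsub>B\<^esub> a = \<alpha> a"
  "b \<in> carrier B \<Longrightarrow> act b \<one>\<^bsub>A\<^esub> = \<epsilon>B b \<odot>\<^bsub>A\<^esub> \<one>\<^bsub>A\<^esub>"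
  using monoidal_hom_algebra.hom_unit_right[OF A_algebra] monoidal_hom_algebra.hom_unit_left[OF A_algebra]
    left_hom_module.hom_lact_one[OF A_module] left_hom_module_algebra.lact_one[OF module_algebra] by auto

lemma act_mult: "\<lbrakk>b \<in> carrier B; a \<in> carrier A; a' \<in> carrier A\<rbrakk>
    \<Longrightarrow> act b (a \<otimes>\<^bsub>A\<^esub> a') = SB A (\<lambda>x y. act x a \<otimes>\<^bsub>A\<^esub> act y a') b"
  unfolding SB_def by (rule left_hom_module_algebra.lact_mult[OF module_algebra])

text \<open>
  In the normal form, sums are outermost, automorphisms stand next to variables, products are
  bracketed to the left and iterated actions are merged into the action of a product of elements of \<open>B\<close>.
\<close>

lemmas sweedler_normal = push_rules scalar_rules fold_sums SB_aut SC_aut SX_aut aut_inverse aut_mult counit_aut mult_assoc act_act units act_mult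
  tensor_lift_tens

lemma tensor_lift_ident:
  assumes "module k M" "module k N" "t \<in> carrier (tensor k M N)"
  shows "tensor_lift k (tensor k M N) (tens k M N) t = t"
  by (rule tensor_ext[OF assms(1,2) tensor_module[OF assms(1,2)] tensor_lift_linear linear_ident _ assms(3)])
    (simp_all add: assms tensor_lift_tens tensor_module tens_bilinear)

lemma comult_sums:
  "b \<in> carrier B \<Longrightarrow> \<Delta>B b = SB (tensor k B B) (tens k B B) b"
  "c \<in> carrier C \<Longrightarrow> \<Delta>C c = SC (tensor k C C) (tens k C C) c"
  "c \<in> carrier C \<Longrightarrow> coact c = SX (tensor k B C) (tens k B C) c"
  unfolding SB_def SC_def SX_def by (simp_all add: tensor_lift_ident modules comult_closed)

section \<open>The axioms for arbitrary multilinear maps\<close>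

lemma trilinear_comp:
  assumes "\<And>y z. \<lbrakk>y \<in> carrier V; z \<in> carrier W\<rbrakk> \<Longrightarrow> (\<lambda>x. F x y z) \<in> linear_maps k U P"
      "\<And>x z. \<lbrakk>x \<in> carrier U; z \<in> carrier W\<rbrakk> \<Longrightarrow> (\<lambda>y. F x y z) \<in> linear_maps k V P"
      "\<And>x y. \<lbrakk>x \<in> carrier U; y \<in> carrier V\<rbrakk> \<Longrightarrow> (\<lambda>z. F x y z) \<in> linear_maps k W P"
  shows "\<lbrakk>f \<in> linear_maps k X U; y \<in> carrier V; z \<in> carrier W\<rbrakk> \<Longrightarrow> (\<lambda>x. F (f x) y z) \<in> linear_maps k X P"
    "\<lbrakk>x \<in> carrier U; g \<in> linear_maps k X V; z \<in> carrier W\<rbrakk> \<Longrightarrow> (\<lambda>y. F x (g y) z) \<in> linear_maps k X P"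
    "\<lbrakk>x \<in> carrier U; y \<in> carrier V; h \<in> linear_maps k X W\<rbrakk> \<Longrightarrow> (\<lambda>z. F x y (h z)) \<in> linear_maps k X P"
  using assms(1)[THEN linear_comp, of y z f X] assms(2)[THEN linear_comp, of x z g X]
    assms(3)[THEN linear_comp, of x y h X] by auto

lemma trilinear_lift:
  assumes "module k P" "module k U" "module k V" "module k W"
      "\<And>y z. \<lbrakk>y \<in> carrier V; z \<in> carrier W\<rbrakk> \<Longrightarrow> (\<lambda>x. F x y z) \<in> linear_maps k U P"
      "\<And>x z. \<lbrakk>x \<in> carrier U; z \<in> carrier W\<rbrakk> \<Longrightarrow> (\<lambda>y. F x y z) \<in> linear_maps k V P"
      "\<And>x y. \<lbrakk>x \<in> carrier U; y \<in> carrier V\<rbrakk> \<Longrightarrow> (\<lambda>z. F x y z) \<in> linear_maps k W P"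
  shows "(\<lambda>x. tensor_lift k P (F x)) \<in> bilinear_maps k U (tensor k V W) P"
  using assms
  by (intro bilinear_mapsI tensor_lift_linear_param[OF assms(3,4)]) (auto intro!: tensor_lift_linear bilinear_mapsI)

text \<open>
  In this and the following lemmas an axiom, which is an equation between tensors, is evaluated by a
  multilinear map \<open>F\<close>: apply the linear map induced by \<open>F\<close> to both sides and push it through the sums.
\<close>

lemma coact_coassoc:
  assumes P: "module k P" and c: "c \<in> carrier C"
    and F: "\<And>y z. \<lbrakk>y \<in> carrier B; z \<in> carrier C\<rbrakk> \<Longrightarrow> (\<lambda>x. F x y z) \<in> linear_maps k B P"
      "\<And>x z. \<lbrakk>x \<in> carrier B; z \<in> carrier C\<rbrakk> \<Longrightarrow> (\<lambda>y. F x y z) \<in> linear_maps k B P"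
      "\<And>x y. \<lbrakk>x \<in> carrier B; y \<in> carrier B\<rbrakk> \<Longrightarrow> (\<lambda>z. F x y z) \<in> linear_maps k C P"
  shows "SX P (\<lambda>b c0. SB P (\<lambda>b1 b2. F b1 b2 (\<gamma>' c0)) b) c = SX P (\<lambda>b c0. SX P (\<lambda>b' c00. F (\<beta>' b) b' c00) c0) c"
  using arg_cong[OF left_hom_comodule.hom_coact_coassoc[OF C_comodule c, folded SB_def SX_def],
      of "tensor_lift k P (\<lambda>x. tensor_lift k P (F x))"]
    P c F trilinear_comp[OF F] trilinear_lift[OF P modules(2,2,3) F]
  by (simp add: linearity sweedler_normal comult_sums)

lemma comult_coassoc:
  assumes P: "module k P" and c: "c \<in> carrier C"
    and F: "\<And>y z. \<lbrakk>y \<in> carrier C; z \<in> carrier C\<rbrakk> \<Longrightarrow> (\<lambda>x. F x y z) \<in> linear_maps k C P"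
      "\<And>x z. \<lbrakk>x \<in> carrier C; z \<in> carrier C\<rbrakk> \<Longrightarrow> (\<lambda>y. F x y z) \<in> linear_maps k C P"
      "\<And>x y. \<lbrakk>x \<in> carrier C; y \<in> carrier C\<rbrakk> \<Longrightarrow> (\<lambda>z. F x y z) \<in> linear_maps k C P"
  shows "SC P (\<lambda>x y. SC P (\<lambda>y1 y2. F (\<gamma>' x) y1 y2) y) c = SC P (\<lambda>x y. SC P (\<lambda>x1 x2. F x1 x2 (\<gamma>' y)) x) c"
  using arg_cong[OF monoidal_hom_coalgebra.hom_coassoc[OF C_coalgebra c, folded SC_def],
      of "tensor_lift k P (\<lambda>x. tensor_lift k P (F x))"]
    P c F trilinear_comp[OF F] trilinear_lift[OF P modules(3,3,3) F]
  by (simp add: linearity sweedler_normal comult_sums)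

lemma coact_comult:
  assumes P: "module k P" and c: "c \<in> carrier C"
    and F: "\<And>y z. \<lbrakk>y \<in> carrier C; z \<in> carrier C\<rbrakk> \<Longrightarrow> (\<lambda>x. F x y z) \<in> linear_maps k B P"
      "\<And>x z. \<lbrakk>x \<in> carrier B; z \<in> carrier C\<rbrakk> \<Longrightarrow> (\<lambda>y. F x y z) \<in> linear_maps k C P"
      "\<And>x y. \<lbrakk>x \<in> carrier B; y \<in> carrier C\<rbrakk> \<Longrightarrow> (\<lambda>z. F x y z) \<in> linear_maps k C P"
  shows "SX P (\<lambda>b c0. SC P (\<lambda>x y. F b x y) c0) c =
    SC P (\<lambda>x y. SX P (\<lambda>b1 x0. SX P (\<lambda>b2 y0. F (b1 \<otimes>\<^bsub>B\<^esub> b2) x0 y0) y) x) c"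
  using arg_cong[OF left_hom_comodule_coalgebra.coact_comult[OF comodule_coalgebra c, folded SC_def SX_def],
      of "tensor_lift k P (\<lambda>x. tensor_lift k P (F x))"]
    P c F trilinear_comp[OF F] trilinear_lift[OF P modules(2,3,3) F]
  by (simp add: linearity sweedler_normal comult_sums)

lemma coact_counitB:
  assumes P: "module k P" and c: "c \<in> carrier C" and G: "G \<in> linear_maps k C P"
  shows "SX P (\<lambda>b c0. \<epsilon>B b \<odot>\<^bsub>P\<^esub> G c0) c = G (\<gamma>' c)"
  using arg_cong[OF left_hom_comodule.hom_coact_counit[OF C_comodule c, folded SX_def], of G]
    SX_push[OF G modules(3) P, of "\<lambda>b c0. \<epsilon>B b \<odot>\<^bsub>C\<^esub> c0" c] c linear_smult[OF G]
  by (simp add: linearity)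

lemma coact_counitC:
  assumes P: "module k P" and c: "c \<in> carrier C" and G: "G \<in> linear_maps k B P"
  shows "SX P (\<lambda>b c0. \<epsilon>C c0 \<odot>\<^bsub>P\<^esub> G b) c = \<epsilon>C c \<odot>\<^bsub>P\<^esub> G \<one>\<^bsub>B\<^esub>"
  using arg_cong[OF left_hom_comodule_coalgebra.coact_counit[OF comodule_coalgebra c, folded SX_def], of G]
    SX_push[OF G modules(2) P, of "\<lambda>b c0. \<epsilon>C c0 \<odot>\<^bsub>B\<^esub> b" c] c linear_smult[OF G]
  by (simp add: linearity)

lemma comult_counit:
  assumes P: "module k P" and c: "c \<in> carrier C" and G: "G \<in> linear_maps k C P"
  shows "SC P (\<lambda>x y. \<epsilon>C x \<odot>\<^bsub>P\<^esub> G y) c = G (\<gamma>' c)" "SC P (\<lambda>x y. \<epsilon>C y \<odot>\<^bsub>P\<^esub> G x) c = G (\<gamma>' c)"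
  using arg_cong[OF monoidal_hom_coalgebra.hom_counit_left[OF C_coalgebra c, folded SC_def], of G]
    SC_push[OF G modules(3) P, of "\<lambda>x y. \<epsilon>C x \<odot>\<^bsub>C\<^esub> y" c]
    arg_cong[OF monoidal_hom_coalgebra.hom_counit_right[OF C_coalgebra c, folded SC_def], of G]
    SC_push[OF G modules(3) P, of "\<lambda>x y. \<epsilon>C y \<odot>\<^bsub>C\<^esub> x" c] c linear_smult[OF G]
  by (simp_all add: linearity)

lemma SX_swap:
  assumes P: "module k P" and c: "c \<in> carrier C" "c' \<in> carrier C"
    and f: "\<And>m n. \<lbrakk>m \<in> carrier B; n \<in> carrier C\<rbrakk> \<Longrightarrow> f m n \<in> bilinear_maps k B C P"
    and f': "\<And>m' n'. \<lbrakk>m' \<in> carrier B; n' \<in> carrier C\<rbrakk> \<Longrightarrow> (\<lambda>m n. f m n m' n') \<in> bilinear_maps k B C P"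
  shows "SX P (\<lambda>m n. SX P (f m n) c') c = SX P (\<lambda>m' n'. SX P (\<lambda>m n. f m n m' n') c) c'"
  unfolding SX_def
  by (rule tensor_lift_swap[OF modules(2,3,2,3) P comult_closed(3)[OF c(1)] comult_closed(3)[OF c(2)] f f'])

section \<open>The Hom-entwining structure\<close>

definition "\<psi> = tensor_lift k (tensor k A C)
      (\<lambda>c a. tensor_lift k (tensor k A C)
        (\<lambda>b c0. tens k A C (act b (aut_inv A \<alpha> a)) (\<gamma> c0)) (coact c))"

lemma psi_body: "(\<lambda>c a. SX (tensor k A C) (\<lambda>b c0. tens k A C (act b (\<alpha>' a)) (\<gamma> c0)) c) \<in> bilinear_maps k C A (tensor k A C)"
  by (simp add: linearity)

lemma psi_linear: "\<psi> \<in> linear_maps k (tensor k C A) (tensor k A C)"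
  unfolding \<psi>_def SX_def[symmetric] by (rule tensor_lift_linear[OF modules(3,1) tensor_module[OF modules(1,3)] psi_body])

lemma psi_tens:
  "\<lbrakk>c \<in> carrier C; a \<in> carrier A\<rbrakk>
    \<Longrightarrow> \<psi> (tens k C A c a) = SX (tensor k A C) (\<lambda>b c0. tens k A C (act b (\<alpha>' a)) (\<gamma> c0)) c"
  unfolding \<psi>_def SX_def[symmetric] by (rule tensor_lift_tens[OF modules(3,1) tensor_module[OF modules(1,3)] psi_body])

lemma psi_lift_linear:
  "\<lbrakk>module k P; f \<in> bilinear_maps k A C P; h \<in> linear_maps k X (tensor k C A)\<rbrakk>
    \<Longrightarrow> (\<lambda>x. tensor_lift k P f (\<psi> (h x))) \<in> linear_maps k X P"
  by (rule linear_comp[OF tensor_lift_linear[OF modules(1,3)] linear_comp[OF psi_linear]])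

text \<open>
  Needed for sums over \<open>\<psi>(c \<otimes> a)\<close>, whose summand may depend on a further bound variable.
\<close>

lemma SX_lift_param:
  "\<lbrakk>module k P; module k X; module k M; module k N; c \<in> carrier C; g \<in> bilinear_maps k B C (tensor k M N);
    \<And>x. x \<in> carrier X \<Longrightarrow> f x \<in> bilinear_maps k M N P;
    \<And>m n. \<lbrakk>m \<in> carrier M; n \<in> carrier N\<rbrakk> \<Longrightarrow> (\<lambda>x. f x m n) \<in> linear_maps k X P\<rbrakk>
    \<Longrightarrow> (\<lambda>x. tensor_lift k P (f x) (SX (tensor k M N) g c)) \<in> linear_maps k X P"
  by (rule tensor_lift_linear_param[of k M N]) (auto intro: SX_closed tensor_module)

lemmas psi_linearity = psi_lift_linear SX_lift_param

lemma tensor_map_aut_linear: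
  "tensor_map k A C \<alpha> \<gamma> \<in> linear_maps k (tensor k A C) (tensor k A C)"
  "tensor_map k C A \<gamma> \<alpha> \<in> linear_maps k (tensor k C A) (tensor k C A)"
  by (simp_all add: tensor_map_linear modules aut_linears)

lemma tensor_map_aut_tens:
  "\<lbrakk>a \<in> carrier A; c \<in> carrier C\<rbrakk> \<Longrightarrow> tensor_map k A C \<alpha> \<gamma> (tens k A C a c) = tens k A C (\<alpha> a) (\<gamma> c)"
  "\<lbrakk>a \<in> carrier A; c \<in> carrier C\<rbrakk> \<Longrightarrow> tensor_map k C A \<gamma> \<alpha> (tens k C A c a) = tens k C A (\<gamma> c) (\<alpha> a)"
  by (simp_all add: tensor_map_tens[OF modules(1,3,1,3)] tensor_map_tens[OF modules(3,1,3,1)] aut_linears)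

text \<open>
  The multilinear map given to an axiom is read off from the normal form of the side to which the axiom applies.
  The comultiplication law also needs an exchange of sums: the comodule coalgebra axiom has the coaction
  of \<open>c\<^sub>1\<close> outside that of \<open>c\<^sub>2\<close>, whereas \<open>\<psi>\<close> is applied to \<open>c\<^sub>2\<close> first.
\<close>

theorem entwining: "hom_entwining k A \<alpha> C \<gamma> \<Delta>C \<epsilon>C \<psi>"
proof (intro hom_entwining.intro hom_entwining_axioms.intro A_algebra C_coalgebra psi_linear)
  show "tensor_map k A C \<alpha> \<gamma> (\<psi> t) = \<psi> (tensor_map k C A \<gamma> \<alpha> t)" if "t \<in> carrier (tensor k C A)" for t
    by (rule tensor_ext[OF modules(3,1) _ linear_comp[OF tensor_map_aut_linear(1) psi_linear]
        linear_comp[OF psi_linear tensor_map_aut_linear(2)] _ that])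
     (simp_all add: linearity sweedler_normal psi_tens SX_push[OF tensor_map_aut_linear(1)] tensor_map_aut_tens)
next
  fix a a' c assume *: "a \<in> carrier A" "a' \<in> carrier A" "c \<in> carrier C"
  show "\<psi> (tens k C A (\<gamma> c) (a \<otimes>\<^bsub>A\<^esub> a')) =
      tensor_lift k (tensor k A C)
        (\<lambda>a\<kappa> c\<kappa>. tensor_lift k (tensor k A C)
          (\<lambda>a'\<nu> c\<kappa>\<nu>. tens k A C (a\<kappa> \<otimes>\<^bsub>A\<^esub> a'\<nu>) (\<gamma> c\<kappa>\<nu>)) (\<psi> (tens k C A c\<kappa> a')))
        (\<psi> (tens k C A c a))"
    using * coact_coassoc[of "tensor k A C" c "\<lambda>x y z. tens k A C (act (\<beta> x) (\<alpha>' a) \<otimes>\<^bsub>A\<^esub> act (\<beta> y) (\<alpha>' a')) (\<gamma> (\<gamma> (\<gamma> z)))"]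
    by (simp add: linearity sweedler_normal psi_tens psi_linearity)
next
  fix a c assume *: "a \<in> carrier A" "c \<in> carrier C"
  let ?P = "tensor k A (tensor k C C)"
  let ?F = "\<lambda>b1 x0 b2 y0. tens k A (tensor k C C) (act (\<beta>' b1 \<otimes>\<^bsub>B\<^esub> \<beta>' b2) (\<alpha>' (\<alpha>' a))) (tens k C C (\<gamma> x0) (\<gamma> y0))"
  have "tensor_lift k ?P (\<lambda>a\<kappa> c\<kappa>. tens k A (tensor k C C) (aut_inv A \<alpha> a\<kappa>) (\<Delta>C c\<kappa>)) (\<psi> (tens k C A c a)) =
      SC ?P (\<lambda>x y. SX ?P (\<lambda>b1 x0. SX ?P (\<lambda>b2 y0. ?F b1 x0 b2 y0) y) x) c"
    using * coact_comult[of ?P c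
      "\<lambda>b x y. tens k A (tensor k C C) (act (\<beta>' b) (\<alpha>' (\<alpha>' a))) (tens k C C (\<gamma> x) (\<gamma> y))"]
    by (simp add: linearity sweedler_normal psi_tens psi_linearity comult_sums linear_comp[OF \<Delta>C_linear])
  also have "\<dots> = SC ?P (\<lambda>x y. SX ?P (\<lambda>b2 y0. SX ?P (\<lambda>b1 x0. ?F b1 x0 b2 y0) x) y) c"
    by (rule SC_cong[OF refl *(2)], rule SX_swap) (simp_all add: linearity *)
  also have "\<dots> = tensor_lift k ?P
        (\<lambda>c1 c2. tensor_lift k ?P
          (\<lambda>a\<kappa> c2\<kappa>. tensor_lift k ?P
            (\<lambda>a\<kappa>\<nu> c1\<nu>. tens k A (tensor k C C) a\<kappa>\<nu> (tens k C C c1\<nu> c2\<kappa>)) (\<psi> (tens k C A c1 a\<kappa>)))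
          (\<psi> (tens k C A c2 (aut_inv A \<alpha> a)))) (\<Delta>C c)"
    using * by (simp add: linearity sweedler_normal psi_tens psi_linearity)
  finally show "tensor_lift k ?P
        (\<lambda>a\<kappa> c\<kappa>. tens k A (tensor k C C) (aut_inv A \<alpha> a\<kappa>) (\<Delta>C c\<kappa>)) (\<psi> (tens k C A c a)) = \<dots>" .
next
  fix c assume *: "c \<in> carrier C"
  show "\<psi> (tens k C A c \<one>\<^bsub>A\<^esub>) = tens k A C \<one>\<^bsub>A\<^esub> c"
    using * coact_counitB[of "tensor k A C" c "\<lambda>z. tens k A C \<one>\<^bsub>A\<^esub> (\<gamma> z)"]
    by (simp add: linearity sweedler_normal psi_tens)
next
  fix a c assume *: "a \<in> carrier A" "c \<in> carrier C"
  show "tensor_lift k A (\<lambda>a\<kappa> c\<kappa>. \<epsilon>C c\<kappa> \<odot>\<^bsub>A\<^esub> a\<kappa>) (\<psi> (tens k C A c a)) = \<epsilon>C c \<odot>\<^bsub>A\<^esub> a"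
    using * coact_counitC[of A c "\<lambda>b. act b (\<alpha>' a)"]
    by (simp add: linearity sweedler_normal psi_tens)
qed

section \<open>Entwined Hom-modules\<close>

text \<open>
  Inside the sum over \<open>\<rho>(m)\<close>, \<open>\<psi>\<close> is applied to a pure tensor and can be replaced by its defining sum.
\<close>

lemma entwined_condition:
  fixes M :: "('k, 'm, 'w) module_scheme"
  assumes "right_hom_module k A \<alpha> M \<mu> ra" "right_hom_comodule k C \<gamma> \<Delta>C \<epsilon>C M \<mu> \<rho>"
    and m: "m \<in> carrier M" and a: "a \<in> carrier A"
  shows "tensor_lift k (tensor k M C)
        (\<lambda>m0 m1. tensor_lift k (tensor k M C)
          (\<lambda>a\<kappa> m1\<kappa>. tens k M C (ra m0 a\<kappa>) (\<gamma> m1\<kappa>)) (\<psi> (tens k C A m1 (aut_inv A \<alpha> a))))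
        (\<rho> m) =
        tensor_lift k (tensor k M C)
            (\<lambda>m0 m1. tensor_lift k (tensor k M C)
              (\<lambda>b c0. tens k M C (ra m0 (act b (aut_inv A \<alpha> (aut_inv A \<alpha> a)))) (\<gamma> (\<gamma> c0)))
              (coact m1))
            (\<rho> m)"
proof -
  have M: "module k M"
    using assms(1) hom_object.object_module by (auto simp: right_hom_module_def)
  note ra = right_hom_module.ract_bilinear[OF assms(1)]
  note ra_lin = bilinear_comp_left[OF ra] bilinear_comp_right[OF ra] bilinear_closed[OF ra]
  have \<rho>: "\<rho> m \<in> carrier (tensor k M C)"
    using right_hom_comodule.coact_linear[OF assms(2)] m by (rule linear_closed)
  show ?thesis
    by (rule tensor_lift_cong[OF M modules(3) \<rho>])
      (simp add: linearity sweedler_normal psi_tens ra_lin M a)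
qed

section \<open>The Hom-bimodule on the tensor product\<close>

abbreviation "T \<equiv> tensor k A C"

definition "AC = hom_bimod_of (tensor k A C) (tensor_map k A C \<alpha> \<gamma>)
            (\<lambda>a. tensor_lift k (tensor k A C)
              (\<lambda>a' c. tens k A C (aut_inv A \<alpha> a \<otimes>\<^bsub>A\<^esub> a') (\<gamma> c)))
            (\<lambda>x a. tensor_lift k (tensor k A C)
              (\<lambda>a' c. tensor_lift k (tensor k A C)
                (\<lambda>b c0. tens k A C (a' \<otimes>\<^bsub>A\<^esub> act b (aut_inv A \<alpha> (aut_inv A \<alpha> a))) (\<gamma> (\<gamma> c0)))
                (coact c)) x)"

lemma T_module: "module k T"
  by (rule tensor_module[OF modules(1,3)])

lemmas T_ext = tensor_ext[OF modules(1,3)]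

lemma AC_simps:
  "carrier AC = carrier T" "add AC = add T" "smult AC = smult T" "aut AC = tensor_map k A C \<alpha> \<gamma>"
  "linear_maps k X AC = linear_maps k X T" "linear_maps k AC X = linear_maps k T X"
  "tensor_lift k AC = tensor_lift k T" "hom_tensor_lift k AC = hom_tensor_lift k T" "module k AC"
  by (simp_all add: AC_def module_hom_bimod_of T_module)

lemma bilinear_AC: "bilinear_maps k AC X P = bilinear_maps k T X P"
  "bilinear_maps k X' AC P = bilinear_maps k X' T P" "bilinear_maps k X Y AC = bilinear_maps k X Y T"
  by (simp_all add: bilinear_maps_def AC_simps)

lemma lact_AC_body: "a \<in> carrier A \<Longrightarrow>
    (\<lambda>a' c. tens k A C (\<alpha>' a \<otimes>\<^bsub>A\<^esub> a') (\<gamma> c)) \<in> bilinear_maps k A C T"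
  by (simp add: linearity)

lemma ract_AC_body: "a \<in> carrier A \<Longrightarrow>
    (\<lambda>a' c. SX T (\<lambda>b c0. tens k A C (a' \<otimes>\<^bsub>A\<^esub> act b (\<alpha>' (\<alpha>' a))) (\<gamma> (\<gamma> c0))) c) \<in> bilinear_maps k A C T"
  by (simp add: linearity)

lemma lact_AC: "lact AC a = tensor_lift k T (\<lambda>a' c. tens k A C (\<alpha>' a \<otimes>\<^bsub>A\<^esub> a') (\<gamma> c))"
  and ract_AC: "ract AC x a = tensor_lift k T (\<lambda>a' c. SX T (\<lambda>b c0. tens k A C (a' \<otimes>\<^bsub>A\<^esub> act b (\<alpha>' (\<alpha>' a))) (\<gamma> (\<gamma> c0))) c) x"
  by (simp_all add: AC_def SX_def)

lemma lact_AC_bilinear: "lact AC \<in> bilinear_maps k A T T"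
  unfolding lact_AC
  by (intro bilinear_mapsI tensor_lift_linear_param[OF modules(1,3) T_module] tensor_lift_linear[OF modules(1,3) T_module])
    (simp_all add: linearity)

lemma ract_AC_bilinear: "ract AC \<in> bilinear_maps k T A T"
  unfolding ract_AC
  by (intro bilinear_mapsI tensor_lift_linear_param[OF modules(1,3) T_module] tensor_lift_linear[OF modules(1,3) T_module])
    (simp_all add: linearity)

lemma aut_AC_linear: "aut AC \<in> linear_maps k T T"
  by (simp add: AC_simps tensor_map_aut_linear)

lemmas AC_linear = bilinear_right[OF lact_AC_bilinear] bilinear_left[OF ract_AC_bilinear] aut_AC_linear

lemma AC_tens:
  "\<lbrakk>a \<in> carrier A; c \<in> carrier C\<rbrakk> \<Longrightarrow> aut AC (tens k A C a c) = tens k A C (\<alpha> a) (\<gamma> c)"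
  "\<lbrakk>a \<in> carrier A; a' \<in> carrier A; c \<in> carrier C\<rbrakk>
    \<Longrightarrow> lact AC a (tens k A C a' c) = tens k A C (\<alpha>' a \<otimes>\<^bsub>A\<^esub> a') (\<gamma> c)"
  "\<lbrakk>a \<in> carrier A; a' \<in> carrier A; c \<in> carrier C\<rbrakk>
    \<Longrightarrow> ract AC (tens k A C a' c) a = SX T (\<lambda>b c0. tens k A C (a' \<otimes>\<^bsub>A\<^esub> act b (\<alpha>' (\<alpha>' a))) (\<gamma> (\<gamma> c0))) c"
  unfolding lact_AC ract_AC
  by (simp_all add: AC_simps tensor_map_aut_tens tensor_lift_tens[OF modules(1,3) T_module lact_AC_body]
    tensor_lift_tens[OF modules(1,3) T_module ract_AC_body])

lemmas AC_push = AC_linear[THEN SX_push] AC_linear[THEN SC_push]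

lemma aut_AC_inverse:
  shows "\<And>x. x \<in> carrier T \<Longrightarrow> tensor_map k A C \<alpha>' \<gamma>' (aut AC x) = x"
    and "\<And>x. x \<in> carrier T \<Longrightarrow> aut AC (tensor_map k A C \<alpha>' \<gamma>' x) = x"
    and "tensor_map k A C \<alpha>' \<gamma>' \<in> linear_maps k T T"
proof -
  show l: "tensor_map k A C \<alpha>' \<gamma>' \<in> linear_maps k T T"
    by (simp add: tensor_map_linear modules aut_linears)
  note t = tensor_map_tens[OF modules(1,3,1,3) aut_linears(4,6)]
  show "tensor_map k A C \<alpha>' \<gamma>' (aut AC x) = x" if "x \<in> carrier T" for x
    by (rule T_ext[OF T_module linear_comp[OF l aut_AC_linear] linear_ident _ that])
      (simp add: AC_tens t closed aut_inverse)
  show "aut AC (tensor_map k A C \<alpha>' \<gamma>' x) = x" if "x \<in> carrier T" for x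
    by (rule T_ext[OF T_module linear_comp[OF aut_AC_linear l] linear_ident _ that])
      (simp add: AC_tens t closed aut_inverse)
qed

lemma AC_object: "hom_object k AC (aut AC)"
proof (intro hom_object.intro hom_object_axioms.intro AC_simps(9))
  show "bij_betw (aut AC) (carrier AC) (carrier AC)"
    unfolding AC_simps(1)
    by (rule bij_betw_byWitness[of _ "tensor_map k A C \<alpha>' \<gamma>'"])
      (auto simp: aut_AC_inverse linear_closed[OF aut_AC_linear] linear_closed[OF aut_AC_inverse(3)])
qed (use aut_AC_linear in \<open>simp add: AC_simps(5,6)\<close>)

text \<open>
  Associativity of the right action is the computation behind multiplicativity of \<open>\<psi>\<close>, and its unit law the one
  behind the unit law of \<open>\<psi>\<close>; the laws involving the left action are those of multiplication in \<open>A\<close>.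
\<close>

lemma AC_bimodule: "hom_bimodule k A \<alpha> AC"
proof (intro hom_bimodule.intro hom_bimodule_axioms.intro left_hom_module.intro left_hom_module_axioms.intro
    right_hom_module.intro right_hom_module_axioms.intro A_algebra AC_object, unfold AC_simps(1) bilinear_AC)
  show "lact AC \<in> bilinear_maps k A T T" "ract AC \<in> bilinear_maps k T A T"
    by (simp_all add: bilinear_AC lact_AC_bilinear ract_AC_bilinear)
next
  fix a b x assume *: "a \<in> carrier A" "b \<in> carrier A" "x \<in> carrier T"
  show "lact AC (\<alpha> a) (lact AC b x) = lact AC (a \<otimes>\<^bsub>A\<^esub> b) (aut AC x)"
    by (rule T_ext[OF T_module linear_comp[OF AC_linear(1) AC_linear(1)] linear_comp[OF AC_linear(1) aut_AC_linear] _ *(3)])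
      (use * in \<open>simp_all add: linearity sweedler_normal AC_tens\<close>)
next
  fix x assume *: "x \<in> carrier T"
  show "lact AC \<one>\<^bsub>A\<^esub> x = aut AC x"
    by (rule T_ext[OF T_module AC_linear(1) aut_AC_linear _ *]) (simp_all add: linearity sweedler_normal AC_tens)
next
  fix a x assume *: "a \<in> carrier A" "x \<in> carrier T"
  show "aut AC (lact AC a x) = lact AC (\<alpha> a) (aut AC x)"
    by (rule T_ext[OF T_module linear_comp[OF aut_AC_linear AC_linear(1)] linear_comp[OF AC_linear(1) aut_AC_linear] _ *(2)])
      (use * in \<open>simp_all add: linearity sweedler_normal AC_tens\<close>)
next
  fix x a b assume *: "x \<in> carrier T" "a \<in> carrier A" "b \<in> carrier A"
  show "ract AC (aut AC x) (a \<otimes>\<^bsub>A\<^esub> b) = ract AC (ract AC x a) (\<alpha> b)"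
  proof (rule T_ext[OF T_module linear_comp[OF AC_linear(2) aut_AC_linear] linear_comp[OF AC_linear(2) AC_linear(2)] _ *(1)])
    fix a' c assume **: "a' \<in> carrier A" "c \<in> carrier C"
    show "ract AC (aut AC (tens k A C a' c)) (a \<otimes>\<^bsub>A\<^esub> b) = ract AC (ract AC (tens k A C a' c) a) (\<alpha> b)"
      using * ** coact_coassoc[of T c "\<lambda>x y z. tens k A C
          ((a' \<otimes>\<^bsub>A\<^esub> act (\<beta> x) (\<alpha>' (\<alpha>' a))) \<otimes>\<^bsub>A\<^esub> act (\<beta> (\<beta> y)) (\<alpha>' b)) (\<gamma> (\<gamma> (\<gamma> (\<gamma> z))))"]
      by (simp add: linearity sweedler_normal AC_tens AC_push)
  qed (use * in \<open>simp_all add: linearity\<close>)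
next
  fix x assume *: "x \<in> carrier T"
  show "ract AC x \<one>\<^bsub>A\<^esub> = aut AC x"
  proof (rule T_ext[OF T_module AC_linear(2) aut_AC_linear _ *])
    fix a' c assume **: "a' \<in> carrier A" "c \<in> carrier C"
    show "ract AC (tens k A C a' c) \<one>\<^bsub>A\<^esub> = aut AC (tens k A C a' c)"
      using ** coact_counitB[of T c "\<lambda>z. tens k A C (\<alpha> a') (\<gamma> (\<gamma> z))"]
      by (simp add: linearity sweedler_normal AC_tens)
  qed (simp add: linearity)
next
  fix x a assume *: "x \<in> carrier T" "a \<in> carrier A"
  show "aut AC (ract AC x a) = ract AC (aut AC x) (\<alpha> a)"
    by (rule T_ext[OF T_module linear_comp[OF aut_AC_linear AC_linear(2)] linear_comp[OF AC_linear(2) aut_AC_linear] _ *(1)])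
      (use * in \<open>simp_all add: linearity sweedler_normal AC_tens AC_push\<close>)
next
  fix a x b assume *: "a \<in> carrier A" "x \<in> carrier T" "b \<in> carrier A"
  show "ract AC (lact AC a x) (\<alpha> b) = lact AC (\<alpha> a) (ract AC x b)"
    by (rule T_ext[OF T_module linear_comp[OF AC_linear(2) AC_linear(1)] linear_comp[OF AC_linear(1) AC_linear(2)] _ *(2)])
      (use * in \<open>simp_all add: linearity sweedler_normal AC_tens AC_push\<close>)
qed

section \<open>The comultiplication and counit of the Hom-coring\<close>

abbreviation "AC2 \<equiv> hom_tensor k A \<alpha> AC AC"
abbreviation "tens2 \<equiv> hom_tens k A AC AC"

interpretation P: hom_bimodule_pair k A \<alpha> AC AC
  by (intro hom_bimodule_pair.intro AC_bimodule)

lemma AC2_module: "module k AC2"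
  by (rule P.H_module)

lemma tens2_bilinear: "tens2 \<in> bilinear_maps k T T AC2"
  using P.hom_tens_bilinear by (simp add: bilinear_AC)

lemmas AC2_linear = P.aut_H_linear P.lact_H_linear P.ract_H_linear

lemmas tens2_linear = AC2_module bilinear_comp_left[OF tens2_bilinear] bilinear_comp_right[OF tens2_bilinear] bilinear_closed[OF tens2_bilinear]

lemmas tens2_push = bilinear_left[OF tens2_bilinear, THEN SX_push] bilinear_right[OF tens2_bilinear, THEN SX_push]
  AC2_linear[THEN SC_push] AC2_linear[THEN SX_push]

lemma AC2_tens:
  assumes "x \<in> carrier T" "y \<in> carrier T"
  shows "aut AC2 (tens2 x y) = tens2 (aut AC x) (aut AC y)"
    and "a \<in> carrier A \<Longrightarrow> lact AC2 a (tens2 x y) = tens2 (lact AC (\<alpha>' a) x) (aut AC y)"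
    and "a \<in> carrier A \<Longrightarrow> ract AC2 (tens2 x y) a = tens2 (aut AC x) (ract AC y (\<alpha>' a))"
  using P.aut_H_tens P.lact_H_tens P.ract_H_tens assms by (simp_all add: AC_simps(1))

definition "comultAC = tensor_lift k AC2
            (\<lambda>a c. tensor_lift k AC2
              (\<lambda>c1 c2. tens2 (tens k A C (aut_inv A \<alpha> a) c1) (tens k A C \<one>\<^bsub>A\<^esub> c2)) (\<Delta>C c))"

definition "counitAC = tensor_lift k A (\<lambda>a c. \<epsilon>C c \<odot>\<^bsub>A\<^esub> \<alpha> a)"

lemma comultAC_body: "(\<lambda>a c. SC AC2 (\<lambda>c1 c2. tens2 (tens k A C (\<alpha>' a) c1) (tens k A C \<one>\<^bsub>A\<^esub> c2)) c) \<in> bilinear_maps k A C AC2"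
  by (simp add: linearity tens2_linear)

lemma comultAC_linear: "comultAC \<in> linear_maps k T AC2"
  unfolding comultAC_def SC_def[symmetric] by (rule tensor_lift_linear[OF modules(1,3) AC2_module comultAC_body])

lemma comultAC_tens: "\<lbrakk>a \<in> carrier A; c \<in> carrier C\<rbrakk>
    \<Longrightarrow> comultAC (tens k A C a c) = SC AC2 (\<lambda>c1 c2. tens2 (tens k A C (\<alpha>' a) c1) (tens k A C \<one>\<^bsub>A\<^esub> c2)) c"
  unfolding comultAC_def SC_def[symmetric] by (rule tensor_lift_tens[OF modules(1,3) AC2_module comultAC_body])

lemma counitAC_body: "(\<lambda>a c. \<epsilon>C c \<odot>\<^bsub>A\<^esub> \<alpha> a) \<in> bilinear_maps k A C A"
  by (simp add: linearity)

lemma counitAC_linear: "counitAC \<in> linear_maps k T A"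
  unfolding counitAC_def by (rule tensor_lift_linear[OF modules(1,3,1) counitAC_body])

lemma counitAC_tens: "\<lbrakk>a \<in> carrier A; c \<in> carrier C\<rbrakk> \<Longrightarrow> counitAC (tens k A C a c) = \<epsilon>C c \<odot>\<^bsub>A\<^esub> \<alpha> a"
  unfolding counitAC_def by (rule tensor_lift_tens[OF modules(1,3,1) counitAC_body])

text \<open>
  Since \<open>x \<otimes> \<gamma>(d) = x(1 \<otimes> d)\<close>, the element \<open>x\<close> can be moved across \<open>\<otimes>\<^sub>A\<close>, where it acts on the first factor
  from the right and so picks up the coaction of \<open>c\<close>.
\<close>

lemma tens2_balance:
  assumes "a \<in> carrier A" "x \<in> carrier A" "c \<in> carrier C" "d \<in> carrier C"
  shows "tens2 (tens k A C a (\<gamma> c)) (tens k A C x (\<gamma> d)) =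
    SX AC2 (\<lambda>b c0. tens2 (tens k A C (\<alpha>' a \<otimes>\<^bsub>A\<^esub> act b (\<alpha>' (\<alpha>' x))) (\<gamma> (\<gamma> c0))) (tens k A C \<one>\<^bsub>A\<^esub> (\<gamma> d))) c"
  using P.hom_tens_balanced[of "tens k A C (\<alpha>' a) c" x "tens k A C \<one>\<^bsub>A\<^esub> d"] assms
  by (simp add: linearity sweedler_normal AC_simps(1) AC_tens tens2_push tens2_linear)

text \<open>
  The left side is a coaction followed by a comultiplication of \<open>C\<close>. On the right side, the scalar acts on the
  second factor and \<open>tens2_balance\<close> produces a coaction on each of \<open>c\<^sub>1\<close> and \<open>c\<^sub>2\<close>. The
  comodule coalgebra axiom identifies the two, up to the order of the two coaction sums.
\<close>

lemma comultAC_ract: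
  assumes "x \<in> carrier T" "a \<in> carrier A"
  shows "comultAC (ract AC x a) = ract AC2 (comultAC x) a"
proof (rule T_ext[OF AC2_module linear_comp[OF comultAC_linear AC_linear(2)[OF assms(2)]]
      linear_comp[OF AC2_linear(3)[OF assms(2)] comultAC_linear] _ assms(1)])
  fix a' c assume *: "a' \<in> carrier A" "c \<in> carrier C"
  let ?F = "\<lambda>b1 c10 b2 c20. tens2 (tens k A C (\<alpha>' a' \<otimes>\<^bsub>A\<^esub> act (\<beta>' b1 \<otimes>\<^bsub>B\<^esub> \<beta>' b2) (\<alpha>' (\<alpha>' (\<alpha>' a)))) (\<gamma> (\<gamma> c10)))
    (tens k A C \<one>\<^bsub>A\<^esub> (\<gamma> (\<gamma> c20)))"
  have "comultAC (ract AC (tens k A C a' c) a) = SC AC2 (\<lambda>x y. SX AC2 (\<lambda>b1 x0. SX AC2 (\<lambda>b2 y0. ?F b1 x0 b2 y0) y) x) c"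
    using * assms(2) coact_comult[of AC2 c "\<lambda>b x y. tens2 (tens k A C (\<alpha>' a' \<otimes>\<^bsub>A\<^esub> act (\<beta>' b) (\<alpha>' (\<alpha>' (\<alpha>' a)))) (\<gamma> (\<gamma> x)))
        (tens k A C \<one>\<^bsub>A\<^esub> (\<gamma> (\<gamma> y)))"]
    by (simp add: linearity sweedler_normal AC_tens comultAC_tens comultAC_linear[THEN SX_push] tens2_push tens2_linear)
  also have "\<dots> = SC AC2 (\<lambda>x y. SX AC2 (\<lambda>b2 y0. SX AC2 (\<lambda>b1 x0. ?F b1 x0 b2 y0) x) y) c"
    by (rule SC_cong[OF refl *(2)], rule SX_swap) (simp_all add: linearity tens2_linear * assms(2))
  also have "\<dots> = SC AC2 (\<lambda>x y. SX AC2 (\<lambda>b2 y0. tens2 (tens k A C a' (\<gamma> x))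
      (tens k A C (act (\<beta> b2) (\<alpha>' (\<alpha>' a))) (\<gamma> (\<gamma> y0)))) y) c"
    by (rule SC_cong[OF refl *(2)], rule SX_cong[OF refl], assumption, subst tens2_balance)
      (simp_all add: linearity sweedler_normal tens2_linear * assms(2))
  also have "\<dots> = ract AC2 (comultAC (tens k A C a' c)) a"
    using * assms(2) by (simp add: linearity sweedler_normal AC_tens comultAC_tens AC2_tens tens2_push tens2_linear)
  finally show "comultAC (ract AC (tens k A C a' c) a) = ract AC2 (comultAC (tens k A C a' c)) a" .
qed

lemma comultAC_bimodule_map: "comultAC \<in> bimodule_maps k A AC AC2"
proof -
  have "comultAC (aut AC x) = aut AC2 (comultAC x)" if "x \<in> carrier T" for x
    by (rule T_ext[OF AC2_module linear_comp[OF comultAC_linear aut_AC_linear] linear_comp[OF AC2_linear(1) comultAC_linear] _ that])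
      (simp add: linearity sweedler_normal AC_tens comultAC_tens AC2_tens tens2_push tens2_linear)
  moreover have "comultAC (lact AC a x) = lact AC2 a (comultAC x)" if "a \<in> carrier A" "x \<in> carrier T" for a x
    by (rule T_ext[OF AC2_module linear_comp[OF comultAC_linear AC_linear(1)] linear_comp[OF AC2_linear(2) comultAC_linear] _ that(2)])
      (use that in \<open>simp_all add: linearity sweedler_normal AC_tens comultAC_tens AC2_tens tens2_push tens2_linear\<close>)
  ultimately show ?thesis
    using comultAC_ract comultAC_linear by (simp add: bimodule_maps_def AC_simps)
qed

lemma counitAC_bimodule_map: "counitAC \<in> bimodule_maps k A AC (regular_bimod A \<alpha>)"
proof -
  have "counitAC (aut AC x) = \<alpha> (counitAC x)" if "x \<in> carrier T" for x
    by (rule T_ext[OF modules(1) linear_comp[OF counitAC_linear aut_AC_linear] linear_comp[OF aut_linears(1) counitAC_linear] _ that])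
      (simp add: linearity sweedler_normal AC_tens counitAC_tens)
  moreover have "counitAC (lact AC a x) = a \<otimes>\<^bsub>A\<^esub> counitAC x" if "a \<in> carrier A" "x \<in> carrier T" for a x
    by (rule T_ext[OF modules(1) linear_comp[OF counitAC_linear AC_linear(1)] linear_comp[OF bilinear_right[OF multA_bilinear] counitAC_linear] _ that(2)])
      (use that in \<open>simp_all add: linearity sweedler_normal AC_tens counitAC_tens\<close>)
  moreover have "counitAC (ract AC x a) = counitAC x \<otimes>\<^bsub>A\<^esub> a" if "a \<in> carrier A" "x \<in> carrier T" for a x
  proof (rule T_ext[OF modules(1) linear_comp[OF counitAC_linear AC_linear(2)] linear_comp[OF bilinear_left[OF multA_bilinear] counitAC_linear] _ that(2)])
    fix a' c assume *: "a' \<in> carrier A" "c \<in> carrier C"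
    show "counitAC (ract AC (tens k A C a' c) a) = counitAC (tens k A C a' c) \<otimes>\<^bsub>A\<^esub> a"
      using * that coact_counitC[of A c "\<lambda>b. \<alpha> a' \<otimes>\<^bsub>A\<^esub> act (\<beta> b) (\<alpha>' a)"]
      by (simp add: linearity sweedler_normal AC_tens counitAC_tens counitAC_linear[THEN SX_push])
  qed (use that in auto)
  ultimately show ?thesis
    using counitAC_linear by (simp add: bimodule_maps_def AC_simps regular_bimod_def)
qed

interpretation Q: hom_bimodule_comult k A \<alpha> AC comultAC
  by (intro hom_bimodule_comult.intro hom_bimodule_comult_axioms.intro AC_bimodule comultAC_bimodule_map)

abbreviation "AC3 \<equiv> hom_tensor k A \<alpha> AC AC2"
abbreviation "tens3 \<equiv> hom_tens k A AC AC2"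

lemma tens3_bilinear: "tens3 \<in> bilinear_maps k T AC2 AC3"
  using Q.triple.hom_tens_bilinear by (simp add: bilinear_AC)

lemma counitAC_bimodule:
  "x \<in> carrier T \<Longrightarrow> counitAC (aut AC x) = \<alpha> (counitAC x)"
  "\<lbrakk>a \<in> carrier A; x \<in> carrier T\<rbrakk> \<Longrightarrow> counitAC (lact AC a x) = a \<otimes>\<^bsub>A\<^esub> counitAC x"
  "\<lbrakk>a \<in> carrier A; x \<in> carrier T\<rbrakk> \<Longrightarrow> counitAC (ract AC x a) = counitAC x \<otimes>\<^bsub>A\<^esub> a"
  using counitAC_bimodule_map by (auto simp: bimodule_maps_def regular_bimod_def AC_simps)

lemmas counitAC_closed = linear_closed[OF counitAC_linear]

lemma counit_left_balanced: "(\<lambda>x1 x2. lact AC (counitAC x1) x2) \<in> balanced_maps k A AC AC T"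
  using left_hom_module.hom_lact_assoc[of k A \<alpha> AC "aut AC" "lact AC"] AC_bimodule
  by (auto simp: balanced_maps_def bilinear_AC AC_simps(1) counitAC_bimodule counitAC_closed closed hom_bimodule_def
    intro!: bilinear_mapsI AC_linear bilinear_comp_left[OF lact_AC_bilinear] counitAC_linear)

lemma counit_right_balanced: "(\<lambda>x1 x2. ract AC x1 (counitAC x2)) \<in> balanced_maps k A AC AC T"
  using right_hom_module.hom_ract_assoc[of k A \<alpha> AC "aut AC" "ract AC"] AC_bimodule
  by (auto simp: balanced_maps_def bilinear_AC AC_simps(1) counitAC_bimodule counitAC_closed closed hom_bimodule_def
    intro!: bilinear_mapsI AC_linear bilinear_comp_right[OF ract_AC_bilinear] counitAC_linear)

lemmas tens2_lift_linear = P.hom_tensor_lift_linear and tens2_lift_tens = P.hom_tensor_lift_tens[unfolded AC_simps(1)]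

text \<open>
  Both counit laws and coassociativity are verified on \<open>a \<otimes> c\<close>, where they are the corresponding laws of \<open>C\<close>.
\<close>

theorem coring: "hom_coring k A \<alpha> AC comultAC counitAC"
proof (intro hom_coring.intro hom_coring_axioms.intro AC_bimodule comultAC_bimodule_map counitAC_bimodule_map)
  fix x assume "x \<in> carrier AC"
  then have x: "x \<in> carrier T" by (simp add: AC_simps(1))
  show "counitAC (aut AC x) = \<alpha> (counitAC x)" by (rule counitAC_bimodule(1)[OF x])
  show "comultAC (aut AC x) = hom_tensor_lift k AC2 (\<lambda>x1 x2. tens2 (aut AC x1) (aut AC x2)) (comultAC x)"
    using Q.D_aut[of x] x by (simp add: AC_simps(1) P.aut_H)
  show "hom_tensor_lift k AC (\<lambda>x1 x2. lact AC (counitAC x1) x2) (comultAC x) = x"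
    unfolding AC_simps(8)
  proof (rule T_ext[OF T_module linear_comp[OF tens2_lift_linear[OF T_module counit_left_balanced] comultAC_linear] linear_ident _ x])
    fix a c assume *: "a \<in> carrier A" "c \<in> carrier C"
    show "hom_tensor_lift k T (\<lambda>x1 x2. lact AC (counitAC x1) x2) (comultAC (tens k A C a c)) = tens k A C a c"
      using * comult_counit(1)[of T c "\<lambda>z. tens k A C a (\<gamma> z)"]
      by (simp add: linearity sweedler_normal AC_tens comultAC_tens counitAC_tens tens2_linear tens2_lift_tens[OF T_module counit_left_balanced]
        tens2_lift_linear[OF T_module counit_left_balanced, THEN SC_push] linear_smult[OF bilinear_left[OF lact_AC_bilinear]])
  qed
  show "hom_tensor_lift k AC (\<lambda>x1 x2. ract AC x1 (counitAC x2)) (comultAC x) = x"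
    unfolding AC_simps(8)
  proof (rule T_ext[OF T_module linear_comp[OF tens2_lift_linear[OF T_module counit_right_balanced] comultAC_linear] linear_ident _ x])
    fix a c assume *: "a \<in> carrier A" "c \<in> carrier C"
    have r1: "ract AC (tens k A C (\<alpha>' a) z) \<one>\<^bsub>A\<^esub> = tens k A C a (\<gamma> z)" if "z \<in> carrier C" for z
      using right_hom_module.hom_ract_one[of k A \<alpha> AC "aut AC" "ract AC" "tens k A C (\<alpha>' a) z"] AC_bimodule * that
      by (simp add: hom_bimodule_def AC_simps(1) linearity sweedler_normal AC_tens)
    show "hom_tensor_lift k T (\<lambda>x1 x2. ract AC x1 (counitAC x2)) (comultAC (tens k A C a c)) = tens k A C a c"
      using * comult_counit(2)[of T c "\<lambda>z. tens k A C a (\<gamma> z)"]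
      by (simp add: linearity sweedler_normal r1 comultAC_tens counitAC_tens tens2_linear tens2_lift_tens[OF T_module counit_right_balanced]
        tens2_lift_linear[OF T_module counit_right_balanced, THEN SC_push] linear_smult[OF bilinear_right[OF ract_AC_bilinear]])
  qed
  let ?R = "\<lambda>x1 x2. hom_tensor_lift k AC3 (\<lambda>x11 x12. tens3 (aut AC x11) (tens2 x12 (aut_inv AC (aut AC) x2))) (comultAC x1)"
  show "hom_tensor_lift k AC3 (\<lambda>x1 x2. tens3 x1 (comultAC x2)) (comultAC x) = hom_tensor_lift k AC3 ?R (comultAC x)"
  proof -
    note Km = Q.triple.H_module
    note l = Q.coassoc_left_balanced and r = Q.coassoc_right_balanced
    have inv_tens: "aut_inv AC (aut AC) (tens k A C a c) = tens k A C (\<alpha>' a) (\<gamma>' c)"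
      if "a \<in> carrier A" "c \<in> carrier C" for a c
      by (rule hom_object.aut_bar_eqI[OF AC_object]) (use that in \<open>simp_all add: AC_simps(1) linearity sweedler_normal AC_tens\<close>)
    note i = Q.coassoc_inner_balanced[unfolded AC_simps(1)]
    note tens3_linear = Km bilinear_comp_left[OF tens3_bilinear] bilinear_comp_right[OF tens3_bilinear] bilinear_closed[OF tens3_bilinear]
    note lifts = tens2_lift_tens[OF Km l] tens2_lift_tens[OF Km r] tens2_lift_tens[OF Km i]
    note sc = tens2_lift_linear[OF Km l, THEN SC_push] tens2_lift_linear[OF Km r, THEN SC_push]
      tens2_lift_linear[OF Km i, THEN SC_push] bilinear_right[OF tens3_bilinear, THEN SC_push]
    show ?thesis
    proof (rule T_ext[OF Km linear_comp[OF tens2_lift_linear[OF Km l] comultAC_linear]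
          linear_comp[OF tens2_lift_linear[OF Km r] comultAC_linear] _ x])
      fix a c assume *: "a \<in> carrier A" "c \<in> carrier C"
      show "hom_tensor_lift k AC3 (\<lambda>x1 x2. tens3 x1 (comultAC x2)) (comultAC (tens k A C a c)) = hom_tensor_lift k AC3 ?R (comultAC (tens k A C a c))"
        using * comult_coassoc[of AC3 c "\<lambda>u v w. tens3 (tens k A C (\<alpha>' a) (\<gamma> u)) (tens2 (tens k A C \<one>\<^bsub>A\<^esub> v) (tens k A C \<one>\<^bsub>A\<^esub> w))"]
        by (simp add: linearity sweedler_normal comultAC_tens inv_tens AC_tens tens2_linear tens3_linear lifts sc)
    qed
  qed
qed

end

section \<open>The Hom-entwining structure, its modules and its Hom-coring\<close>

theorem proposition4p15:
  fixes k :: "('k, 'r) ring_scheme"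
    and B :: "('k, 'b, 'x) module_scheme" and \<beta> :: "'b \<Rightarrow> 'b"
    and \<Delta>B :: "'b \<Rightarrow> ('k, 'b, 'b) tensor" and \<epsilon>B :: "'b \<Rightarrow> 'k"
    and A :: "('k, 'a, 'y) module_scheme" and \<alpha> :: "'a \<Rightarrow> 'a"
    and act :: "'b \<Rightarrow> 'a \<Rightarrow> 'a"
    and C :: "('k, 'c, 'z) module_scheme" and \<gamma> :: "'c \<Rightarrow> 'c"
    and \<Delta>C :: "'c \<Rightarrow> ('k, 'c, 'c) tensor" and \<epsilon>C :: "'c \<Rightarrow> 'k"
    and coact :: "'c \<Rightarrow> ('k, 'b, 'c) tensor"
    and \<psi> :: "('k, 'c, 'a) tensor \<Rightarrow> ('k, 'a, 'c) tensor"
  assumes "monoidal_hom_bialgebra k B \<beta> \<Delta>B \<epsilon>B"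
    and "left_hom_module_algebra k B \<beta> \<Delta>B \<epsilon>B A \<alpha> act"
    and "left_hom_comodule_coalgebra k B \<beta> \<Delta>B \<epsilon>B C \<gamma> \<Delta>C \<epsilon>C coact"
    and psi_eq: "\<psi> = tensor_lift k (tensor k A C)
      (\<lambda>c a. tensor_lift k (tensor k A C)
        (\<lambda>b c0. tens k A C (act b (aut_inv A \<alpha> a)) (\<gamma> c0)) (coact c))"
  shows "hom_entwining k A \<alpha> C \<gamma> \<Delta>C \<epsilon>C \<psi> \<and>
    (\<forall>(M :: ('k, 'm, 'w) module_scheme) (\<mu> :: 'm \<Rightarrow> 'm) (ra :: 'm \<Rightarrow> 'a \<Rightarrow> 'm)
          (\<rho> :: 'm \<Rightarrow> ('k, 'm, 'c) tensor).
      entwined_hom_module k A \<alpha> C \<gamma> \<Delta>C \<epsilon>C \<psi> M \<mu> ra \<rho> \<longleftrightarrow>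
        right_hom_module k A \<alpha> M \<mu> ra \<and>
        right_hom_comodule k C \<gamma> \<Delta>C \<epsilon>C M \<mu> \<rho> \<and>
        (\<forall>m\<in>carrier M. \<forall>a\<in>carrier A.
          \<rho> (ra m a) =
          tensor_lift k (tensor k M C)
            (\<lambda>m0 m1. tensor_lift k (tensor k M C)
              (\<lambda>b c0. tens k M C (ra m0 (act b (aut_inv A \<alpha> (aut_inv A \<alpha> a)))) (\<gamma> (\<gamma> c0)))
              (coact m1))
            (\<rho> m))) \<and>
    (let AC = hom_bimod_of (tensor k A C) (tensor_map k A C \<alpha> \<gamma>)
            (\<lambda>a. tensor_lift k (tensor k A C)
              (\<lambda>a' c. tens k A C (aut_inv A \<alpha> a \<otimes>\<^bsub>A\<^esub> a') (\<gamma> c)))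
            (\<lambda>x a. tensor_lift k (tensor k A C)
              (\<lambda>a' c. tensor_lift k (tensor k A C)
                (\<lambda>b c0. tens k A C (a' \<otimes>\<^bsub>A\<^esub> act b (aut_inv A \<alpha> (aut_inv A \<alpha> a))) (\<gamma> (\<gamma> c0)))
                (coact c)) x)
      in hom_coring k A \<alpha> AC
          (tensor_lift k (hom_tensor k A \<alpha> AC AC)
            (\<lambda>a c. tensor_lift k (hom_tensor k A \<alpha> AC AC)
              (\<lambda>c1 c2. hom_tens k A AC AC (tens k A C (aut_inv A \<alpha> a) c1) (tens k A C \<one>\<^bsub>A\<^esub> c2))
              (\<Delta>C c)))
          (tensor_lift k A (\<lambda>a c. \<epsilon>C c \<odot>\<^bsub>A\<^esub> \<alpha> a)))"
proof -
  interpret S: module_comodule_datum k B \<beta> \<Delta>B \<epsilon>B A \<alpha> act C \<gamma> \<Delta>C \<epsilon>C coact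
    by (intro module_comodule_datum.intro assms(2,3))
  have psi: "\<psi> = S.\<psi>"
    unfolding psi_eq S.\<psi>_def ..
  have part2: "entwined_hom_module k A \<alpha> C \<gamma> \<Delta>C \<epsilon>C S.\<psi> M \<mu> ra \<rho> \<longleftrightarrow>
        right_hom_module k A \<alpha> M \<mu> ra \<and>
        right_hom_comodule k C \<gamma> \<Delta>C \<epsilon>C M \<mu> \<rho> \<and>
        (\<forall>m\<in>carrier M. \<forall>a\<in>carrier A.
          \<rho> (ra m a) =
          tensor_lift k (tensor k M C)
            (\<lambda>m0 m1. tensor_lift k (tensor k M C)
              (\<lambda>b c0. tens k M C (ra m0 (act b (aut_inv A \<alpha> (aut_inv A \<alpha> a)))) (\<gamma> (\<gamma> c0)))
              (coact m1))
            (\<rho> m))"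
    for M :: "('k, 'm, 'w) module_scheme" and \<mu> ra \<rho>
    using S.entwining S.entwined_condition[of M \<mu> ra \<rho>]
    by (auto simp: entwined_hom_module_def entwined_hom_module_axioms_def)
  show ?thesis
    using S.entwining part2 S.coring
    unfolding psi Let_def S.comultAC_def S.counitAC_def S.AC_def by blast
qed

end
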